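(* Suppose that the following two assumptions hold. Assumption 1 (holomorphic flow). The vector field $F:\mathbb D^n\cup\mathbb T^n\to\mathbb C^n$ is holomorphic on $\mathbb D^n$ and continuous on $\mathbb T^n$, and generates a flow $\mathbb R^+\times\mathbb D^n\to\mathbb D^n$, $(t,\mathbf z)\mapsto\varphi^t(\mathbf z)$ which, for all $t\geqslant0$, is holomorphic on $\mathbb D^n$. Assumption 2 (forward invariance). For all $t>0$ there exists $R_t\in(0,1)$ such that $\varphi^t(\mathbf z)\in D(\mathbf 0,R_t)^n$ for all $\mathbf z\in\mathbb T^n$. Let $\mathbf x_0\in\mathbb D^n$. Then the dual Koopman system $$\dot f(t)=A_F^*f(t),\quad f(0)=k_{\mathbf x_0},\qquad \mathbf y(t)=C_hf(t)$$ admits a unique pseudo-weak solution on $\mathbb H^2(\mathbb D^n)$, which is given by $$f(t)=K(t)^*k_{\mathbf x_0}=k_{\varphi^t(\mathbf x_0)},\quad t\geqslant0.$$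
   Context: $\mathbb D^n$ is the open unit polydisc in $\mathbb C^n$, $\mathbb T^n=\{\mathbf z:|z_k|=1\ \forall k\}$, $D(\mathbf 0,R)^n=\{\mathbf z:|z_k|<R\ \forall k\}$; in Assumption 2 the flow is understood as extended continuously to $\mathbb T^n$. The Hardy space $\mathbb H^2(\mathbb D^n)$ is the Hilbert space of holomorphic $f:\mathbb D^n\to\mathbb C$ with $\|f\|^2=\lim_{r\to1^-}\int_{\mathbb T^n}|f(r\mathbf w)|^2dm_n(\mathbf w)<\infty$ ($m_n$ normalized Lebesgue measure on $\mathbb T^n$) and inner product $\langle f,g\rangle=\lim_{r\to1^-}\int_{\mathbb T^n}f(r\mathbf w)\overline{g(r\mathbf w)}\,dm_n(\mathbf w)$. It is a reproducing kernel Hilbert space with reproducing functions $k_{\mathbf z_0}(\mathbf z)=\prod_{i=1}^n(1-\overline{z_{0,i}}z_i)^{-1}$, so $\langle f,k_{\mathbf z_0}\rangle=f(\mathbf z_0)$. $K(t)f=f\circ\varphi^t$ is the Koopman operator and $K(t)^*$ its adjoint. $A_Ff=F\cdot\nabla f=\sum_kF_k\,\partial f/\partial x_k$ with domain $D(A_F)=\{f\in\mathbb H^2(\mathbb D^n):F\cdot\nabla f\in\mathbb H^2(\mathbb D^n)\}$; $A_F$ and its adjoint $A_F^*$ are closed and densely defined. The output operator is $C_hg=(\langle g,h_1\rangle,\dots,\langle g,h_m\rangle)^T$ for $h=(h_1,\dots,h_m)\in\mathbb H^2(\mathbb D^n)^m$. A pseudo-weak solution of $\dot f=Af+\Gamma(t)$,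 $f(0)=f_0\in\mathrm{span}\{k_{\mathbf x}:\mathbf x\in\mathbb D^n\}$ ($A$ closed and densely defined on $X=\mathbb H^2(\mathbb D^n)$, $\Gamma(t)\in X$) is a function $f$ with $f(0)=f_0$ such that (1) $f\in C([0,\tau],X)$ for all $\tau>0$; (2) $t\mapsto\langle f(t),g\rangle$ is absolutely continuous for all $g\in D(A^* )$; (3) for all $g\in D(A^* )$, $\frac{d}{dt}\langle f(t),g\rangle=\langle f(t),A^*g\rangle+\langle\Gamma(t),g\rangle$. Here $A=A_F^*$, $A^*=A_F$, $\Gamma=0$. *)

theory Defs
  imports "HOL-Analysis.Analysis"
begin

type_synonym 'n cfun = "complex ^ 'n \<Rightarrow> complex"

definition polydisc :: "real \<Rightarrow> (complex ^ 'n) set" where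
  "polydisc R = {z. \<forall>k. cmod (z $ k) < R}"

abbreviation unit_polydisc :: "(complex ^ 'n) set" where
  "unit_polydisc \<equiv> polydisc 1"

definition torus :: "(complex ^ 'n) set" where
  "torus = {z. \<forall>k. cmod (z $ k) = 1}"

text \<open>Normalized Lebesgue measure on the torus: the image of the uniform distribution on
  the cube of angles.\<close>
definition torus_measure :: "(complex ^ 'n::finite) measure" where
  "torus_measure = distr (uniform_measure lborel {\<theta> :: real ^ 'n. \<forall>k. 0 \<le> \<theta> $ k \<and> \<theta> $ k \<le> 2 * pi})
                     borel (\<lambda>\<theta>. \<chi> k. cis (\<theta> $ k))"

text \<open>Holomorphy in several variables on an open set: total differentiability with a
  \<^emph>\<open>complex\<close>-linear derivative.\<close>
definition cn_holomorphic_on :: "'n::finite cfun \<Rightarrow> (complex ^ 'n) set \<Rightarrow> bool" where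
  "cn_holomorphic_on f S \<longleftrightarrow>
     (\<forall>z\<in>S. \<exists>L. (f has_derivative L) (at z) \<and> (\<forall>c v. L (c *s v) = c * L v))"

definition cn_map_holomorphic_on ::
    "(complex ^ 'n::finite \<Rightarrow> complex ^ 'n) \<Rightarrow> (complex ^ 'n) set \<Rightarrow> bool" where
  "cn_map_holomorphic_on G S \<longleftrightarrow> (\<forall>k. cn_holomorphic_on (\<lambda>z. G z $ k) S)"

definition partial_deriv :: "'n \<Rightarrow> 'n cfun \<Rightarrow> 'n::finite cfun" where
  "partial_deriv k f z = deriv (\<lambda>w. f (\<chi> j. if j = k then w else z $ j)) (z $ k)"

text \<open>A function on the open unit polydisc is represented by its extension by zero, so that
  equality in the Hardy space is equality of HOL functions.\<close>
definition hardy_space :: "'n::finite cfun set" where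
  "hardy_space = {f. cn_holomorphic_on f unit_polydisc \<and> (\<forall>z. z \<notin> unit_polydisc \<longrightarrow> f z = 0) \<and>
     (\<exists>l::real. ((\<lambda>r. LINT w|torus_measure. (cmod (f (r *\<^sub>R w)))\<^sup>2) \<longlongrightarrow> l) (at_left 1))}"

definition hardy_norm :: "'n::finite cfun \<Rightarrow> real" where
  "hardy_norm f = sqrt (Lim (at_left 1) (\<lambda>r. LINT w|torus_measure. (cmod (f (r *\<^sub>R w)))\<^sup>2))"

definition hardy_inner :: "'n::finite cfun \<Rightarrow> 'n cfun \<Rightarrow> complex" where
  "hardy_inner f g =
     Lim (at_left 1) (\<lambda>r. LINT w|torus_measure. f (r *\<^sub>R w) * cnj (g (r *\<^sub>R w)))"

definition hardy_kernel :: "complex ^ 'n::finite \<Rightarrow> 'n cfun" where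
  "hardy_kernel x = (\<lambda>z. if z \<in> unit_polydisc then \<Prod>i\<in>UNIV. inverse (1 - cnj (x $ i) * z $ i) else 0)"

definition kernel_span :: "'n::finite cfun set" where
  "kernel_span = {(\<lambda>z. \<Sum>x\<in>S. c x * hardy_kernel x z) | S c. finite S \<and> S \<subseteq> unit_polydisc}"

text \<open>A possibly unbounded operator is given by its domain \<open>D\<close>, a subset of the Hardy space,
  and a map \<open>A\<close> whose values outside \<open>D\<close> are irrelevant. The value of the adjoint is
  meaningful on its domain, provided that \<open>D\<close> is dense.\<close>
definition adjoint_dom :: "'n::finite cfun set \<Rightarrow> ('n cfun \<Rightarrow> 'n cfun) \<Rightarrow> 'n cfun set" where
  "adjoint_dom D A = {g \<in> hardy_space.
     \<exists>u\<in>hardy_space. \<forall>f\<in>D. hardy_inner (A f) g = hardy_inner f u}"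

definition adjoint_op :: "'n::finite cfun set \<Rightarrow> ('n cfun \<Rightarrow> 'n cfun) \<Rightarrow> 'n cfun \<Rightarrow> 'n cfun" where
  "adjoint_op D A g =
     (THE u. u \<in> hardy_space \<and> (\<forall>f\<in>D. hardy_inner (A f) g = hardy_inner f u))"

definition koopman_op :: "(complex ^ 'n \<Rightarrow> complex ^ 'n) \<Rightarrow> 'n::finite cfun \<Rightarrow> 'n cfun" where
  "koopman_op \<psi> f = (\<lambda>z. if z \<in> unit_polydisc then f (\<psi> z) else 0)"

definition koopman_gen :: "(complex ^ 'n \<Rightarrow> complex ^ 'n) \<Rightarrow> 'n::finite cfun \<Rightarrow> 'n cfun" where
  "koopman_gen F f =
     (\<lambda>z. if z \<in> unit_polydisc then \<Sum>k\<in>UNIV. F z $ k * partial_deriv k f z else 0)"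

definition koopman_gen_dom :: "(complex ^ 'n \<Rightarrow> complex ^ 'n) \<Rightarrow> 'n::finite cfun set" where
  "koopman_gen_dom F = {f \<in> hardy_space. koopman_gen F f \<in> hardy_space}"

definition output_op :: "('m \<Rightarrow> 'n::finite cfun) \<Rightarrow> 'n cfun \<Rightarrow> complex ^ 'm::finite" where
  "output_op h g = (\<chi> j. hardy_inner g (h j))"

definition abs_continuous_on_interval :: "real \<Rightarrow> real \<Rightarrow> (real \<Rightarrow> complex) \<Rightarrow> bool" where
  "abs_continuous_on_interval a b u \<longleftrightarrow>
     (\<forall>\<epsilon>>0. \<exists>\<delta>>0. \<forall>(N::nat) l r.
        (\<forall>i<N. a \<le> l i \<and> l i \<le> r i \<and> r i \<le> b) \<longrightarrow>
        disjoint_family_on (\<lambda>i. {l i<..<r i}) {..<N} \<longrightarrow>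
        (\<Sum>i<N. r i - l i) < \<delta> \<longrightarrow>
        (\<Sum>i<N. cmod (u (r i) - u (l i))) < \<epsilon>)"

definition hardy_continuous_on :: "real set \<Rightarrow> (real \<Rightarrow> 'n::finite cfun) \<Rightarrow> bool" where
  "hardy_continuous_on I f \<longleftrightarrow>
     (\<forall>t\<in>I. f t \<in> hardy_space \<and> ((\<lambda>s. hardy_norm (\<lambda>z. f s z - f t z)) \<longlongrightarrow> 0) (at t within I))"

text \<open>Pseudo-weak solutions of \<open>f' = A f + \<Gamma>(t)\<close>, \<open>f(0) = f0\<close>, where \<open>A\<close> has domain \<open>D\<close>.
  Only nonnegative times matter; the derivative at time \<open>0\<close> is one-sided.\<close>
definition pseudo_weak_solution ::
    "'n::finite cfun set \<Rightarrow> ('n cfun \<Rightarrow> 'n cfun) \<Rightarrow> (real \<Rightarrow> 'n cfun) \<Rightarrow> 'n cfun \<Rightarrow>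
     (real \<Rightarrow> 'n cfun) \<Rightarrow> bool" where
  "pseudo_weak_solution D A \<Gamma> f0 f \<longleftrightarrow>
     f0 \<in> kernel_span \<and> f 0 = f0 \<and>
     (\<forall>\<tau>>0. hardy_continuous_on {0..\<tau>} f) \<and>
     (\<forall>g\<in>adjoint_dom D A. \<forall>\<tau>>0. abs_continuous_on_interval 0 \<tau> (\<lambda>t. hardy_inner (f t) g)) \<and>
     (\<forall>g\<in>adjoint_dom D A. \<forall>t\<ge>0.
        ((\<lambda>s. hardy_inner (f s) g) has_vector_derivative
           hardy_inner (f t) (adjoint_op D A g) + hardy_inner (\<Gamma> t) g) (at t within {0..}))"

definition dual_koopman_solution ::
    "(complex ^ 'n \<Rightarrow> complex ^ 'n) \<Rightarrow> ('m \<Rightarrow> 'n::finite cfun) \<Rightarrow> complex ^ 'n \<Rightarrow>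
     (real \<Rightarrow> 'n cfun) \<Rightarrow> (real \<Rightarrow> complex ^ 'm::finite) \<Rightarrow> bool" where
  "dual_koopman_solution F h x\<^sub>0 f y \<longleftrightarrow>
     pseudo_weak_solution
       (adjoint_dom (koopman_gen_dom F) (koopman_gen F))
       (adjoint_op (koopman_gen_dom F) (koopman_gen F))
       (\<lambda>t z. 0) (hardy_kernel x\<^sub>0) f \<and>
     (\<forall>t\<ge>0. y t = output_op h (f t))"

text \<open>\<open>F\<close> is required to be jointly continuous on the union of the open polydisc and the torus,
  not merely to have a continuous restriction to the torus.\<close>
definition holomorphic_flow ::
    "(complex ^ 'n \<Rightarrow> complex ^ 'n) \<Rightarrow> (real \<Rightarrow> complex ^ 'n \<Rightarrow> complex ^ 'n::finite) \<Rightarrow> bool" where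
  "holomorphic_flow F \<phi> \<longleftrightarrow>
     cn_map_holomorphic_on F unit_polydisc \<and> continuous_on (unit_polydisc \<union> torus) F \<and>
     (\<forall>t\<ge>0. \<phi> t ` unit_polydisc \<subseteq> unit_polydisc \<and> cn_map_holomorphic_on (\<phi> t) unit_polydisc) \<and>
     (\<forall>z\<in>unit_polydisc. \<phi> 0 z = z \<and>
        (\<forall>s\<ge>0. \<forall>t\<ge>0. \<phi> (s + t) z = \<phi> s (\<phi> t z)) \<and>
        (\<forall>t\<ge>0. ((\<lambda>s. \<phi> s z) has_vector_derivative F (\<phi> t z)) (at t within {0..})))"

text \<open>On the torus, the flow map means the (unique) continuous extension \<open>\<psi>\<close> of \<open>\<phi> t\<close>.\<close>
definition forward_invariant_torus :: "(real \<Rightarrow> complex ^ 'n \<Rightarrow> complex ^ 'n::finite) \<Rightarrow> bool" where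
  "forward_invariant_torus \<phi> \<longleftrightarrow>
     (\<forall>t>0. \<exists>\<psi>. continuous_on (unit_polydisc \<union> torus) \<psi> \<and> (\<forall>z\<in>unit_polydisc. \<psi> z = \<phi> t z) \<and>
        (\<exists>R. 0 < R \<and> R < 1 \<and> \<psi> ` torus \<subseteq> polydisc R))"

end

theory Submission
  imports Defs "HOL-Complex_Analysis.Cauchy_Integral_Formula"
begin

text \<open>The reproducing kernels \<open>k\<^sub>x\<close> lie both in the domain of \<open>A\<^sub>F\<close> and in that of \<open>A\<^sub>F\<^sup>*\<close>, where
  \<open>\<langle>f, A\<^sub>F\<^sup>* k\<^sub>x\<rangle> = (A\<^sub>F f) x\<close> is a directional derivative of \<open>f\<close> at \<open>x\<close>. Testing against kernels shows that
  \<open>A\<^sub>F\<^sup>*\<^sup>* = A\<^sub>F\<close>, and the chain rule along the orbit of \<open>x\<^sub>0\<close> shows that \<open>t \<mapsto> k\<^bsub>\<phi> t x\<^sub>0\<^esub>\<close> is a solution.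
  For uniqueness, the time reversed orbit \<open>s \<mapsto> K (t - s) k\<^sub>y\<close> is used as a test function. It is
  differentiable in the supremum norm, because \<open>F\<close> is bounded by the maximum principle and because,
  by forward invariance, \<open>\<phi> t\<close> maps the polydisc into a compact subset for \<open>t > 0\<close>.\<close>

subsection \<open>Means over the torus\<close>

text \<open>The Hardy norm and the inner product are written with \<open>Lim\<close>, so they carry
  no information until the radial limits are shown to exist. This is why the Poisson formula
  precedes the Hardy space: it makes radial means increasing, so that a bound already implies
  membership, and polarization then gives the inner product.

  A solution \<open>f\<close> is only continuous in norm and differentiable against fixed test
  functions. The product rule for \<open><f s, Q s>\<close> with a moving \<open>Q\<close> therefore
  has to take its strength from \<open>Q\<close>; the supremum norm is the right one because an
  inner product is at most a supremum norm times a Hardy norm. The two terms of the product rule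
  cancel because the generator commutes with \<open>K\<close>. Invariance speaks of positive times,
  so differentiability is obtained strictly between 0 and \<open>t\<close>, and the end points are
  reached by continuity alone.\<close>

definition torus_pt :: "real ^ 'n \<Rightarrow> complex ^ 'n::finite" where
  "torus_pt \<theta> = (\<chi> k. cis (\<theta> $ k))"

abbreviation angle_cube :: "(real ^ 'n::finite) set" where
  "angle_cube \<equiv> cbox 0 (\<chi> k. 2 * pi)"

text \<open>An integral over a compact box in place of \<open>torus_measure\<close>: continuity on
  the torus gives integrability, and Fubini on boxes applies. \<open>LINT_torus_measure\<close> is
  the bridge.\<close>

definition torus_mean :: "(complex ^ 'n::finite \<Rightarrow> 'b::euclidean_space) \<Rightarrow> 'b" where
  "torus_mean G = integral angle_cube (\<lambda>\<theta>. G (torus_pt \<theta>)) /\<^sub>R measure lborel (angle_cube :: (real ^ 'n) set)"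

lemma torus_pt_in_torus [simp]: "torus_pt \<theta> \<in> torus"
  by (simp add: torus_pt_def torus_def)

lemma torus_pt_nth [simp]: "torus_pt \<theta> $ k = cis (\<theta> $ k)"
  by (simp add: torus_pt_def)

lemma continuous_on_torus_pt [continuous_intros]: "continuous_on S torus_pt"
  unfolding torus_pt_def by (intro continuous_intros continuous_on_vec_lambda)

lemma content_angle_cube_pos: "0 < measure lborel (angle_cube :: (real ^ 'n::finite) set)"
proof -
  have "box 0 (\<chi> k. 2 * pi) \<noteq> ({} :: (real ^ 'n) set)"
    by (simp add: interval_ne_empty_cart)
  then show ?thesis
    by (simp add: content_eq_0_interior zero_less_measure_iff interior_cbox order.strict_iff_order)
qed

lemma continuous_on_comp_torus_pt:
  assumes "continuous_on torus G"
  shows "continuous_on S (\<lambda>\<theta>. G (torus_pt \<theta>))"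
  by (rule continuous_on_compose2[OF assms]) (auto intro: continuous_intros)

lemma torus_pt_integrable:
  fixes G :: "complex ^ 'n::finite \<Rightarrow> 'b::euclidean_space"
  assumes "continuous_on torus G"
  shows "(\<lambda>\<theta>. G (torus_pt \<theta>)) integrable_on angle_cube"
  by (intro integrable_continuous continuous_on_comp_torus_pt assms)

text \<open>Change of variables along \<open>torus_pt\<close>, then the constant density of the
  uniform measure on the cube. Measurability is global while continuity is asked for on the torus
  alone, which suits functions extended by zero.\<close>

lemma LINT_torus_measure:
  fixes G :: "complex ^ 'n::finite \<Rightarrow> 'b::euclidean_space"
  assumes [measurable]: "G \<in> borel_measurable borel" and cont: "continuous_on torus G"
  shows "(LINT w|torus_measure. G w) = torus_mean G"
proof -
  let ?Q = "angle_cube :: (real ^ 'n) set"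
  let ?c = "measure lborel ?Q"
  have Q: "{\<theta> :: real ^ 'n. \<forall>k. 0 \<le> \<theta> $ k \<and> \<theta> $ k \<le> 2 * pi} = ?Q"
    by (auto simp: mem_box_cart)
  have c: "?c > 0"
    by (rule content_angle_cube_pos)
  have em: "emeasure lborel ?Q = ennreal ?c"
    using emeasure_lborel_cbox_finite[of "0 :: real ^ 'n" "\<chi> k. 2 * pi"]
    by (intro emeasure_eq_ennreal_measure) (metis infinity_ennreal_def less_irrefl)
  have um: "uniform_measure lborel ?Q = density lborel (\<lambda>x. ennreal (indicator ?Q x / ?c))"
    unfolding uniform_measure_def using c em
    by (intro arg_cong[where f = "density lborel"] ext)
      (simp split: split_indicator add: divide_ennreal[symmetric] ennreal_1[symmetric] del: ennreal_1)
  have [measurable]: "(torus_pt :: real ^ 'n \<Rightarrow> _) \<in> borel_measurable borel"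
    by (intro borel_measurable_continuous_onI continuous_intros)
  have tm: "torus_measure = distr (uniform_measure lborel ?Q) borel (torus_pt :: real ^ 'n \<Rightarrow> _)"
    unfolding torus_measure_def Q torus_pt_def ..
  have "(LINT w|torus_measure. G w) = (LINT \<theta>|uniform_measure lborel ?Q. G (torus_pt \<theta>))"
    unfolding tm by (intro integral_distr) measurable
  also have "\<dots> = (LINT \<theta>|lborel. (indicator ?Q \<theta> / ?c) *\<^sub>R G (torus_pt \<theta>))"
    unfolding um using c by (intro integral_density) auto
  also have "\<dots> = (LINT \<theta>|lborel. (1 / ?c) *\<^sub>R (indicator ?Q \<theta> *\<^sub>R G (torus_pt \<theta>)))"
    by (intro Bochner_Integration.integral_cong) simp_all
  also have "\<dots> = (1 / ?c) *\<^sub>R (LINT \<theta>:?Q|lborel. G (torus_pt \<theta>))"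
    unfolding set_lebesgue_integral_def by (rule integral_scaleR_right)
  also have "(LINT \<theta>:?Q|lborel. G (torus_pt \<theta>)) = integral ?Q (\<lambda>\<theta>. G (torus_pt \<theta>))"
    by (intro set_borel_integral_eq_integral(2))
      (simp add: set_integrable_def borel_integrable_compact continuous_on_comp_torus_pt cont)
  finally show ?thesis
    by (simp add: torus_mean_def divide_inverse)
qed

lemma torus_mean_const [simp]: "torus_mean (\<lambda>w :: complex ^ 'n::finite. c) = c"
proof -
  let ?c = "measure lborel (angle_cube :: (real ^ 'n) set)"
  have "inverse ?c * ?c = 1"
    using content_angle_cube_pos[where 'n = 'n] by (intro field_class.field_inverse) linarith
  moreover have "torus_mean (\<lambda>w :: complex ^ 'n. c) = (inverse ?c * ?c) *\<^sub>R c"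
    by (simp only: torus_mean_def integral_const scaleR_scaleR)
  ultimately show ?thesis
    by simp
qed

lemma torus_mean_cong: "(\<And>w. w \<in> torus \<Longrightarrow> f w = g w) \<Longrightarrow> torus_mean f = torus_mean g"
  by (simp add: torus_mean_def)

lemma torus_mean_add:
  "continuous_on torus f \<Longrightarrow> continuous_on torus g \<Longrightarrow>
   torus_mean (\<lambda>w. f w + g w) = torus_mean f + torus_mean g"
  by (simp add: torus_mean_def integral_add torus_pt_integrable scaleR_add_right)

lemma torus_mean_linear:
  assumes "bounded_linear L" "continuous_on torus f"
  shows "torus_mean (\<lambda>w. L (f w)) = L (torus_mean f)"
proof -
  interpret L: bounded_linear L by fact
  show ?thesis
    using integral_linear[OF torus_pt_integrable[OF assms(2)] assms(1)]
    by (simp add: torus_mean_def o_def L.scaleR)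
qed

lemma torus_mean_mono:
  fixes f g :: "complex ^ 'n::finite \<Rightarrow> real"
  assumes "continuous_on torus f" "continuous_on torus g" "\<And>w. w \<in> torus \<Longrightarrow> f w \<le> g w"
  shows "torus_mean f \<le> torus_mean g"
  unfolding torus_mean_def using content_angle_cube_pos
  by (intro scaleR_left_mono integral_le torus_pt_integrable assms) auto

lemma norm_torus_mean_le:
  assumes "continuous_on torus f" "continuous_on torus g" "\<And>w. w \<in> torus \<Longrightarrow> norm (f w) \<le> g w"
  shows "norm (torus_mean f) \<le> torus_mean g"
  unfolding torus_mean_def norm_scaleR using content_angle_cube_pos
  by (auto intro!: mult_left_mono integral_norm_bound_integral torus_pt_integrable assms)

lemma torus_mean_swap:
  fixes K :: "complex ^ 'n::finite \<Rightarrow> complex ^ 'm::finite \<Rightarrow> 'b::euclidean_space"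
  assumes "continuous_on (torus \<times> torus) (\<lambda>(x, y). K x y)"
  shows "torus_mean (\<lambda>x. torus_mean (\<lambda>y. K x y)) = torus_mean (\<lambda>y. torus_mean (\<lambda>x. K x y))"
proof -
  have "continuous_on S (\<lambda>(\<theta>, \<eta>). K (torus_pt \<theta>) (torus_pt \<eta>))" for S
    unfolding case_prod_beta
    by (rule continuous_on_compose2[OF assms[unfolded case_prod_beta], of _ "\<lambda>p. (torus_pt (fst p), torus_pt (snd p))", simplified])
      (auto intro!: continuous_intros continuous_on_compose2[OF continuous_on_torus_pt])
  from integral_swap_continuous[OF this] show ?thesis
    by (simp add: torus_mean_def mult.commute)
qed

lemma torus_mean_swap_interval:
  fixes K :: "complex ^ 'n::finite \<Rightarrow> real \<Rightarrow> 'b::euclidean_space"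
  assumes "continuous_on (torus \<times> {0..1}) (\<lambda>(x, y). K x y)"
  shows "torus_mean (\<lambda>x. integral {0..1} (\<lambda>y. K x y)) = integral {0..1} (\<lambda>y. torus_mean (\<lambda>x. K x y))"
proof -
  have "continuous_on (S \<times> {0..1}) (\<lambda>(\<theta>, \<eta>). K (torus_pt \<theta>) \<eta>)" for S
    unfolding case_prod_beta
    by (rule continuous_on_compose2[OF assms[unfolded case_prod_beta], of _ "\<lambda>p. (torus_pt (fst p), snd p)", simplified])
      (auto intro!: continuous_intros continuous_on_compose2[OF continuous_on_torus_pt])
  then have "continuous_on (cbox (0, 0) (\<chi> k. 2 * pi, 1)) (\<lambda>(\<theta>, \<eta>). K (torus_pt \<theta>) \<eta>)"
    by (simp add: cbox_Pair_eq)
  from integral_swap_continuous[OF this] show ?thesis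
    by (simp add: torus_mean_def)
qed

section \<open>Rotation invariance of the torus mean\<close>

lemma angle_cube_integral_shift:
  fixes q :: "real ^ 'n::finite \<Rightarrow> 'b::euclidean_space"
  assumes cont: "continuous_on UNIV q"
    and per: "\<And>\<theta>. q (\<theta> + axis k (2 * pi)) = q \<theta>"
    and a: "0 \<le> a" "a \<le> 2 * pi"
  shows "integral angle_cube (\<lambda>\<theta>. q (\<theta> + axis k a)) = integral angle_cube q"
proof -
  let ?e = "axis k 1 :: real ^ 'n"
  let ?v = "axis k a :: real ^ 'n"
  let ?u = "axis k (2 * pi) :: real ^ 'n"
  let ?b = "(\<chi> i. 2 * pi) :: real ^ 'n"
  let ?b' = "(\<chi> i. if i = k then a else 2 * pi) :: real ^ 'n"
  have ie: "x \<bullet> ?e = x $ k" for x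
    by (simp add: inner_axis)
  have ax: "axis k t $ i = (if i = k then t else 0)" for t :: real and i
    by (simp add: axis_def)
  have mem: "x \<in> cbox c d \<longleftrightarrow> c $ k \<le> x $ k \<and> x $ k \<le> d $ k \<and> (\<forall>i. i \<noteq> k \<longrightarrow> c $ i \<le> x $ i \<and> x $ i \<le> d $ i)"
    for c d x :: "real ^ 'n"
    by (auto simp: mem_box_cart)
  have e: "?e \<in> Basis"
    by (simp add: axis_in_Basis_iff)
  have int: "q integrable_on cbox c d" for c d
    by (intro integrable_continuous continuous_on_subset[OF cont]) auto
  have "integral angle_cube (\<lambda>\<theta>. q (\<theta> + ?v)) = integral (cbox 0 ?b) (q \<circ> (+) ?v)"
    by (simp add: o_def add.commute)
  also have "\<dots> = integral (cbox ?v (?b + ?v)) q"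
    by (subst integral_shift_cbox_plus) simp
  \<comment> \<open>The shifted cube is cut at \<open>2 * pi\<close> in direction \<open>k\<close>.
    The piece beyond the cut, moved back by one period, is the slab of thickness \<open>a\<close>
    that the shift has left behind.\<close>
  also have "\<dots> = integral (cbox ?v (?b + ?v) \<inter> {x. x \<bullet> ?e \<le> 2 * pi}) q
                 + integral (cbox ?v (?b + ?v) \<inter> {x. x \<bullet> ?e \<ge> 2 * pi}) q"
    by (rule integral_split[OF int e])
  also have "cbox ?v (?b + ?v) \<inter> {x. x \<bullet> ?e \<le> 2 * pi} = cbox 0 ?b \<inter> {x. x \<bullet> ?e \<ge> a}"
    using a by (auto simp: mem ie ax)
  also have "cbox ?v (?b + ?v) \<inter> {x. x \<bullet> ?e \<ge> 2 * pi} = cbox (0 + ?u) (?b' + ?u)"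
    using a by (auto simp: mem ie ax)
  also have "integral (cbox (0 + ?u) (?b' + ?u)) q = integral (cbox 0 ?b') (q \<circ> (+) ?u)"
    by (rule integral_shift_cbox_plus[symmetric])
  also have "q \<circ> (+) ?u = q"
    using per by (auto simp: fun_eq_iff add.commute)
  also have "cbox 0 ?b' = cbox 0 ?b \<inter> {x. x \<bullet> ?e \<le> a}"
    using a by (auto simp: mem ie ax)
  also have "integral (cbox 0 ?b \<inter> {x. x \<bullet> ?e \<ge> a}) q + integral (cbox 0 ?b \<inter> {x. x \<bullet> ?e \<le> a}) q
      = integral (cbox 0 ?b) q"
    using integral_split[OF int e, of 0 ?b a] by simp
  finally show ?thesis .
qed

lemma torus_mean_rotate_coordinate:
  assumes cont: "continuous_on torus G" and c: "cmod c = 1"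
  shows "torus_mean (\<lambda>w. G (\<chi> i. if i = k then c * w $ i else w $ i)) = torus_mean G"
proof -
  define a where "a = Arg2pi c"
  have a: "0 \<le> a" "a \<le> 2 * pi" "c = cis a"
    using Arg2pi[of c] c by (auto simp: a_def cis_conv_exp is_Arg_def)
  have "G (\<chi> i. if i = k then c * torus_pt \<theta> $ i else torus_pt \<theta> $ i)
      = G (torus_pt (\<theta> + axis k a))" for \<theta>
    by (intro arg_cong[where f = G]) (auto simp: vec_eq_iff a(3) axis_def cis_mult add.commute)
  moreover have "G (torus_pt (\<theta> + axis k (2 * pi))) = G (torus_pt \<theta>)" for \<theta>
    by (intro arg_cong[where f = G]) (auto simp: vec_eq_iff axis_def cis_mult[symmetric])
  ultimately show ?thesis
    unfolding torus_mean_def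
    using angle_cube_integral_shift[OF continuous_on_comp_torus_pt[OF cont], of k a] a by simp
qed

lemma torus_mean_rotate:
  fixes G :: "complex ^ 'n::finite \<Rightarrow> 'b::euclidean_space"
  assumes cont: "continuous_on torus G" and c: "c \<in> torus"
  shows "torus_mean (\<lambda>w. G (w * c)) = torus_mean G"
proof -
  \<comment> \<open>Rotations are performed one coordinate at a time; \<open>S\<close> collects the
    coordinates already rotated.\<close>
  have "torus_mean (\<lambda>w. G (\<chi> i. if i \<in> S then w $ i * c $ i else w $ i)) = torus_mean G"
    if "finite S" for S
    using that
  proof (induction S)
    case (insert k S)
    let ?G = "\<lambda>w. G (\<chi> i. if i \<in> S then w $ i * c $ i else w $ i)"
    have "continuous_on torus ?G"
    proof (rule continuous_on_compose2[OF cont])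
      have "continuous_on torus (\<lambda>w. if i \<in> S then w $ i * c $ i else w $ i)" for i
        by (cases "i \<in> S") (auto intro!: continuous_intros)
      then show "continuous_on torus (\<lambda>w. \<chi> i. if i \<in> S then w $ i * c $ i else w $ i)"
        by (rule continuous_on_vec_lambda)
    qed (use c in \<open>auto simp: torus_def norm_mult\<close>)
    moreover have "(\<chi> i. if i \<in> S then (\<chi> i. if i = k then c $ k * w $ i else w $ i) $ i * c $ i
        else (\<chi> i. if i = k then c $ k * w $ i else w $ i) $ i)
      = (\<chi> i. if i \<in> insert k S then w $ i * c $ i else w $ i)" for w
      using insert by (auto simp: vec_eq_iff)
    ultimately show ?case
      using torus_mean_rotate_coordinate[of ?G "c $ k" k] c insert by (simp add: torus_def)
  qed auto
  from this[of UNIV] show ?thesis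
    by (simp add: times_vec_def)
qed

text \<open>Cauchy's formula for \<open>z \<mapsto> h (c * z)\<close> at the point
  \<open>y * cnj c\<close>. On the unit circle
  \<open>u / (u - y * cnj c) = inverse (1 - y * cnj (c * u))\<close>, the factor \<open>u\<close>
  coming from the velocity of the circle path. The base point \<open>c\<close> lets the average
  start anywhere on the circle.\<close>

lemma Cauchy_integral_circle_mean:
  assumes hol: "h holomorphic_on ball 0 \<rho>" and \<rho>: "1 < \<rho>" and y: "cmod y < 1" and c: "cmod c = 1"
  shows "((\<lambda>t. h (c * cis (2 * pi * t)) * inverse (1 - y * cnj (c * cis (2 * pi * t)))) has_integral h y) {0..1}"
proof -
  have cc: "c * cnj c = 1"
    by (simp add: complex_norm_square[symmetric] c)
  then have cy: "c * (y * cnj c) = y"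
    by (metis mult.commute mult.left_commute mult.right_neutral)
  have "(\<lambda>z. h (c * z)) holomorphic_on cball 0 1"
    using \<rho> c by (intro holomorphic_on_compose_gen[OF _ hol, unfolded o_def] holomorphic_intros)
      (auto simp: norm_mult)
  from Cauchy_integral_circlepath_simple[OF this, of "y * cnj c"]
  have "((\<lambda>x. h (c * circlepath 0 1 x) / (circlepath 0 1 x - y * cnj c) *
      vector_derivative (circlepath 0 1) (at x)) has_integral 2 * of_real pi * \<i> * h y) {0..1}"
    using y c cy by (simp add: norm_mult has_contour_integral)
  then have "((\<lambda>x. (h (c * circlepath 0 1 x) / (circlepath 0 1 x - y * cnj c) *
      vector_derivative (circlepath 0 1) (at x)) / (2 * of_real pi * \<i>)) has_integral
      (2 * of_real pi * \<i> * h y) / (2 * of_real pi * \<i>)) {0..1}"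
    by (rule has_integral_divide)
  moreover have "(h (c * circlepath 0 1 x) / (circlepath 0 1 x - y * cnj c) *
      vector_derivative (circlepath 0 1) (at x)) / (2 * of_real pi * \<i>)
      = h (c * cis (2 * pi * x)) * inverse (1 - y * cnj (c * cis (2 * pi * x)))" for x
  proof -
    define u where "u = cis (2 * pi * x)"
    have u: "u * cnj u = 1" "u \<noteq> 0" "cnj u = inverse u"
      by (simp_all add: u_def cis_mult cis_cnj cis_neq_zero)
    have e: "circlepath 0 1 x = u" "exp (2 * of_real pi * \<i> * of_real x) = u"
      by (simp_all add: circlepath u_def cis_conv_exp mult_ac)
    have "u / (u - y * cnj c) = inverse (1 - y * cnj (c * u))"
    proof -
      have "u * (1 - y * cnj (c * u)) = u - y * cnj c * (u * cnj u)"
        by (simp add: algebra_simps)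
      then have "u - y * cnj c = u * (1 - y * cnj (c * u))"
        using u(1) by simp
      then show ?thesis
        using u(2) by (simp add: inverse_eq_divide)
    qed
    then have "h (c * u) * inverse (1 - y * cnj (c * u)) = h (c * u) * (u / (u - y * cnj c))"
      by simp
    also have "\<dots> = h (c * u) / (u - y * cnj c) * (2 * pi * \<i> * of_real 1 * u) / (2 * of_real pi * \<i>)"
      by simp
    finally show ?thesis
      unfolding vector_derivative_circlepath e u_def[symmetric] ..
  qed
  ultimately show ?thesis
    by simp
qed

subsection \<open>Holomorphic functions of several variables\<close>

lemma has_derivative_vec_lambda:
  fixes f :: "'i::finite \<Rightarrow> 'a::real_normed_vector \<Rightarrow> 'b::euclidean_space"
  assumes "\<And>i. (f i has_derivative D i) (at x within S)"
  shows "((\<lambda>x. \<chi> i. f i x) has_derivative (\<lambda>h. \<chi> i. D i h)) (at x within S)"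
proof (subst has_derivative_componentwise_within, intro ballI)
  fix b :: "'b ^ 'i" assume "b \<in> Basis"
  then obtain i u where "b = axis i u"
    by (auto simp: Basis_vec_def)
  then show "((\<lambda>x. (\<chi> i. f i x) \<bullet> b) has_derivative (\<lambda>h. (\<chi> i. D i h) \<bullet> b)) (at x within S)"
    using has_derivative_inner_left[OF assms] by (simp add: inner_axis)
qed

lemma cn_holomorphic_onI:
  assumes "\<And>z. z \<in> S \<Longrightarrow> (f has_derivative L z) (at z)" "\<And>z c v. z \<in> S \<Longrightarrow> L z (c *s v) = c * L z v"
  shows "cn_holomorphic_on f S"
  using assms unfolding cn_holomorphic_on_def by blast

lemma cn_holomorphic_onE:
  assumes "cn_holomorphic_on f S" "z \<in> S"
  obtains L where "(f has_derivative L) (at z)" "\<And>c v. L (c *s v) = c * L v"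
  using assms unfolding cn_holomorphic_on_def by blast

lemma cn_holomorphic_on_subset: "cn_holomorphic_on f T \<Longrightarrow> S \<subseteq> T \<Longrightarrow> cn_holomorphic_on f S"
  unfolding cn_holomorphic_on_def by blast

lemma cn_holomorphic_on_imp_continuous_on:
  "cn_holomorphic_on f S \<Longrightarrow> continuous_on S f"
  by (meson cn_holomorphic_onE continuous_at_imp_continuous_on has_derivative_continuous)

lemma cn_holomorphic_on_transform:
  assumes "cn_holomorphic_on f S" "open S" "\<And>z. z \<in> S \<Longrightarrow> f z = g z"
  shows "cn_holomorphic_on g S"
  unfolding cn_holomorphic_on_def
proof
  fix z assume z: "z \<in> S"
  from cn_holomorphic_onE[OF assms(1) z] obtain L
    where L: "(f has_derivative L) (at z)" "\<And>c v. L (c *s v) = c * L v" by blast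
  from has_derivative_transform_within_open[OF L(1) assms(2) z assms(3)] L(2)
  show "\<exists>L. (g has_derivative L) (at z) \<and> (\<forall>c v. L (c *s v) = c * L v)" by auto
qed

lemma cn_holomorphic_on_const [intro]: "cn_holomorphic_on (\<lambda>z. c) S"
  by (rule cn_holomorphic_onI[where L = "\<lambda>z v. 0"]) auto

lemma cn_holomorphic_on_nth [intro]: "cn_holomorphic_on (\<lambda>z. z $ i) S"
  by (rule cn_holomorphic_onI[where L = "\<lambda>z v. v $ i"])
    (simp_all add: bounded_linear_imp_has_derivative bounded_linear_vec_nth)

lemma cn_holomorphic_on_add [intro]:
  assumes "cn_holomorphic_on f S" "cn_holomorphic_on g S"
  shows "cn_holomorphic_on (\<lambda>z. f z + g z) S"
  unfolding cn_holomorphic_on_def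
proof
  fix z assume z: "z \<in> S"
  from cn_holomorphic_onE[OF assms(1) z] obtain L
    where L: "(f has_derivative L) (at z)" "\<And>c v. L (c *s v) = c * L v" by blast
  from cn_holomorphic_onE[OF assms(2) z] obtain M
    where M: "(g has_derivative M) (at z)" "\<And>c v. M (c *s v) = c * M v" by blast
  show "\<exists>L. ((\<lambda>z. f z + g z) has_derivative L) (at z) \<and> (\<forall>c v. L (c *s v) = c * L v)"
    using has_derivative_add[OF L(1) M(1)] L(2) M(2) by (auto simp: distrib_left)
qed

lemma cn_holomorphic_on_mult [intro]:
  assumes "cn_holomorphic_on f S" "cn_holomorphic_on g S"
  shows "cn_holomorphic_on (\<lambda>z. f z * g z) S"
  unfolding cn_holomorphic_on_def
proof
  fix z assume z: "z \<in> S"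
  from cn_holomorphic_onE[OF assms(1) z] obtain L
    where L: "(f has_derivative L) (at z)" "\<And>c v. L (c *s v) = c * L v" by blast
  from cn_holomorphic_onE[OF assms(2) z] obtain M
    where M: "(g has_derivative M) (at z)" "\<And>c v. M (c *s v) = c * M v" by blast
  show "\<exists>L. ((\<lambda>z. f z * g z) has_derivative L) (at z) \<and> (\<forall>c v. L (c *s v) = c * L v)"
    using has_derivative_mult[OF L(1) M(1)] L(2) M(2) by (auto simp: algebra_simps)
qed

lemma cn_holomorphic_on_sum [intro]:
  "(\<And>i. i \<in> I \<Longrightarrow> cn_holomorphic_on (f i) S) \<Longrightarrow> cn_holomorphic_on (\<lambda>z. \<Sum>i\<in>I. f i z) S"
  by (induction I rule: infinite_finite_induct) auto

lemma cn_holomorphic_on_prod [intro]: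
  "(\<And>i. i \<in> I \<Longrightarrow> cn_holomorphic_on (f i) S) \<Longrightarrow> cn_holomorphic_on (\<lambda>z. \<Prod>i\<in>I. f i z) S"
  by (induction I rule: infinite_finite_induct) auto

lemma cn_holomorphic_on_inverse [intro]:
  assumes "cn_holomorphic_on f S" "\<And>z. z \<in> S \<Longrightarrow> f z \<noteq> 0"
  shows "cn_holomorphic_on (\<lambda>z. inverse (f z)) S"
  unfolding cn_holomorphic_on_def
proof
  fix z assume z: "z \<in> S"
  from cn_holomorphic_onE[OF assms(1) z] obtain L
    where L: "(f has_derivative L) (at z)" "\<And>c v. L (c *s v) = c * L v" by blast
  show "\<exists>L. ((\<lambda>z. inverse (f z)) has_derivative L) (at z) \<and> (\<forall>c v. L (c *s v) = c * L v)"
    using Deriv.has_derivative_inverse[OF assms(2)[OF z] L(1)] L(2) by (auto simp: algebra_simps)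
qed

lemma cn_holomorphic_on_compose:
  assumes f: "cn_holomorphic_on f T" and \<psi>: "cn_map_holomorphic_on \<psi> S" and "\<psi> ` S \<subseteq> T"
  shows "cn_holomorphic_on (\<lambda>z. f (\<psi> z)) S"
  unfolding cn_holomorphic_on_def
proof
  fix z assume z: "z \<in> S"
  from assms(3) z have "\<psi> z \<in> T" by auto
  from cn_holomorphic_onE[OF f this] obtain L
    where L: "(f has_derivative L) (at (\<psi> z))" "\<And>c v. L (c *s v) = c * L v" by blast
  have "\<forall>k. \<exists>M. ((\<lambda>z. \<psi> z $ k) has_derivative M) (at z) \<and> (\<forall>c v. M (c *s v) = c * M v)"
    using \<psi> z unfolding cn_map_holomorphic_on_def cn_holomorphic_on_def by blast
  from choice[OF this] obtain M where M: "\<And>k. ((\<lambda>z. \<psi> z $ k) has_derivative M k) (at z)"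
    "\<And>k c v. M k (c *s v) = c * M k v" by auto
  have "(\<psi> has_derivative (\<lambda>v. \<chi> k. M k v)) (at z)"
    using has_derivative_vec_lambda[of "\<lambda>k z. \<psi> z $ k", OF M(1)] by simp
  from diff_chain_at[OF this L(1)]
  have "((\<lambda>z. f (\<psi> z)) has_derivative (\<lambda>v. L (\<chi> k. M k v))) (at z)"
    by (simp add: o_def)
  moreover have "(\<chi> k. M k (c *s v)) = c *s (\<chi> k. M k v)" for c v
    by (simp add: vec_eq_iff M(2))
  ultimately show "\<exists>L. ((\<lambda>z. f (\<psi> z)) has_derivative L) (at z) \<and> (\<forall>c v. L (c *s v) = c * L v)"
    using L(2) by (intro exI[of _ "\<lambda>v. L (\<chi> k. M k v)"]) simp
qed

text \<open>Complex linearity makes the real derivative of the slice a multiplication by a complex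
  number, which identifies \<open>partial_deriv\<close> with a value of the total
  derivative.\<close>

lemma slice_has_field_derivative:
  fixes f :: "'n::finite cfun"
  assumes f: "(f has_derivative L) (at (\<chi> i. if i = k then u else v i))"
    and L: "\<And>c v. L (c *s v) = c * L v"
  shows "((\<lambda>u. f (\<chi> i. if i = k then u else v i)) has_field_derivative L (axis k 1)) (at u)"
proof -
  have "((\<lambda>u. (\<chi> i. if i = k then u else v i)) has_derivative (\<lambda>h. \<chi> i. if i = k then h else 0)) (at u)"
  proof (rule has_derivative_vec_lambda)
    show "((\<lambda>u. if i = k then u else v i) has_derivative (\<lambda>h. if i = k then h else 0)) (at u)" for i
      by (cases "i = k") auto
  qed
  from diff_chain_at[OF this f]
  have "((\<lambda>u. f (\<chi> i. if i = k then u else v i)) has_derivative (\<lambda>h. L (\<chi> i. if i = k then h else 0))) (at u)"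
    by (simp add: o_def)
  moreover have "(\<chi> i. if i = k then h else 0) = h *s axis k 1" for h :: complex
    by (auto simp: vec_eq_iff axis_def)
  ultimately show ?thesis
    by (simp add: has_field_derivative_def L mult.commute[of _ "L (axis k 1)"])
qed

lemma holomorphic_on_slice:
  assumes "cn_holomorphic_on f (polydisc \<rho>)" "\<And>i. i \<noteq> k \<Longrightarrow> cmod (v i) < \<rho>"
  shows "(\<lambda>u. f (\<chi> i. if i = k then u else v i)) holomorphic_on ball 0 \<rho>"
proof (rule holomorphic_onI)
  fix u :: complex assume "u \<in> ball 0 \<rho>"
  then have "(\<chi> i. if i = k then u else v i) \<in> polydisc \<rho>"
    using assms(2) by (simp add: polydisc_def)
  from cn_holomorphic_onE[OF assms(1) this] obtain L
    where "(f has_derivative L) (at (\<chi> i. if i = k then u else v i))" "\<And>c v. L (c *s v) = c * L v" by blast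
  from slice_has_field_derivative[OF this]
  show "(\<lambda>u. f (\<chi> i. if i = k then u else v i)) field_differentiable (at u within ball 0 \<rho>)"
    by (auto simp: field_differentiable_def intro: has_field_derivative_at_within)
qed

lemma open_polydisc [simp]: "open (polydisc R :: (complex ^ 'n::finite) set)"
proof -
  have "polydisc R = (\<Inter>k. {z :: complex ^ 'n. cmod (z $ k) < R})"
    by (auto simp: polydisc_def)
  then show ?thesis
    by (auto intro!: open_Collect_less continuous_intros)
qed

lemma polydisc_margin:
  fixes z :: "complex ^ 'n::finite"
  assumes "z \<in> polydisc R"
  obtains m where "0 \<le> m" "m < R" "\<And>k. cmod (z $ k) \<le> m"
proof
  let ?m = "Max (range (\<lambda>k. cmod (z $ k)))"
  show le: "cmod (z $ k) \<le> ?m" for k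
    by (rule Max_ge) auto
  show "?m < R"
    using assms by (subst Max_less_iff) (auto simp: polydisc_def)
  show "0 \<le> ?m"
    using le norm_ge_zero order_trans by blast
qed

lemma one_minus_cnj_mult_neq_0:
  assumes "cmod a < 1" "cmod b \<le> 1"
  shows "1 - cnj a * b \<noteq> 0" "1 - a * cnj b \<noteq> 0"
proof -
  have "cmod a * cmod b < 1"
    using assms by (metis linorder_not_less mult_left_le norm_ge_zero order_le_less_trans)
  then show "1 - cnj a * b \<noteq> 0" "1 - a * cnj b \<noteq> 0"
    by (metis complex_mod_cnj less_irrefl norm_mult norm_one right_minus_eq)+
qed

lemma torus_polydisc: "1 < \<rho> \<Longrightarrow> torus \<subseteq> polydisc \<rho>"
  by (auto simp: torus_def polydisc_def)

subsection \<open>The Cauchy and Poisson formulas on the polydisc\<close>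

text \<open>One coordinate at a time: averaging over rotations of a single coordinate does not change the
  torus mean, and this average is computed by the Cauchy formula in one variable.\<close>

lemma Cauchy_torus_mean:
  fixes g :: "'n::finite cfun"
  assumes hol: "cn_holomorphic_on g (polydisc \<rho>)" and \<rho>: "1 < \<rho>" and y: "y \<in> unit_polydisc"
  shows "torus_mean (\<lambda>w. g w * (\<Prod>i\<in>UNIV. inverse (1 - y $ i * cnj (w $ i)))) = g y"
proof -
  have y1: "cmod (y $ i) < 1" for i
    using y by (simp add: polydisc_def)
  \<comment> \<open>In \<open>G S\<close>, Cauchy's formula has been applied in the coordinates of
    \<open>S\<close>: they are set to \<open>y\<close> and their kernel factors are gone.
    \<open>G {}\<close> is the integrand and \<open>G UNIV\<close> the constant
    \<open>g y\<close>.\<close>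
  define G where "G S w = g (\<chi> i. if i \<in> S then y $ i else w $ i) *
      (\<Prod>i\<in>-S. inverse (1 - y $ i * cnj (w $ i)))" for S w
  have nz: "1 - y $ i * cnj (w $ i) \<noteq> 0" if "w \<in> torus" for w i
    using that y1 by (intro one_minus_cnj_mult_neq_0) (auto simp: torus_def)
  have contg: "continuous_on (polydisc \<rho>) g"
    by (rule cn_holomorphic_on_imp_continuous_on[OF hol])
  have in_polydisc: "(\<chi> i. if i \<in> S then y $ i else w $ i) \<in> polydisc \<rho>" if "w \<in> torus" for S w
    using that y1 \<rho> by (auto simp: polydisc_def torus_def intro: less_trans)
  have contG: "continuous_on torus (G S)" for S
  proof -
    have "continuous_on torus (\<lambda>w. if i \<in> S then y $ i else w $ i)" for i
      by (cases "i \<in> S") (auto intro!: continuous_intros)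
    then have "continuous_on torus (\<lambda>w. g (\<chi> i. if i \<in> S then y $ i else w $ i))"
      by (intro continuous_on_compose2[OF contg] continuous_on_vec_lambda) (use in_polydisc in auto)
    then show ?thesis
      unfolding G_def using nz by (intro continuous_intros) auto
  qed
  have "torus_mean (G S) = torus_mean (G {})" if "finite S" for S
    using that
  proof (induction S)
    case (insert k S)
    define rot where "rot t w = (\<chi> i. if i = k then cis (2 * pi * t) * w $ i else w $ i)" for t and w :: "complex ^ 'n"
    have rot: "rot t w \<in> torus" if "w \<in> torus" for t w
      using that by (simp add: rot_def torus_def norm_mult)
    have cont: "continuous_on (torus \<times> {0..1}) (\<lambda>(w, t). G S (rot t w))"
      unfolding case_prod_beta
    proof (rule continuous_on_compose2[OF contG])
      have "continuous_on (torus \<times> {0..1}) (\<lambda>p. if i = k then cis (2 * pi * snd p) * fst p $ i else fst p $ i)" for i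
        by (cases "i = k") (auto intro!: continuous_intros)
      then show "continuous_on (torus \<times> {0..1}) (\<lambda>p. rot (snd p) (fst p))"
        unfolding rot_def by (rule continuous_on_vec_lambda)
    qed (use rot in auto)
    \<comment> \<open>The factors of the other coordinates do not depend on \<open>t\<close> and
      form the constant \<open>c\<close>; the formula in one variable, started at
      \<open>w $ k\<close>, removes the factor of coordinate \<open>k\<close>.\<close>
    have "((\<lambda>t. G S (rot t w)) has_integral G (insert k S) w) {0..1}" if w: "w \<in> torus" for w
    proof -
      define v where "v i = (if i \<in> S then y $ i else w $ i)" for i
      define c where "c = (\<Prod>i\<in>-insert k S. inverse (1 - y $ i * cnj (w $ i)))"
      define h where "h u = g (\<chi> i. if i = k then u else v i)" for u
      have "h holomorphic_on ball 0 \<rho>"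
        unfolding h_def using in_polydisc[OF w, of S]
        by (intro holomorphic_on_slice[OF hol]) (auto simp: polydisc_def v_def)
      from Cauchy_integral_circle_mean[OF this \<rho> y1, of "w $ k" k]
      have "((\<lambda>t. c * (h (w $ k * cis (2 * pi * t)) * inverse (1 - y $ k * cnj (w $ k * cis (2 * pi * t)))))
          has_integral c * h (y $ k)) {0..1}"
        using w by (intro has_integral_mult_right) (simp add: torus_def)
      moreover have "c * (h (w $ k * cis (2 * pi * t)) * inverse (1 - y $ k * cnj (w $ k * cis (2 * pi * t))))
          = G S (rot t w)" for t
      proof -
        have "(\<Prod>i\<in>-S. inverse (1 - y $ i * cnj (rot t w $ i)))
            = inverse (1 - y $ k * cnj (w $ k * cis (2 * pi * t))) * c"
          using insert.hyps unfolding c_def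
          by (subst prod.remove[of _ k]) (auto simp: rot_def mult.commute Compl_insert intro!: prod.cong)
        moreover have "(\<chi> i. if i = k then w $ k * cis (2 * pi * t) else v i)
            = (\<chi> i. if i \<in> S then y $ i else rot t w $ i)"
          using insert.hyps by (auto simp: vec_eq_iff v_def rot_def)
        ultimately show ?thesis
          by (simp add: G_def h_def)
      qed
      moreover have "c * h (y $ k) = G (insert k S) w"
      proof -
        have "(\<chi> i. if i = k then y $ k else v i) = (\<chi> i. if i \<in> insert k S then y $ i else w $ i)"
          by (auto simp: vec_eq_iff v_def)
        then show ?thesis
          by (simp add: G_def h_def c_def)
      qed
      ultimately show ?thesis
        by simp
    qed
    then have "torus_mean (G (insert k S)) = torus_mean (\<lambda>w. integral {0..1} (\<lambda>t. G S (rot t w)))"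
      by (intro torus_mean_cong) (metis integral_unique)
    also have "\<dots> = integral {0..1} (\<lambda>t. torus_mean (\<lambda>w. G S (rot t w)))"
      by (rule torus_mean_swap_interval[OF cont])
    also have "\<dots> = torus_mean (G S)"
      unfolding rot_def by (subst torus_mean_rotate_coordinate[OF contG]) auto
    finally show ?case
      using insert.IH by simp
  qed auto
  from this[of UNIV] show ?thesis
    by (simp add: G_def[abs_def])
qed

definition poisson_kernel :: "complex ^ 'n::finite \<Rightarrow> complex ^ 'n \<Rightarrow> real" where
  "poisson_kernel z w = (\<Prod>i\<in>UNIV. (1 - (cmod (z $ i))\<^sup>2) / (cmod (1 - cnj (z $ i) * w $ i))\<^sup>2)"

lemma poisson_kernel_nonneg: "z \<in> unit_polydisc \<Longrightarrow> 0 \<le> poisson_kernel z w"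
  unfolding poisson_kernel_def
  by (intro prod_nonneg divide_nonneg_nonneg) (auto simp: polydisc_def power_le_one less_imp_le)

lemma continuous_on_poisson_kernel:
  "z \<in> unit_polydisc \<Longrightarrow> continuous_on torus (poisson_kernel z)"
  unfolding poisson_kernel_def
  by (intro continuous_intros ballI) (use one_minus_cnj_mult_neq_0(1) in \<open>auto simp: polydisc_def torus_def\<close>)

text \<open>The Cauchy formula for \<open>w \<mapsto> f w * \<Prod>\<^sub>i (1 - cnj z\<^sub>i * w\<^sub>i)\<^sup>-\<^sup>1\<close>. The Poisson kernel is positive of
  mean one, which gives the maximum principle and the monotonicity of the means.\<close>

lemma Poisson_torus_mean:
  fixes f :: "'n::finite cfun"
  assumes hol: "cn_holomorphic_on f (polydisc \<rho>)" and \<rho>: "1 < \<rho>" and z: "z \<in> unit_polydisc"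
  shows "torus_mean (\<lambda>w. f w * of_real (poisson_kernel z w)) = f z"
proof -
  have z1: "cmod (z $ i) < 1" for i
    using z by (simp add: polydisc_def)
  obtain m where m: "0 \<le> m" "m < 1" "\<And>k. cmod (z $ k) \<le> m"
    using polydisc_margin[OF z] by blast
  \<comment> \<open>Cauchy's formula needs \<open>g\<close> to be holomorphic beyond the torus. The
    number \<open>2 / (1 + m)\<close> exceeds 1, while \<open>m * (2 / (1 + m)) < 1\<close>, so no
    factor \<open>1 - cnj (z $ i) * w $ i\<close> vanishes within this radius.\<close>
  define \<rho>' where "\<rho>' = min \<rho> (2 / (1 + m))"
  have \<rho>': "1 < \<rho>'" "\<rho>' \<le> \<rho>" "m * \<rho>' < 1"
  proof -
    have "m * \<rho>' \<le> m * (2 / (1 + m))"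
      using m by (intro mult_left_mono) (auto simp: \<rho>'_def)
    also have "\<dots> < 1"
      using m by (simp add: field_simps)
    finally show "m * \<rho>' < 1" .
  qed (use m \<rho> in \<open>auto simp: \<rho>'_def field_simps\<close>)
  define g where "g w = f w * (\<Prod>i\<in>UNIV. inverse (1 - cnj (z $ i) * w $ i))" for w
  have nz: "1 - cnj (z $ i) * w $ i \<noteq> 0" if "w \<in> polydisc \<rho>'" for w i
  proof -
    have "cmod (z $ i) * cmod (w $ i) \<le> m * \<rho>'"
      using that m by (intro mult_mono) (auto simp: polydisc_def less_imp_le)
    then show ?thesis
      using \<rho>'(3) by (metis complex_mod_cnj less_irrefl norm_mult norm_one right_minus_eq order_le_less_trans)
  qed
  have "cn_holomorphic_on (\<lambda>w. 1 + (- cnj (z $ i)) * w $ i) (polydisc \<rho>')" for i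
    by (intro cn_holomorphic_on_add cn_holomorphic_on_mult cn_holomorphic_on_const cn_holomorphic_on_nth)
  then have "cn_holomorphic_on g (polydisc \<rho>')"
    unfolding g_def
    by (intro cn_holomorphic_on_mult cn_holomorphic_on_prod cn_holomorphic_on_inverse
          cn_holomorphic_on_subset[OF hol])
      (use nz \<rho>' in \<open>auto simp: polydisc_def intro: less_le_trans\<close>)
  from Cauchy_torus_mean[OF this \<rho>'(1) z]
  have "torus_mean (\<lambda>w. g w * (\<Prod>i\<in>UNIV. inverse (1 - z $ i * cnj (w $ i)))) = g z" .
  \<comment> \<open>The denominator of the Poisson kernel splits into conjugate factors: the one
    holomorphic in \<open>w\<close> belongs to \<open>g\<close>, the other one is the Cauchy kernel
    at \<open>z\<close>. The numerator is constant in \<open>w\<close> and cancels the product of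
    inverses in \<open>g z\<close>.\<close>
  moreover have "f w * of_real (poisson_kernel z w) =
     (\<Prod>i\<in>UNIV. of_real (1 - (cmod (z $ i))\<^sup>2)) * (g w * (\<Prod>i\<in>UNIV. inverse (1 - z $ i * cnj (w $ i))))" for w
  proof -
    have "of_real (poisson_kernel z w) =
      (\<Prod>i\<in>UNIV. of_real (1 - (cmod (z $ i))\<^sup>2) * inverse (1 - cnj (z $ i) * w $ i) * inverse (1 - z $ i * cnj (w $ i)))"
      unfolding poisson_kernel_def of_real_prod
    proof (intro prod.cong refl)
      fix i
      have "complex_of_real ((cmod (1 - cnj (z $ i) * w $ i))\<^sup>2) = (1 - cnj (z $ i) * w $ i) * (1 - z $ i * cnj (w $ i))"
        unfolding complex_norm_square by simp
      then show "complex_of_real ((1 - (cmod (z $ i))\<^sup>2) / (cmod (1 - cnj (z $ i) * w $ i))\<^sup>2) =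
         of_real (1 - (cmod (z $ i))\<^sup>2) * inverse (1 - cnj (z $ i) * w $ i) * inverse (1 - z $ i * cnj (w $ i))"
        unfolding of_real_divide by (simp add: divide_inverse mult.assoc)
    qed
    then show ?thesis
      by (simp add: g_def prod.distrib mult_ac)
  qed
  moreover have "(\<Prod>i\<in>UNIV. of_real (1 - (cmod (z $ i))\<^sup>2)) * g z = f z"
  proof -
    have "(\<Prod>i\<in>UNIV. of_real (1 - (cmod (z $ i))\<^sup>2)) * (\<Prod>i\<in>UNIV. inverse (1 - cnj (z $ i) * z $ i)) = 1"
      unfolding prod.distrib[symmetric]
    proof (intro prod.neutral ballI)
      fix i
      have "complex_of_real (1 - (cmod (z $ i))\<^sup>2) = 1 - cnj (z $ i) * z $ i"
        unfolding of_real_diff complex_norm_square by (simp add: mult.commute)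
      then show "complex_of_real (1 - (cmod (z $ i))\<^sup>2) * inverse (1 - cnj (z $ i) * z $ i) = 1"
        using one_minus_cnj_mult_neq_0(1)[OF z1 less_imp_le[OF z1], of i i] by simp
    qed
    then show ?thesis
      by (simp add: g_def mult_ac)
  qed
  moreover have cont: "continuous_on torus (\<lambda>w. g w * (\<Prod>i\<in>UNIV. inverse (1 - z $ i * cnj (w $ i))))"
    using z1 cn_holomorphic_on_imp_continuous_on[OF \<open>cn_holomorphic_on g _\<close>] torus_polydisc[OF \<rho>'(1)]
    by (intro continuous_intros ballI one_minus_cnj_mult_neq_0) (auto intro: continuous_on_subset simp: torus_def)
  ultimately show ?thesis
    by (simp add: torus_mean_linear[OF bounded_linear_mult_right cont])
qed

lemma torus_mean_poisson_kernel: 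
  assumes "z \<in> unit_polydisc"
  shows "torus_mean (poisson_kernel z) = 1"
proof -
  have "complex_of_real (torus_mean (poisson_kernel z)) = torus_mean (\<lambda>w. of_real (poisson_kernel z w))"
    by (rule torus_mean_linear[OF bounded_linear_of_real continuous_on_poisson_kernel[OF assms], symmetric])
  also have "\<dots> = 1"
    using Poisson_torus_mean[of "\<lambda>_. 1" 2, OF _ _ assms] by auto
  finally show ?thesis
    by simp
qed

lemma continuous_on_torus_mean:
  fixes K :: "complex ^ 'n::finite \<Rightarrow> complex ^ 'm::finite \<Rightarrow> 'b::euclidean_space"
  assumes "continuous_on (torus \<times> torus) (\<lambda>(x, y). K x y)"
  shows "continuous_on torus (\<lambda>x. torus_mean (K x))"
proof -
  have "continuous_on (torus \<times> angle_cube) (\<lambda>(x, \<eta>). K x (torus_pt \<eta>))"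
    unfolding case_prod_beta
    by (rule continuous_on_compose2[OF assms[unfolded case_prod_beta], of _ "\<lambda>p. (fst p, torus_pt (snd p))", simplified])
      (auto intro!: continuous_intros continuous_on_compose2[OF continuous_on_torus_pt])
  from integral_continuous_on_param[OF this] show ?thesis
    unfolding torus_mean_def by (intro continuous_intros)
qed

subsection \<open>The Hardy space\<close>

text \<open>The Hardy space without its growth condition. Extension by zero makes the members Borel
  measurable on the whole space, as integration over \<open>torus_measure\<close> requires.\<close>

definition holomorphic_ext0 :: "'n::finite cfun set" where
  "holomorphic_ext0 = {f. cn_holomorphic_on f unit_polydisc \<and> (\<forall>z. z \<notin> unit_polydisc \<longrightarrow> f z = 0)}"

lemma holomorphic_ext0I:
  "cn_holomorphic_on f unit_polydisc \<Longrightarrow> (\<lambda>z. if z \<in> unit_polydisc then f z else 0) \<in> holomorphic_ext0"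
  by (auto simp: holomorphic_ext0_def intro: cn_holomorphic_on_transform)

lemma holomorphic_ext0_combine:
  assumes "f \<in> holomorphic_ext0" "g \<in> holomorphic_ext0"
  shows "(\<lambda>z. a * f z + b * g z) \<in> holomorphic_ext0"
  using assms by (auto simp: holomorphic_ext0_def intro!: cn_holomorphic_on_add cn_holomorphic_on_mult cn_holomorphic_on_const)

lemma holomorphic_ext0_borel:
  assumes "f \<in> holomorphic_ext0"
  shows "f \<in> borel_measurable borel"
proof -
  have "(\<lambda>z. indicator unit_polydisc z *\<^sub>R f z) \<in> borel_measurable borel"
    using assms by (intro borel_measurable_continuous_on_indicator cn_holomorphic_on_imp_continuous_on)
      (auto simp: holomorphic_ext0_def)
  moreover have "(\<lambda>z. indicator unit_polydisc z *\<^sub>R f z) = f"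
    using assms by (auto simp: holomorphic_ext0_def fun_eq_iff indicator_def)
  ultimately show ?thesis
    by simp
qed

lemma scaleR_torus_in_polydisc: "0 \<le> r \<Longrightarrow> r < 1 \<Longrightarrow> w \<in> torus \<Longrightarrow> r *\<^sub>R w \<in> unit_polydisc"
  by (simp add: torus_def polydisc_def)

lemma continuous_on_dilate:
  assumes "cn_holomorphic_on f unit_polydisc" "0 \<le> r" "r < 1"
  shows "continuous_on torus (\<lambda>w. f (r *\<^sub>R w))"
  by (rule continuous_on_compose2[OF cn_holomorphic_on_imp_continuous_on[OF assms(1)]])
    (use assms in \<open>auto intro!: continuous_intros scaleR_torus_in_polydisc\<close>)

text \<open>The product \<open>c * z\<close> is componentwise, so this covers the dilates of
  \<open>f\<close> as well as dilates rotated by a point of the torus. For \<open>s < 1\<close> the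
  domain of holomorphy reaches beyond the torus, where the Cauchy and Poisson formulas
  apply.\<close>

lemma cn_holomorphic_on_times:
  fixes f :: "'n::finite cfun"
  assumes f: "cn_holomorphic_on f unit_polydisc" and "0 < s" "\<And>i. cmod (c $ i) \<le> s"
  shows "cn_holomorphic_on (\<lambda>z. f (c * z)) (polydisc (1 / s))"
proof (rule cn_holomorphic_on_compose[OF f])
  show "cn_map_holomorphic_on ((*) c) (polydisc (1 / s))"
    by (auto simp: cn_map_holomorphic_on_def)
  show "(*) c ` polydisc (1 / s) \<subseteq> unit_polydisc"
  proof clarify
    fix z :: "complex ^ 'n" assume z: "z \<in> polydisc (1 / s)"
    have "cmod (c $ i) * cmod (z $ i) < 1" for i
    proof -
      have "cmod (c $ i) * cmod (z $ i) \<le> s * cmod (z $ i)"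
        using assms(3) by (intro mult_right_mono) auto
      also have "\<dots> < 1"
        using z assms(2) by (simp add: polydisc_def field_simps)
      finally show ?thesis .
    qed
    then show "c * z \<in> unit_polydisc"
      by (simp add: polydisc_def norm_mult)
  qed
qed

text \<open>The Poisson formula for a dilate of \<open>f\<close> sees only values on a dilated
  torus. Hence a bound along the rays over the torus suffices, although in several variables these
  rays do not fill the polydisc.\<close>

lemma maximum_principle_polydisc:
  fixes f :: "'n::finite cfun"
  assumes f: "cn_holomorphic_on f unit_polydisc"
    and le: "\<And>r w. 0 \<le> r \<Longrightarrow> r < 1 \<Longrightarrow> w \<in> torus \<Longrightarrow> cmod (f (r *\<^sub>R w)) \<le> M"
    and z: "z \<in> unit_polydisc"
  shows "cmod (f z) \<le> M"
proof -
  obtain m where m: "0 \<le> m" "m < 1" "\<And>k. cmod (z $ k) \<le> m"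
    using polydisc_margin[OF z] by blast
  \<comment> \<open>Any dilation between the margin \<open>m\<close> and 1 would do:
    \<open>z / r\<close> has to remain in the open polydisc.\<close>
  define r where "r = (1 + m) / 2"
  have r: "0 < r" "r < 1" "m < r"
    using m by (auto simp: r_def)
  define \<zeta> where "\<zeta> = z /\<^sub>R r"
  have \<zeta>: "\<zeta> \<in> unit_polydisc"
    using m(3) r by (auto simp: \<zeta>_def polydisc_def divide_simps intro: le_less_trans)
  define c :: "complex ^ 'n" where "c = (\<chi> i. of_real r)"
  have c: "c * w = r *\<^sub>R w" for w
    by (simp add: c_def vec_eq_iff) (simp add: scaleR_conv_of_real)
  have "cn_holomorphic_on (\<lambda>w. f (c * w)) (polydisc (1 / r))"
    using r by (intro cn_holomorphic_on_times f) (auto simp: c_def)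
  from Poisson_torus_mean[OF this _ \<zeta>] r
  have eq: "f z = torus_mean (\<lambda>w. f (r *\<^sub>R w) * of_real (poisson_kernel \<zeta> w))"
    by (simp add: c) (simp add: \<zeta>_def)
  have cont: "continuous_on torus (\<lambda>w. f (r *\<^sub>R w))" "continuous_on torus (poisson_kernel \<zeta>)"
    using continuous_on_dilate[OF f] continuous_on_poisson_kernel[OF \<zeta>] r by auto
  have "cmod (f z) \<le> torus_mean (\<lambda>w. M * poisson_kernel \<zeta> w)"
    unfolding eq
    by (rule norm_torus_mean_le)
      (use r cont poisson_kernel_nonneg[OF \<zeta>] in \<open>auto intro!: continuous_intros mult_right_mono le simp: norm_mult\<close>)
  also have "\<dots> = M * torus_mean (poisson_kernel \<zeta>)"
    by (rule torus_mean_linear[OF bounded_linear_mult_right cont(2)])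
  finally show ?thesis
    by (simp add: torus_mean_poisson_kernel[OF \<zeta>])
qed

section \<open>Radial means and the norm\<close>

definition radial_mean :: "'n::finite cfun \<Rightarrow> real \<Rightarrow> real" where
  "radial_mean f r = torus_mean (\<lambda>w. (cmod (f (r *\<^sub>R w)))\<^sup>2)"

definition radial_inner :: "'n::finite cfun \<Rightarrow> 'n cfun \<Rightarrow> real \<Rightarrow> complex" where
  "radial_inner f g r = torus_mean (\<lambda>w. f (r *\<^sub>R w) * cnj (g (r *\<^sub>R w)))"

text \<open>By the Poisson formula, \<open>f (r w)\<close> is a weighted average of the values of \<open>f\<close> at the rotations of
  \<open>s w\<close>; average over \<open>w\<close> and use the rotation invariance of the torus mean.\<close>

lemma radial_mean_mono:
  fixes f :: "'n::finite cfun"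
  assumes f: "cn_holomorphic_on f unit_polydisc" and r: "0 < r" "r \<le> s" "s < 1"
  shows "radial_mean f r \<le> radial_mean f s"
proof (cases "r = s")
  case False
  then have rs: "0 < r / s" "r / s < 1"
    using r by auto
  \<comment> \<open>All coordinates are \<open>r / s\<close>, so that
    \<open>s (w * z) = r w\<close>: the Poisson formula for
    \<open>\<zeta> \<mapsto> f (s w * \<zeta>)\<close> at \<open>z\<close> returns
    \<open>f (r w)\<close>.\<close>
  define z :: "complex ^ 'n" where "z = (\<chi> i. of_real (r / s))"
  have z: "z \<in> unit_polydisc"
    using rs by (simp add: z_def polydisc_def del: of_real_divide)
  define P where "P = poisson_kernel z"
  have P: "continuous_on torus P" "\<And>w. 0 \<le> P w" "torus_mean P = 1"
    using continuous_on_poisson_kernel[OF z] poisson_kernel_nonneg[OF z] torus_mean_poisson_kernel[OF z]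
    by (auto simp: P_def)
  define h where "h w = f (s *\<^sub>R w)" for w
  have hcont: "continuous_on torus h"
    unfolding h_def using r by (intro continuous_on_dilate[OF f]) auto
  have torus_times: "w * \<zeta> \<in> torus" if "w \<in> torus" "\<zeta> \<in> torus" for w \<zeta> :: "complex ^ 'n"
    using that by (simp add: torus_def norm_mult)
  have joint: "continuous_on (torus \<times> torus) (\<lambda>(w, \<zeta>). h (w * \<zeta>))"
    unfolding case_prod_beta times_vec_def
    by (rule continuous_on_compose2[OF hcont])
      (use torus_times in \<open>auto intro!: continuous_intros simp: times_vec_def\<close>)
  have joint': "continuous_on (torus \<times> torus) (\<lambda>(w, \<zeta>). (cmod (h (w * \<zeta>)))\<^sup>2 * P \<zeta>)"
    using joint unfolding case_prod_beta
    by (intro continuous_intros) (auto intro!: continuous_on_compose2[OF P(1)] continuous_intros)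
  have pointwise: "(cmod (f (r *\<^sub>R w)))\<^sup>2 \<le> torus_mean (\<lambda>\<zeta>. (cmod (h (w * \<zeta>)))\<^sup>2 * P \<zeta>)" if w: "w \<in> torus" for w
  proof -
    define u where "u = f (r *\<^sub>R w)"
    define a where "a \<zeta> = h (w * \<zeta>)" for \<zeta>
    have acont: "continuous_on torus a"
      unfolding a_def using w by (intro continuous_on_compose2[OF joint[unfolded case_prod_beta], of _ "\<lambda>\<zeta>. (w, \<zeta>)", simplified])
        (auto intro!: continuous_intros)
    have e1: "s *\<^sub>R w * \<zeta> = s *\<^sub>R (w * \<zeta>)" for \<zeta>
      by (simp add: vec_eq_iff)
    have e2: "s *\<^sub>R (w * z) = r *\<^sub>R w"
      using r by (simp add: vec_eq_iff z_def) (simp add: scaleR_conv_of_real)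
    have "cn_holomorphic_on (\<lambda>\<zeta>. f ((s *\<^sub>R w) * \<zeta>)) (polydisc (1 / s))"
      using r w by (intro cn_holomorphic_on_times f) (auto simp: torus_def)
    from Poisson_torus_mean[OF this _ z] r
    have u: "torus_mean (\<lambda>\<zeta>. a \<zeta> * of_real (P \<zeta>)) = u"
      by (simp add: e1 e2 a_def P_def u_def h_def)
    have lin: "bounded_linear (\<lambda>x. Re (cnj u * x))"
      by (intro bounded_linear_compose[OF bounded_linear_Re bounded_linear_mult_right])
    \<comment> \<open>Jensen's inequality by hand: \<open>|u|^2\<close> is the mean of
      \<open>Re (cnj u * a) * P\<close>, the integrand is at most
      \<open>(|u|^2 + |a|^2) / 2 * P\<close>, and the half of \<open>|u|^2\<close> that arises is
      absorbed on the left.\<close>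
    have "(cmod u)\<^sup>2 = Re (cnj u * torus_mean (\<lambda>\<zeta>. a \<zeta> * of_real (P \<zeta>)))"
      unfolding u by (simp add: cmod_power2) (simp add: power2_eq_square)
    also have "\<dots> = torus_mean (\<lambda>\<zeta>. Re (cnj u * (a \<zeta> * of_real (P \<zeta>))))"
      by (intro torus_mean_linear[OF lin, symmetric] continuous_intros acont P)
    also have "\<dots> \<le> torus_mean (\<lambda>\<zeta>. ((cmod u)\<^sup>2 / 2) * P \<zeta> + (1 / 2) * ((cmod (a \<zeta>))\<^sup>2 * P \<zeta>))"
    proof (rule torus_mean_mono)
      fix \<zeta>
      have "Re (cnj u * a \<zeta>) \<le> cmod u * cmod (a \<zeta>)"
        by (metis complex_Re_le_cmod complex_mod_cnj norm_mult)
      also have "\<dots> \<le> ((cmod u)\<^sup>2 + (cmod (a \<zeta>))\<^sup>2) / 2"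
        using sum_squares_bound[of "cmod u" "cmod (a \<zeta>)"] by simp
      finally have "Re (cnj u * a \<zeta>) * P \<zeta> \<le> ((cmod u)\<^sup>2 + (cmod (a \<zeta>))\<^sup>2) / 2 * P \<zeta>"
        by (intro mult_right_mono P)
      moreover have "Re (cnj u * (a \<zeta> * of_real (P \<zeta>))) = Re (cnj u * a \<zeta>) * P \<zeta>"
        by (simp add: algebra_simps)
      ultimately show "Re (cnj u * (a \<zeta> * of_real (P \<zeta>))) \<le> (cmod u)\<^sup>2 / 2 * P \<zeta> + 1 / 2 * ((cmod (a \<zeta>))\<^sup>2 * P \<zeta>)"
        by (simp add: field_simps)
    qed (intro continuous_intros acont P)+
    also have "\<dots> = torus_mean (\<lambda>\<zeta>. ((cmod u)\<^sup>2 / 2) * P \<zeta>) + torus_mean (\<lambda>\<zeta>. (1 / 2) * ((cmod (a \<zeta>))\<^sup>2 * P \<zeta>))"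
      by (intro torus_mean_add continuous_intros acont P)
    also have "torus_mean (\<lambda>\<zeta>. ((cmod u)\<^sup>2 / 2) * P \<zeta>) = (cmod u)\<^sup>2 / 2"
      by (simp only: torus_mean_linear[OF bounded_linear_mult_right P(1)] P(3) mult_1_right)
    also have "torus_mean (\<lambda>\<zeta>. (1 / 2) * ((cmod (a \<zeta>))\<^sup>2 * P \<zeta>)) = (1 / 2) * torus_mean (\<lambda>\<zeta>. (cmod (a \<zeta>))\<^sup>2 * P \<zeta>)"
      by (intro torus_mean_linear[OF bounded_linear_mult_right] continuous_intros acont P)
    finally show ?thesis
      by (simp add: u_def a_def)
  qed
  have hr: "continuous_on torus (\<lambda>w. (cmod (f (r *\<^sub>R w)))\<^sup>2)"
    using r by (intro continuous_intros continuous_on_dilate[OF f]) auto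
  have "radial_mean f r \<le> torus_mean (\<lambda>w. torus_mean (\<lambda>\<zeta>. (cmod (h (w * \<zeta>)))\<^sup>2 * P \<zeta>))"
    unfolding radial_mean_def
    by (rule torus_mean_mono[OF hr continuous_on_torus_mean[OF joint'] pointwise])
  also have "\<dots> = torus_mean (\<lambda>\<zeta>. torus_mean (\<lambda>w. (cmod (h (w * \<zeta>)))\<^sup>2 * P \<zeta>))"
    by (rule torus_mean_swap[OF joint'])
  also have "\<dots> = torus_mean (\<lambda>\<zeta>. radial_mean f s * P \<zeta>)"
  proof (rule torus_mean_cong)
    fix \<zeta> :: "complex ^ 'n" assume \<zeta>: "\<zeta> \<in> torus"
    have c1: "continuous_on torus (\<lambda>w. (cmod (h w))\<^sup>2 * P \<zeta>)" "continuous_on torus (\<lambda>w. (cmod (h w))\<^sup>2)"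
      by (intro continuous_intros hcont)+
    have "torus_mean (\<lambda>w. (cmod (h (w * \<zeta>)))\<^sup>2 * P \<zeta>) = torus_mean (\<lambda>w. (cmod (h w))\<^sup>2 * P \<zeta>)"
      by (rule torus_mean_rotate[OF c1(1) \<zeta>])
    also have "\<dots> = radial_mean f s * P \<zeta>"
      unfolding radial_mean_def h_def[symmetric]
      by (rule torus_mean_linear[OF bounded_linear_mult_left c1(2)])
    finally show "torus_mean (\<lambda>w. (cmod (h (w * \<zeta>)))\<^sup>2 * P \<zeta>) = radial_mean f s * P \<zeta>" .
  qed
  also have "\<dots> = radial_mean f s"
    by (simp add: torus_mean_linear[OF bounded_linear_mult_right P(1)] P(3))
  finally show ?thesis .
qed simp

lemma radial_mean_nonneg:
  fixes f :: "'n::finite cfun"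
  assumes f: "cn_holomorphic_on f unit_polydisc" and r: "0 < r" "r < 1"
  shows "0 \<le> radial_mean f r"
proof -
  have "torus_mean (\<lambda>w :: complex ^ 'n. 0 :: real) \<le> radial_mean f r"
    unfolding radial_mean_def using r
    by (intro torus_mean_mono continuous_intros continuous_on_dilate[OF f]) auto
  then show ?thesis
    by simp
qed

lemma eventually_at_left_1: "eventually (\<lambda>r::real. 0 < r \<and> r < 1) (at_left 1)"
  using eventually_at_left_real[of 0 1] by simp

lemma LINT_radial_mean:
  assumes "f \<in> holomorphic_ext0" "0 < r" "r < 1"
  shows "(LINT w|torus_measure. (cmod (f (r *\<^sub>R w)))\<^sup>2) = radial_mean f r"
proof -
  have f: "cn_holomorphic_on f unit_polydisc" and [measurable]: "f \<in> borel_measurable borel"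
    using assms holomorphic_ext0_borel by (auto simp: holomorphic_ext0_def)
  show ?thesis
    unfolding radial_mean_def using assms
    by (intro LINT_torus_measure continuous_intros continuous_on_dilate[OF f]) auto
qed

lemma LINT_radial_inner:
  assumes "f \<in> holomorphic_ext0" "g \<in> holomorphic_ext0" "0 < r" "r < 1"
  shows "(LINT w|torus_measure. f (r *\<^sub>R w) * cnj (g (r *\<^sub>R w))) = radial_inner f g r"
proof -
  have f: "cn_holomorphic_on f unit_polydisc" and [measurable]: "f \<in> borel_measurable borel"
    using assms holomorphic_ext0_borel by (auto simp: holomorphic_ext0_def)
  have g: "cn_holomorphic_on g unit_polydisc" and [measurable]: "g \<in> borel_measurable borel"
    using assms holomorphic_ext0_borel by (auto simp: holomorphic_ext0_def)
  have [measurable]: "cnj \<in> borel_measurable borel"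
    by (intro borel_measurable_continuous_onI continuous_intros)
  show ?thesis
    unfolding radial_inner_def using assms
    by (intro LINT_torus_measure continuous_intros continuous_on_dilate[OF f] continuous_on_dilate[OF g]) auto
qed

lemma tendsto_radial_mean_cong:
  assumes "f \<in> holomorphic_ext0"
  shows "((\<lambda>r. LINT w|torus_measure. (cmod (f (r *\<^sub>R w)))\<^sup>2) \<longlongrightarrow> l) (at_left 1)
    \<longleftrightarrow> (radial_mean f \<longlongrightarrow> l) (at_left 1)"
  by (rule filterlim_cong[OF refl refl eventually_mono[OF eventually_at_left_1]])
    (simp add: LINT_radial_mean[OF assms])

lemma hardy_space_ext0: "f \<in> hardy_space \<Longrightarrow> f \<in> holomorphic_ext0"
  by (simp add: hardy_space_def holomorphic_ext0_def)

lemma hardy_space_holomorphic: "f \<in> hardy_space \<Longrightarrow> cn_holomorphic_on f unit_polydisc"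
  by (simp add: hardy_space_def)

lemma hardy_space_outside: "f \<in> hardy_space \<Longrightarrow> z \<notin> unit_polydisc \<Longrightarrow> f z = 0"
  by (simp add: hardy_space_def)

text \<open>Increasing bounded radial means converge to their supremum, so a bound is enough where
  the definition of \<open>hardy_space\<close> asks for a limit.\<close>

lemma hardy_spaceI_radial_mean:
  assumes f: "f \<in> holomorphic_ext0" and B: "\<And>r. 0 < r \<Longrightarrow> r < 1 \<Longrightarrow> radial_mean f r \<le> B"
  shows "f \<in> hardy_space" "hardy_norm f \<le> sqrt B"
proof -
  have hol: "cn_holomorphic_on f unit_polydisc"
    using f by (simp add: holomorphic_ext0_def)
  define l where "l = Sup (radial_mean f ` {0<..<1})"
  have bdd: "bdd_above (radial_mean f ` {0<..<1})"
    using B by (intro bdd_aboveI2[of _ _ B]) auto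
  have "(radial_mean f \<longlongrightarrow> l) (at_left 1)"
  proof (rule increasing_tendsto)
    show "\<forall>\<^sub>F r in at_left 1. radial_mean f r \<le> l"
      using eventually_at_left_1 by eventually_elim (auto simp: l_def intro!: cSup_upper bdd)
  next
    fix x assume "x < l"
    then obtain s where s: "0 < s" "s < 1" "x < radial_mean f s"
      using less_cSup_iff[OF _ bdd, of x] by (auto simp: l_def)
    have "eventually (\<lambda>r. s < r \<and> r < 1) (at_left 1)"
      using eventually_at_left_real[OF s(2)] by simp
    then show "\<forall>\<^sub>F r in at_left 1. x < radial_mean f r"
      by eventually_elim (use s radial_mean_mono[OF hol s(1)] in \<open>auto intro: less_le_trans\<close>)
  qed
  then have lim: "((\<lambda>r. LINT w|torus_measure. (cmod (f (r *\<^sub>R w)))\<^sup>2) \<longlongrightarrow> l) (at_left 1)"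
    by (simp add: tendsto_radial_mean_cong[OF f])
  then show "f \<in> hardy_space"
    using f unfolding hardy_space_def holomorphic_ext0_def by blast
  have "l \<le> B"
    unfolding l_def using B by (intro cSup_least) auto
  then show "hardy_norm f \<le> sqrt B"
    unfolding hardy_norm_def tendsto_Lim[OF trivial_limit_at_left_real lim] by simp
qed

text \<open>Monotonicity turns the limit into an upper bound for every single mean.\<close>

lemma hardy_space_radial_mean:
  assumes f: "f \<in> hardy_space"
  shows "(radial_mean f \<longlongrightarrow> (hardy_norm f)\<^sup>2) (at_left 1)" (is ?lim)
    and "0 \<le> hardy_norm f"
    and "0 < r \<Longrightarrow> r < 1 \<Longrightarrow> radial_mean f r \<le> (hardy_norm f)\<^sup>2"
proof -
  note hol = hardy_space_holomorphic[OF f]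
  obtain l where l: "((\<lambda>r. LINT w|torus_measure. (cmod (f (r *\<^sub>R w)))\<^sup>2) \<longlongrightarrow> l) (at_left 1)"
    using f by (auto simp: hardy_space_def)
  then have lim: "(radial_mean f \<longlongrightarrow> l) (at_left 1)"
    by (simp add: tendsto_radial_mean_cong[OF hardy_space_ext0[OF f]])
  have "0 \<le> l"
    by (rule tendsto_lowerbound[OF lim eventually_mono[OF eventually_at_left_1]])
      (auto intro: radial_mean_nonneg[OF hol])
  then have norm: "(hardy_norm f)\<^sup>2 = l" "0 \<le> hardy_norm f"
    unfolding hardy_norm_def tendsto_Lim[OF trivial_limit_at_left_real l] by simp_all
  then show ?lim "0 \<le> hardy_norm f"
    using lim by auto
  show "radial_mean f r \<le> (hardy_norm f)\<^sup>2" if r: "0 < r" "r < 1"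
    unfolding norm
  proof (rule tendsto_lowerbound[OF lim])
    have "eventually (\<lambda>s. r < s \<and> s < 1) (at_left 1)"
      using eventually_at_left_real[OF r(2)] by simp
    then show "\<forall>\<^sub>F s in at_left 1. radial_mean f r \<le> radial_mean f s"
      by eventually_elim (use r radial_mean_mono[OF hol r(1)] in auto)
  qed simp
qed

text \<open>Convergence of the radial means of a combination cannot be read off from those of
  \<open>f\<close> and \<open>g\<close>. A bound can, through
  \<open>|u + v|^2 <= 2 |u|^2 + 2 |v|^2\<close>, and monotonicity supplies the limit.\<close>

lemma hardy_space_combine:
  assumes f: "f \<in> hardy_space" and g: "g \<in> hardy_space"
  shows "(\<lambda>z. a * f z + b * g z) \<in> hardy_space"
proof (rule hardy_spaceI_radial_mean(1))
  fix r :: real assume r: "0 < r" "r < 1"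
  have cont: "continuous_on torus (\<lambda>w. f (r *\<^sub>R w))" "continuous_on torus (\<lambda>w. g (r *\<^sub>R w))"
    using r by (auto intro!: continuous_on_dilate hardy_space_holomorphic f g)
  have "radial_mean (\<lambda>z. a * f z + b * g z) r
    \<le> torus_mean (\<lambda>w. (2 * (cmod a)\<^sup>2) * (cmod (f (r *\<^sub>R w)))\<^sup>2 + (2 * (cmod b)\<^sup>2) * (cmod (g (r *\<^sub>R w)))\<^sup>2)"
    unfolding radial_mean_def
  proof (rule torus_mean_mono)
    fix w
    have "(cmod (a * f (r *\<^sub>R w) + b * g (r *\<^sub>R w)))\<^sup>2 \<le> (cmod (a * f (r *\<^sub>R w)) + cmod (b * g (r *\<^sub>R w)))\<^sup>2"
      by (intro power_mono norm_triangle_ineq) auto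
    also have "\<dots> \<le> 2 * (cmod (a * f (r *\<^sub>R w)))\<^sup>2 + 2 * (cmod (b * g (r *\<^sub>R w)))\<^sup>2"
      using sum_squares_bound[of "cmod (a * f (r *\<^sub>R w))" "cmod (b * g (r *\<^sub>R w))"] by (simp add: power2_sum)
    finally show "(cmod (a * f (r *\<^sub>R w) + b * g (r *\<^sub>R w)))\<^sup>2
        \<le> (2 * (cmod a)\<^sup>2) * (cmod (f (r *\<^sub>R w)))\<^sup>2 + (2 * (cmod b)\<^sup>2) * (cmod (g (r *\<^sub>R w)))\<^sup>2"
      by (simp add: norm_mult power_mult_distrib mult_ac)
  qed (intro continuous_intros cont)+
  also have "\<dots> = (2 * (cmod a)\<^sup>2) * radial_mean f r + (2 * (cmod b)\<^sup>2) * radial_mean g r"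
    unfolding radial_mean_def
    by (subst torus_mean_add) (auto intro!: continuous_intros cont torus_mean_linear[OF bounded_linear_mult_right] arg_cong2[where f = "(+)"])
  also have "\<dots> \<le> (2 * (cmod a)\<^sup>2) * (hardy_norm f)\<^sup>2 + (2 * (cmod b)\<^sup>2) * (hardy_norm g)\<^sup>2"
    using r by (intro add_mono mult_left_mono hardy_space_radial_mean f g) auto
  finally show "radial_mean (\<lambda>z. a * f z + b * g z) r
    \<le> (2 * (cmod a)\<^sup>2) * (hardy_norm f)\<^sup>2 + (2 * (cmod b)\<^sup>2) * (hardy_norm g)\<^sup>2" .
qed (intro holomorphic_ext0_combine hardy_space_ext0 f g)

lemma hardy_space_diff: "f \<in> hardy_space \<Longrightarrow> g \<in> hardy_space \<Longrightarrow> (\<lambda>z. f z - g z) \<in> hardy_space"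
  using hardy_space_combine[of f g 1 "-1"] by simp

section \<open>The inner product\<close>

lemma torus_mean_sum:
  assumes "finite I" "\<And>i. i \<in> I \<Longrightarrow> continuous_on torus (F i)"
  shows "torus_mean (\<lambda>w. \<Sum>i\<in>I. F i w) = (\<Sum>i\<in>I. torus_mean (F i))"
  using assms
  by (induction I rule: finite_induct) (simp_all add: torus_mean_add continuous_on_sum)

text \<open>Polarization: \<open>4 u cnj v\<close> is the sum of \<open>i^k |u + i^k v|^2\<close>
  over \<open>k < 4\<close>, and each combination \<open>f + i^k g\<close> has convergent radial
  means.\<close>

lemma tendsto_radial_inner:
  assumes f: "f \<in> hardy_space" and g: "g \<in> hardy_space"
  shows "(radial_inner f g \<longlongrightarrow> hardy_inner f g) (at_left 1)"
proof -
  let ?c = "\<lambda>a z. f z + a * g z"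
  have comb: "?c a \<in> hardy_space" for a
    using hardy_space_combine[OF f g, of 1 a] by simp
  define l where "l = (\<Sum>k<4. \<i> ^ k * of_real ((hardy_norm (?c (\<i> ^ k)))\<^sup>2)) / 4"
  have "((\<lambda>r. (\<Sum>k<4. \<i> ^ k * of_real (radial_mean (?c (\<i> ^ k)) r)) / 4) \<longlongrightarrow> l) (at_left 1)"
    unfolding l_def by (intro tendsto_intros hardy_space_radial_mean comb) simp
  moreover have "(\<Sum>k<4. \<i> ^ k * of_real (radial_mean (?c (\<i> ^ k)) r)) / 4 = radial_inner f g r"
    if r: "0 < r" "r < 1" for r
  proof -
    have cont: "continuous_on torus (\<lambda>w. f (r *\<^sub>R w))" "continuous_on torus (\<lambda>w. g (r *\<^sub>R w))"
      using r by (auto intro!: continuous_on_dilate hardy_space_holomorphic f g)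
    have lin: "bounded_linear (\<lambda>x. \<i> ^ k * of_real x / 4)" for k
      by (rule bounded_linear_compose[OF bounded_linear_divide
            bounded_linear_compose[OF bounded_linear_mult_right bounded_linear_of_real]])
    have eq: "\<i> ^ k * of_real (radial_mean (?c (\<i> ^ k)) r) / 4
      = torus_mean (\<lambda>w. \<i> ^ k * of_real ((cmod (f (r *\<^sub>R w) + \<i> ^ k * g (r *\<^sub>R w)))\<^sup>2) / 4)" for k
      unfolding radial_mean_def
      by (intro torus_mean_linear[OF lin, symmetric] continuous_intros cont)
    have sum4: "(\<Sum>k<4. F k) = F 0 + F 1 + F 2 + F 3" for F :: "nat \<Rightarrow> complex"
      by (simp add: eval_nat_numeral)
    have pol: "u * cnj v = (\<Sum>k<4. \<i> ^ k * of_real ((cmod (u + \<i> ^ k * v))\<^sup>2) / 4)" for u v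
      by (simp add: sum4 power3_eq_cube complex_eq_iff cmod_power2)
        (simp add: power2_eq_square field_simps)
    have "radial_inner f g r = torus_mean (\<lambda>w. \<Sum>k<4. \<i> ^ k * of_real ((cmod (f (r *\<^sub>R w) + \<i> ^ k * g (r *\<^sub>R w)))\<^sup>2) / 4)"
      unfolding radial_inner_def pol ..
    also have "\<dots> = (\<Sum>k<4. \<i> ^ k * of_real (radial_mean (?c (\<i> ^ k)) r) / 4)"
      unfolding eq
      by (intro torus_mean_sum continuous_intros cont) auto
    finally show ?thesis
      by (simp add: sum_divide_distrib)
  qed
  ultimately have lim: "(radial_inner f g \<longlongrightarrow> l) (at_left 1)"
    by (elim Lim_transform_eventually) (use eventually_at_left_1 in eventually_elim, auto)
  then have "((\<lambda>r. LINT w|torus_measure. f (r *\<^sub>R w) * cnj (g (r *\<^sub>R w))) \<longlongrightarrow> l) (at_left 1)"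
    by (rule Lim_transform_eventually)
      (use eventually_at_left_1 in eventually_elim, simp add: LINT_radial_inner hardy_space_ext0 f g)
  then have "hardy_inner f g = l"
    unfolding hardy_inner_def by (rule tendsto_Lim[OF trivial_limit_at_left_real])
  then show ?thesis
    using lim by simp
qed

lemma hardy_inner_eqI:
  assumes "f \<in> hardy_space" "g \<in> hardy_space" "(radial_inner f g \<longlongrightarrow> l) (at_left 1)"
  shows "hardy_inner f g = l"
  using tendsto_unique[OF trivial_limit_at_left_real tendsto_radial_inner[OF assms(1,2)] assms(3)] .

lemma hardy_inner_cnj:
  assumes f: "f \<in> hardy_space" and g: "g \<in> hardy_space"
  shows "hardy_inner g f = cnj (hardy_inner f g)"
proof (rule hardy_inner_eqI[OF g f])
  have "((\<lambda>r. cnj (radial_inner f g r)) \<longlongrightarrow> cnj (hardy_inner f g)) (at_left 1)"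
    by (intro tendsto_intros tendsto_radial_inner f g)
  then show "(radial_inner g f \<longlongrightarrow> cnj (hardy_inner f g)) (at_left 1)"
  proof (rule Lim_transform_eventually, use eventually_at_left_1 in eventually_elim)
    fix r :: real assume r: "0 < r \<and> r < 1"
    have cont: "continuous_on torus (\<lambda>w. f (r *\<^sub>R w))" "continuous_on torus (\<lambda>w. g (r *\<^sub>R w))"
      using r by (auto intro!: continuous_on_dilate hardy_space_holomorphic f g)
    then show "cnj (radial_inner f g r) = radial_inner g f r"
      unfolding radial_inner_def
      by (subst torus_mean_linear[OF bounded_linear_cnj, symmetric]) (auto intro!: continuous_intros simp: mult.commute)
  qed
qed

lemma hardy_inner_combine_left:
  assumes f: "f \<in> hardy_space" and g: "g \<in> hardy_space" and h: "h \<in> hardy_space"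
  shows "hardy_inner (\<lambda>z. a * f z + b * g z) h = a * hardy_inner f h + b * hardy_inner g h"
proof (rule hardy_inner_eqI[OF hardy_space_combine[OF f g] h])
  have "((\<lambda>r. a * radial_inner f h r + b * radial_inner g h r) \<longlongrightarrow> a * hardy_inner f h + b * hardy_inner g h) (at_left 1)"
    by (intro tendsto_intros tendsto_radial_inner f g h)
  then show "(radial_inner (\<lambda>z. a * f z + b * g z) h \<longlongrightarrow> a * hardy_inner f h + b * hardy_inner g h) (at_left 1)"
  proof (rule Lim_transform_eventually, use eventually_at_left_1 in eventually_elim)
    fix r :: real assume r: "0 < r \<and> r < 1"
    have cont: "continuous_on torus (\<lambda>w. f (r *\<^sub>R w))" "continuous_on torus (\<lambda>w. g (r *\<^sub>R w))"
      "continuous_on torus (\<lambda>w. h (r *\<^sub>R w))"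
      using r by (auto intro!: continuous_on_dilate hardy_space_holomorphic f g h)
    have "a * radial_inner f h r + b * radial_inner g h r
      = torus_mean (\<lambda>w. a * (f (r *\<^sub>R w) * cnj (h (r *\<^sub>R w)))) + torus_mean (\<lambda>w. b * (g (r *\<^sub>R w) * cnj (h (r *\<^sub>R w))))"
      unfolding radial_inner_def
      by (intro arg_cong2[where f = "(+)"] torus_mean_linear[OF bounded_linear_mult_right, symmetric] continuous_intros cont)
    also have "\<dots> = radial_inner (\<lambda>z. a * f z + b * g z) h r"
      unfolding radial_inner_def
      by (subst torus_mean_add[symmetric]) (auto intro!: continuous_intros cont simp: algebra_simps)
    finally show "a * radial_inner f h r + b * radial_inner g h r = radial_inner (\<lambda>z. a * f z + b * g z) h r" .
  qed
qed

lemma hardy_inner_combine_right: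
  assumes f: "f \<in> hardy_space" and g: "g \<in> hardy_space" and h: "h \<in> hardy_space"
  shows "hardy_inner h (\<lambda>z. a * f z + b * g z) = cnj a * hardy_inner h f + cnj b * hardy_inner h g"
  using hardy_inner_combine_left[OF f g h, of a b] hardy_space_combine[OF f g, of a b]
  by (simp add: hardy_inner_cnj[of _ h] f g h)

lemma hardy_inner_diff_left:
  "f \<in> hardy_space \<Longrightarrow> g \<in> hardy_space \<Longrightarrow> h \<in> hardy_space \<Longrightarrow>
    hardy_inner (\<lambda>z. f z - g z) h = hardy_inner f h - hardy_inner g h"
  using hardy_inner_combine_left[of f g h 1 "-1"] by simp

lemma hardy_inner_zero_left: "h \<in> hardy_space \<Longrightarrow> hardy_inner (\<lambda>z. 0) h = 0"
  using hardy_inner_combine_left[of h h h 0 0] by simp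

section \<open>Bounded functions\<close>

lemma hardy_spaceI_bounded:
  fixes f :: "'n::finite cfun"
  assumes f: "f \<in> holomorphic_ext0" and B: "\<And>z. z \<in> unit_polydisc \<Longrightarrow> cmod (f z) \<le> B"
  shows "f \<in> hardy_space" "hardy_norm f \<le> B"
proof -
  have hol: "cn_holomorphic_on f unit_polydisc"
    using f by (simp add: holomorphic_ext0_def)
  have "0 \<in> (unit_polydisc :: (complex ^ 'n) set)"
    by (simp add: polydisc_def)
  from order_trans[OF norm_ge_zero B[OF this]] have "0 \<le> B" .
  have le: "radial_mean f r \<le> B\<^sup>2" if r: "0 < r" "r < 1" for r
  proof -
    have "radial_mean f r \<le> torus_mean (\<lambda>w :: complex ^ 'n. B\<^sup>2)"
      unfolding radial_mean_def using r
      by (intro torus_mean_mono continuous_intros continuous_on_dilate[OF hol] power_mono B scaleR_torus_in_polydisc) auto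
    then show ?thesis
      by simp
  qed
  from hardy_spaceI_radial_mean[OF f le] \<open>0 \<le> B\<close> show "f \<in> hardy_space" "hardy_norm f \<le> B"
    by simp_all
qed

text \<open>A form of the Cauchy-Schwarz inequality suited to bounded test functions in the second
  argument. The mean \<open>m\<close> of \<open>|f|\<close> is compared with the Hardy norm by
  averaging \<open>2 m |f| <= m^2 + |f|^2\<close>.\<close>

lemma norm_hardy_inner_le:
  fixes f :: "'n::finite cfun"
  assumes f: "f \<in> hardy_space" and g: "g \<in> hardy_space" and B: "\<And>z. z \<in> unit_polydisc \<Longrightarrow> cmod (g z) \<le> B"
  shows "cmod (hardy_inner f g) \<le> B * hardy_norm f"
proof (rule tendsto_upperbound[OF tendsto_norm[OF tendsto_radial_inner[OF f g]] eventually_mono[OF eventually_at_left_1]])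
  fix r :: real assume r: "0 < r \<and> r < 1"
  have "0 \<in> (unit_polydisc :: (complex ^ 'n) set)"
    by (simp add: polydisc_def)
  from order_trans[OF norm_ge_zero B[OF this]] have "0 \<le> B" .
  have cont: "continuous_on torus (\<lambda>w. f (r *\<^sub>R w))" "continuous_on torus (\<lambda>w. g (r *\<^sub>R w))"
    using r by (auto intro!: continuous_on_dilate hardy_space_holomorphic f g)
  define m where "m = torus_mean (\<lambda>w. cmod (f (r *\<^sub>R w)))"
  have "m * m = torus_mean (\<lambda>w. m * cmod (f (r *\<^sub>R w)))"
    unfolding m_def by (intro torus_mean_linear[OF bounded_linear_mult_right, symmetric] continuous_intros cont)
  also have "\<dots> \<le> torus_mean (\<lambda>w. m\<^sup>2 / 2 + (1 / 2) * (cmod (f (r *\<^sub>R w)))\<^sup>2)"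
  proof (rule torus_mean_mono)
    show "m * cmod (f (r *\<^sub>R w)) \<le> m\<^sup>2 / 2 + 1 / 2 * (cmod (f (r *\<^sub>R w)))\<^sup>2" for w
      using sum_squares_bound[of m "cmod (f (r *\<^sub>R w))"] by simp
  qed (intro continuous_intros cont)+
  also have "\<dots> = torus_mean (\<lambda>w :: complex ^ 'n. m\<^sup>2 / 2) + torus_mean (\<lambda>w. (1 / 2) * (cmod (f (r *\<^sub>R w)))\<^sup>2)"
    by (intro torus_mean_add continuous_intros cont)
  also have "torus_mean (\<lambda>w. (1 / 2) * (cmod (f (r *\<^sub>R w)))\<^sup>2) = (1 / 2) * radial_mean f r"
    unfolding radial_mean_def
    by (intro torus_mean_linear[OF bounded_linear_mult_right] continuous_intros cont)
  finally have "m\<^sup>2 \<le> radial_mean f r"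
    by (simp add: power2_eq_square)
  also have "\<dots> \<le> (hardy_norm f)\<^sup>2"
    using r by (intro hardy_space_radial_mean f) auto
  finally have m: "m \<le> hardy_norm f"
    using hardy_space_radial_mean(2)[OF f] by (rule power2_le_imp_le)
  have "cmod (radial_inner f g r) \<le> torus_mean (\<lambda>w. B * cmod (f (r *\<^sub>R w)))"
    unfolding radial_inner_def
  proof (rule norm_torus_mean_le)
    fix w :: "complex ^ 'n" assume "w \<in> torus"
    then show "cmod (f (r *\<^sub>R w) * cnj (g (r *\<^sub>R w))) \<le> B * cmod (f (r *\<^sub>R w))"
      using r B[OF scaleR_torus_in_polydisc[of r w]] by (simp add: norm_mult mult.commute[of B] mult_left_mono)
  qed (intro continuous_intros cont)+
  also have "\<dots> = B * m"
    unfolding m_def by (intro torus_mean_linear[OF bounded_linear_mult_right] continuous_intros cont)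
  also have "\<dots> \<le> B * hardy_norm f"
    using m \<open>0 \<le> B\<close> by (rule mult_left_mono)
  finally show "cmod (radial_inner f g r) \<le> B * hardy_norm f" .
qed simp

subsection \<open>Reproducing kernels\<close>

definition closed_polydisc :: "real \<Rightarrow> (complex ^ 'n) set" where
  "closed_polydisc R = {z. \<forall>k. cmod (z $ k) \<le> R}"

lemma compact_closed_polydisc [simp]: "compact (closed_polydisc R :: (complex ^ 'n::finite) set)"
proof (rule compact_eq_bounded_closed[THEN iffD2], intro conjI)
  have "norm z \<le> (\<Sum>i\<in>(UNIV :: 'n set). R)" if "z \<in> closed_polydisc R" for z :: "complex ^ 'n"
  proof -
    have "norm z \<le> (\<Sum>i\<in>UNIV. cmod (z $ i))"
      by (simp add: norm_vec_def L2_set_le_sum)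
    also have "\<dots> \<le> (\<Sum>i\<in>(UNIV :: 'n set). R)"
      using that by (intro sum_mono) (auto simp: closed_polydisc_def)
    finally show ?thesis .
  qed
  then show "bounded (closed_polydisc R :: (complex ^ 'n) set)"
    by (intro boundedI) auto
  have "closed_polydisc R = (\<Inter>k. {z :: complex ^ 'n. cmod (z $ k) \<le> R})"
    by (auto simp: closed_polydisc_def)
  then show "closed (closed_polydisc R :: (complex ^ 'n) set)"
    by (auto intro!: closed_Collect_le continuous_intros)
qed

lemma polydisc_subset_closed: "polydisc R \<subseteq> closed_polydisc R"
  by (auto simp: polydisc_def closed_polydisc_def less_imp_le)

lemma compact_torus [simp]: "compact (torus :: (complex ^ 'n::finite) set)"
proof -
  have "torus = (\<Inter>k. {z :: complex ^ 'n. cmod (z $ k) = 1})"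
    by (auto simp: torus_def)
  moreover have "closed (\<Inter>k. {z :: complex ^ 'n. cmod (z $ k) = 1})"
    by (intro closed_INT ballI closed_Collect_eq continuous_intros)
  ultimately have "closed (torus :: (complex ^ 'n) set)"
    by simp
  then have "compact (closed_polydisc 1 \<inter> torus :: (complex ^ 'n) set)"
    by (intro compact_Int_closed) auto
  moreover have "closed_polydisc 1 \<inter> torus = (torus :: (complex ^ 'n) set)"
    by (auto simp: torus_def closed_polydisc_def)
  ultimately show ?thesis
    by simp
qed

text \<open>The union of the polydisc and the torus is not compact when there is more than one variable.
  This cone over the torus is compact, and it suffices for the maximum principle.\<close>

definition star_torus :: "(complex ^ 'n) set" where
  "star_torus = (\<lambda>(r, w). r *\<^sub>R w) ` ({0..1} \<times> torus)"

lemma compact_star_torus: "compact (star_torus :: (complex ^ 'n::finite) set)"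
  unfolding star_torus_def case_prod_beta
  by (intro compact_continuous_image compact_Times continuous_intros) auto

lemma star_torus_subset: "star_torus \<subseteq> unit_polydisc \<union> torus"
proof
  fix z :: "complex ^ 'a" assume "z \<in> star_torus"
  then obtain r w where z: "z = r *\<^sub>R w" "0 \<le> r" "r \<le> 1" "w \<in> torus"
    by (auto simp: star_torus_def)
  then show "z \<in> unit_polydisc \<union> torus"
    by (cases "r = 1") (auto simp: torus_def polydisc_def)
qed

lemma scaleR_in_star_torus: "0 \<le> r \<Longrightarrow> r \<le> 1 \<Longrightarrow> w \<in> torus \<Longrightarrow> r *\<^sub>R w \<in> star_torus"
  by (force simp: star_torus_def)

lemma holomorphic_continuous_torus_bounded:
  fixes f :: "'n::finite cfun"
  assumes hol: "cn_holomorphic_on f unit_polydisc" and cont: "continuous_on (unit_polydisc \<union> torus) f"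
  obtains B where "\<And>z. z \<in> unit_polydisc \<Longrightarrow> cmod (f z) \<le> B"
proof -
  have "compact (f ` star_torus)"
    by (intro compact_continuous_image compact_star_torus continuous_on_subset[OF cont] star_torus_subset)
  then obtain B where B: "\<And>z. z \<in> star_torus \<Longrightarrow> cmod (f z) \<le> B"
    using compact_imp_bounded[of "f ` star_torus"] by (auto simp: bounded_iff)
  from that maximum_principle_polydisc[OF hol] show thesis
    by (metis B less_imp_le scaleR_in_star_torus)
qed

lemma hardy_spaceI_continuous_torus:
  fixes f :: "'n::finite cfun"
  assumes hol: "cn_holomorphic_on f unit_polydisc" and cont: "continuous_on (unit_polydisc \<union> torus) f"
  shows "(\<lambda>z. if z \<in> unit_polydisc then f z else 0) \<in> hardy_space"
proof -
  obtain B where "\<And>z. z \<in> unit_polydisc \<Longrightarrow> cmod (f z) \<le> B"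
    using holomorphic_continuous_torus_bounded[OF assms] by blast
  then show ?thesis
    by (intro hardy_spaceI_bounded(1)[OF holomorphic_ext0I[OF hol]]) auto
qed

text \<open>The kernel without its cut-off outside the polydisc: it stays continuous up to the
  boundary, and conjugation exchanges its two arguments.\<close>

definition kernel_prod :: "complex ^ 'n::finite \<Rightarrow> complex ^ 'n \<Rightarrow> complex" where
  "kernel_prod x z = (\<Prod>i\<in>UNIV. inverse (1 - cnj (x $ i) * z $ i))"

text \<open>The derivative in \<open>z\<close> in direction \<open>v\<close>, as the kernel times
  its logarithmic derivative.\<close>

definition kernel_deriv :: "complex ^ 'n::finite \<Rightarrow> complex ^ 'n \<Rightarrow> complex ^ 'n \<Rightarrow> complex" where
  "kernel_deriv x z v = kernel_prod x z * (\<Sum>i\<in>UNIV. cnj (x $ i) * v $ i * inverse (1 - cnj (x $ i) * z $ i))"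

lemma hardy_kernel_eq: "hardy_kernel x = (\<lambda>z. if z \<in> unit_polydisc then kernel_prod x z else 0)"
  unfolding hardy_kernel_def kernel_prod_def ..

lemma kernel_prod_cnj: "kernel_prod x z = cnj (kernel_prod z x)"
  by (simp add: kernel_prod_def mult.commute)

text \<open>Nonvanishing denominators are the symmetric form of the requirement: either argument may
  lie on the boundary as long as the other one is interior.\<close>

definition kernel_domain :: "((complex ^ 'n) \<times> (complex ^ 'n)) set" where
  "kernel_domain = {(x, z). \<forall>i. 1 - cnj (x $ i) * z $ i \<noteq> 0}"

lemma kernel_domainI:
  "x \<in> unit_polydisc \<Longrightarrow> z \<in> closed_polydisc 1 \<Longrightarrow> (x, z) \<in> kernel_domain"
  "z \<in> unit_polydisc \<Longrightarrow> x \<in> closed_polydisc 1 \<Longrightarrow> (x, z) \<in> kernel_domain"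
  using one_minus_cnj_mult_neq_0 by (auto simp: kernel_domain_def polydisc_def closed_polydisc_def) (metis mult.commute)+

lemma continuous_on_kernel_prod [continuous_intros]:
  assumes "continuous_on S f" "continuous_on S g" "\<And>s. s \<in> S \<Longrightarrow> (f s, g s) \<in> kernel_domain"
  shows "continuous_on S (\<lambda>s. kernel_prod (f s) (g s))"
  unfolding kernel_prod_def
  by (intro continuous_intros assms) (use assms(3) in \<open>auto simp: kernel_domain_def\<close>)

lemma continuous_on_kernel_deriv [continuous_intros]:
  assumes "continuous_on S f" "continuous_on S g" "continuous_on S h" "\<And>s. s \<in> S \<Longrightarrow> (f s, g s) \<in> kernel_domain"
  shows "continuous_on S (\<lambda>s. kernel_deriv (f s) (g s) (h s))"
  unfolding kernel_deriv_def
  by (intro continuous_intros assms) (use assms(4) in \<open>auto simp: kernel_domain_def\<close>)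

lemma kernel_deriv_scale: "kernel_deriv x z (c *s v) = c * kernel_deriv x z v"
  by (simp add: kernel_deriv_def sum_distrib_left mult_ac)

lemma has_derivative_kernel_prod:
  fixes x z :: "complex ^ 'n::finite"
  assumes "(x, z) \<in> kernel_domain"
  shows "(kernel_prod x has_derivative kernel_deriv x z) (at z)"
proof -
  have nz: "1 - cnj (x $ i) * z $ i \<noteq> 0" for i
    using assms by (simp add: kernel_domain_def)
  define D where "D i v = cnj (x $ i) * v $ i * inverse (1 - cnj (x $ i) * z $ i) * inverse (1 - cnj (x $ i) * z $ i)"
    for i and v :: "complex ^ 'n"
  have nth: "((\<lambda>z. z $ i) has_derivative (\<lambda>v. v $ i)) (at z)" for i
    by (simp add: bounded_linear_imp_has_derivative bounded_linear_vec_nth)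
  have "((\<lambda>z. inverse (1 - cnj (x $ i) * z $ i)) has_derivative D i) (at z)" for i
    using Deriv.has_derivative_inverse[OF nz has_derivative_diff[OF has_derivative_const has_derivative_mult_right[OF nth]], of i]
    by (rule has_derivative_eq_rhs) (simp add: D_def fun_eq_iff mult_ac)
  then have "(kernel_prod x has_derivative (\<lambda>v. \<Sum>i\<in>UNIV. D i v * (\<Prod>j\<in>UNIV - {i}. inverse (1 - cnj (x $ j) * z $ j)))) (at z)"
    unfolding kernel_prod_def[abs_def] by (intro has_derivative_prod) auto
  moreover have "(\<Sum>i\<in>UNIV. D i v * (\<Prod>j\<in>UNIV - {i}. inverse (1 - cnj (x $ j) * z $ j))) = kernel_deriv x z v" for v
    unfolding kernel_deriv_def sum_distrib_left
  proof (intro sum.cong refl)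
    fix i
    have "kernel_prod x z = inverse (1 - cnj (x $ i) * z $ i) * (\<Prod>j\<in>UNIV - {i}. inverse (1 - cnj (x $ j) * z $ j))"
      unfolding kernel_prod_def by (rule prod.remove) auto
    then show "D i v * (\<Prod>j\<in>UNIV - {i}. inverse (1 - cnj (x $ j) * z $ j))
        = kernel_prod x z * (cnj (x $ i) * v $ i * inverse (1 - cnj (x $ i) * z $ i))"
      by (simp add: D_def mult_ac)
  qed
  ultimately show ?thesis
    by simp
qed

lemma cn_holomorphic_on_kernel_prod:
  assumes "x \<in> unit_polydisc"
  shows "cn_holomorphic_on (kernel_prod x) unit_polydisc"
proof (rule cn_holomorphic_onI)
  show "(kernel_prod x has_derivative kernel_deriv x z) (at z)" if "z \<in> unit_polydisc" for z
    using that assms polydisc_subset_closed by (intro has_derivative_kernel_prod kernel_domainI) auto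
qed (rule kernel_deriv_scale)

lemma unit_polydisc_torus_subset: "unit_polydisc \<union> torus \<subseteq> closed_polydisc 1"
  by (auto simp: polydisc_def torus_def closed_polydisc_def less_imp_le)

lemma hardy_kernel_in_hardy_space:
  assumes "x \<in> unit_polydisc"
  shows "hardy_kernel x \<in> hardy_space"
  unfolding hardy_kernel_eq
  by (intro hardy_spaceI_continuous_torus cn_holomorphic_on_kernel_prod assms continuous_intros kernel_domainI)
    (use unit_polydisc_torus_subset in auto)

text \<open>Cauchy's formula for the dilate \<open>w \<mapsto> f (r w)\<close> at the point
  \<open>r x\<close>. Both arguments of the inner product are dilated, hence the value
  \<open>f (r^2 x)\<close>, which tends to \<open>f x\<close>.\<close>

lemma hardy_inner_hardy_kernel:
  fixes f :: "'n::finite cfun"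
  assumes f: "f \<in> hardy_space" and x: "x \<in> unit_polydisc"
  shows "hardy_inner f (hardy_kernel x) = f x"
proof (rule hardy_inner_eqI[OF f hardy_kernel_in_hardy_space[OF x]])
  note hol = hardy_space_holomorphic[OF f]
  have "radial_inner f (hardy_kernel x) r = f (r\<^sup>2 *\<^sub>R x)" if r: "0 < r" "r < 1" for r
  proof -
    define c :: "complex ^ 'n" where "c = (\<chi> i. of_real r)"
    have c: "c * w = r *\<^sub>R w" for w
      by (simp add: c_def vec_eq_iff) (simp add: scaleR_conv_of_real)
    have rx: "r *\<^sub>R x \<in> unit_polydisc"
    proof -
      have "r * cmod (x $ k) < 1" for k
        using mult_strict_mono'[of r 1 "cmod (x $ k)" 1] r x by (auto simp: polydisc_def)
      then show ?thesis
        using r by (simp add: polydisc_def)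
    qed
    have "cn_holomorphic_on (\<lambda>w. f (c * w)) (polydisc (1 / r))"
      using r by (intro cn_holomorphic_on_times hol) (auto simp: c_def)
    from Cauchy_torus_mean[OF this _ rx] r
    have "torus_mean (\<lambda>w. f (r *\<^sub>R w) * (\<Prod>i\<in>UNIV. inverse (1 - (r *\<^sub>R x) $ i * cnj (w $ i)))) = f (r *\<^sub>R r *\<^sub>R x)"
      by (simp add: c)
    moreover have "(\<Prod>i\<in>UNIV. inverse (1 - (r *\<^sub>R x) $ i * cnj (w $ i))) = cnj (hardy_kernel x (r *\<^sub>R w))"
      if "w \<in> torus" for w
      using scaleR_torus_in_polydisc[of r w] r that by (simp add: hardy_kernel_def)
    ultimately show ?thesis
      unfolding radial_inner_def by (simp add: power2_eq_square cong: torus_mean_cong)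
  qed
  moreover have "((\<lambda>r. f (r\<^sup>2 *\<^sub>R x)) \<longlongrightarrow> f (1\<^sup>2 *\<^sub>R x)) (at_left 1)"
  proof (rule isCont_tendsto_compose[where g = f])
    show "isCont f (1\<^sup>2 *\<^sub>R x)"
      using continuous_on_interior[OF cn_holomorphic_on_imp_continuous_on[OF hol]] x
      by (simp add: interior_open)
    show "((\<lambda>r. r\<^sup>2 *\<^sub>R x) \<longlongrightarrow> 1\<^sup>2 *\<^sub>R x) (at_left (1::real))"
      by (intro tendsto_intros)
  qed
  ultimately show "(radial_inner f (hardy_kernel x) \<longlongrightarrow> f x) (at_left 1)"
    by (auto elim!: Lim_transform_eventually intro: eventually_mono[OF eventually_at_left_1])
qed

lemma hardy_norm_zero: "hardy_norm (\<lambda>z. 0) = 0"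
proof -
  have 0: "(\<lambda>z. 0) \<in> holomorphic_ext0"
    by (auto simp: holomorphic_ext0_def)
  have "(\<lambda>z. 0) \<in> hardy_space" "hardy_norm (\<lambda>z. 0) \<le> 0"
    by (rule hardy_spaceI_bounded[OF 0, of 0], simp)+
  then show ?thesis
    using hardy_space_radial_mean(2) order_antisym by blast
qed

section \<open>Differentiating an inner product along a path\<close>

lemma has_vector_derivative_compose_path:
  assumes "(f has_derivative L) (at (\<gamma> s))" "(\<gamma> has_vector_derivative v) (at s within S)"
  shows "((\<lambda>s. f (\<gamma> s)) has_vector_derivative L v) (at s within S)"
  using vector_derivative_diff_chain_within[OF assms(2) has_derivative_at_withinI[OF assms(1)]]
  by (simp add: o_def)

text \<open>The product rule, from \<open><f s, Q s> = <f s, Q s\<^sub>0> + (s - s\<^sub>0) <f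
  s\<^sub>0, D> + R s\<close>. The remainder pairs \<open>f s - f s\<^sub>0\<close>, which is small
  in norm, with \<open>Q s - Q s\<^sub>0\<close>, which is of order \<open>s - s\<^sub>0\<close> in
  the supremum norm, and it pairs \<open>f s\<^sub>0\<close> with the linearization error of
  \<open>Q\<close>. So \<open>f\<close> need only be continuous in norm and differentiable against
  the fixed function \<open>Q s\<^sub>0\<close>.\<close>

lemma has_vector_derivative_hardy_inner:
  fixes f Q :: "real \<Rightarrow> 'n::finite cfun"
  assumes S: "open S" "s\<^sub>0 \<in> S"
    and f: "\<And>s. s \<in> S \<Longrightarrow> f s \<in> hardy_space" and Q: "\<And>s. s \<in> S \<Longrightarrow> Q s \<in> hardy_space"
    and D: "D \<in> hardy_space" "\<And>z. z \<in> unit_polydisc \<Longrightarrow> cmod (D z) \<le> B"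
    and cont: "((\<lambda>s. hardy_norm (\<lambda>z. f s z - f s\<^sub>0 z)) \<longlongrightarrow> 0) (at s\<^sub>0)"
    and deriv: "((\<lambda>s. hardy_inner (f s) (Q s\<^sub>0)) has_vector_derivative a) (at s\<^sub>0)"
    and unif: "\<And>\<epsilon>. \<epsilon> > 0 \<Longrightarrow> eventually (\<lambda>s. \<forall>z\<in>unit_polydisc.
        cmod (Q s z - Q s\<^sub>0 z - (s - s\<^sub>0) *\<^sub>R D z) \<le> \<epsilon> * \<bar>s - s\<^sub>0\<bar>) (at s\<^sub>0)"
  shows "((\<lambda>s. hardy_inner (f s) (Q s)) has_vector_derivative a + hardy_inner (f s\<^sub>0) D) (at s\<^sub>0)"
proof -
  \<comment> \<open>The linearization error of \<open>Q\<close>, written as nested combinations so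
    that \<open>hardy_space_combine\<close> and \<open>hardy_inner_combine_right\<close> match it
    literally.\<close>
  define E where "E s z = 1 * (1 * Q s z + (-1) * Q s\<^sub>0 z) + (- of_real (s - s\<^sub>0)) * D z" for s z
  define d where "d s z = f s z - f s\<^sub>0 z" for s z
  define R where "R s = hardy_inner (d s) (\<lambda>z. Q s z - Q s\<^sub>0 z) + hardy_inner (f s\<^sub>0) (E s)" for s
  have dH: "d s \<in> hardy_space" if "s \<in> S" for s
    unfolding d_def by (intro hardy_space_diff f that S)
  have EH: "E s \<in> hardy_space" if "s \<in> S" for s
    unfolding E_def by (intro hardy_space_combine Q that S D)
  have QH: "(\<lambda>z. Q s z - Q s\<^sub>0 z) \<in> hardy_space" if "s \<in> S" for s
    by (intro hardy_space_diff Q that S)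
  have E_eq: "E s z = Q s z - Q s\<^sub>0 z - (s - s\<^sub>0) *\<^sub>R D z" for s z
    by (simp add: E_def scaleR_conv_of_real algebra_simps)
  have evS: "eventually (\<lambda>s. s \<in> S) (at s\<^sub>0)"
    using S eventually_at_topological by blast
  have "0 \<in> (unit_polydisc :: (complex ^ 'n) set)"
    by (simp add: polydisc_def)
  from order_trans[OF norm_ge_zero D(2)[OF this]] have B: "0 \<le> B" .
  have f0: "0 \<le> hardy_norm (f s\<^sub>0)"
    by (intro hardy_space_radial_mean f S)
  have "(R has_derivative (\<lambda>_. 0)) (at s\<^sub>0)"
  proof (rule has_derivative_at_withinI, subst has_derivative_iff_norm, intro conjI)
    have R0: "R s\<^sub>0 = 0"
    proof -
      have "d s\<^sub>0 = (\<lambda>z. 0)" "E s\<^sub>0 = (\<lambda>z. 0)"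
        by (auto simp: d_def E_def)
      moreover have "hardy_inner (f s\<^sub>0) (\<lambda>z. 0) = 0"
        using hardy_inner_combine_right[OF D(1) D(1) f[OF S(2)], of 0 0] by simp
      moreover have "hardy_inner (\<lambda>z. 0) (\<lambda>z. Q s\<^sub>0 z - Q s\<^sub>0 z) = 0"
        by (intro hardy_inner_zero_left QH S)
      ultimately show ?thesis
        by (simp add: R_def)
    qed
    show "((\<lambda>s. norm (R s - R s\<^sub>0 - 0) / norm (s - s\<^sub>0)) \<longlongrightarrow> 0) (at s\<^sub>0)"
    proof (rule tendstoI)
      fix e :: real assume e: "e > 0"
      \<comment> \<open>The cap 1 keeps the difference quotient of \<open>Q\<close> below
        \<open>B + 1\<close>; the other bound grants half of \<open>e\<close> to the second term of
        \<open>R\<close>.\<close>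
      define \<epsilon> where "\<epsilon> = min 1 (e / (2 * (1 + hardy_norm (f s\<^sub>0))))"
      have \<epsilon>: "\<epsilon> > 0" "\<epsilon> \<le> 1" "\<epsilon> * hardy_norm (f s\<^sub>0) \<le> e / 2"
      proof -
        have "\<epsilon> * hardy_norm (f s\<^sub>0) \<le> e / (2 * (1 + hardy_norm (f s\<^sub>0))) * hardy_norm (f s\<^sub>0)"
          unfolding \<epsilon>_def using f0 by (intro mult_right_mono) auto
        also have "\<dots> \<le> e / 2"
          using f0 e by (simp add: field_simps)
        finally show "\<epsilon> * hardy_norm (f s\<^sub>0) \<le> e / 2" .
      qed (use e f0 in \<open>auto simp: \<epsilon>_def\<close>)
      have "eventually (\<lambda>s. hardy_norm (d s) < e / (2 * (B + 1))) (at s\<^sub>0)"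
        using order_tendstoD(2)[OF cont, of "e / (2 * (B + 1))"] e B by (simp add: d_def[abs_def])
      moreover have "eventually (\<lambda>s. s \<noteq> s\<^sub>0) (at s\<^sub>0)"
        by (simp add: eventually_at_filter)
      ultimately show "eventually (\<lambda>s. dist (norm (R s - R s\<^sub>0 - 0) / norm (s - s\<^sub>0)) 0 < e) (at s\<^sub>0)"
        using evS unif[OF \<epsilon>(1)]
      proof eventually_elim
        fix s assume small: "hardy_norm (d s) < e / (2 * (B + 1))" and neq: "s \<noteq> s\<^sub>0" and s: "s \<in> S"
          and "\<forall>z\<in>unit_polydisc. cmod (Q s z - Q s\<^sub>0 z - (s - s\<^sub>0) *\<^sub>R D z) \<le> \<epsilon> * \<bar>s - s\<^sub>0\<bar>"
        then have le: "cmod (E s z) \<le> \<epsilon> * \<bar>s - s\<^sub>0\<bar>" if "z \<in> unit_polydisc" for z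
          using that by (simp add: E_eq)
        have "cmod (Q s z - Q s\<^sub>0 z) \<le> (B + 1) * \<bar>s - s\<^sub>0\<bar>" if z: "z \<in> unit_polydisc" for z
        proof -
          have "Q s z - Q s\<^sub>0 z = E s z + (s - s\<^sub>0) *\<^sub>R D z"
            by (simp add: E_eq)
          then have "cmod (Q s z - Q s\<^sub>0 z) \<le> cmod (E s z) + \<bar>s - s\<^sub>0\<bar> * cmod (D z)"
            by (metis norm_scaleR norm_triangle_ineq)
          also have "\<dots> \<le> 1 * \<bar>s - s\<^sub>0\<bar> + \<bar>s - s\<^sub>0\<bar> * B"
            using \<epsilon>(2) by (intro add_mono order_trans[OF le[OF z]] mult_right_mono mult_left_mono D z) auto
          finally show ?thesis
            by (simp add: algebra_simps)
        qed
        from norm_hardy_inner_le[OF dH[OF s] QH[OF s] this]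
        have 1: "cmod (hardy_inner (d s) (\<lambda>z. Q s z - Q s\<^sub>0 z)) \<le> (B + 1) * \<bar>s - s\<^sub>0\<bar> * hardy_norm (d s)" .
        have 2: "cmod (hardy_inner (f s\<^sub>0) (E s)) \<le> \<epsilon> * \<bar>s - s\<^sub>0\<bar> * hardy_norm (f s\<^sub>0)"
          by (intro norm_hardy_inner_le f S EH s le)
        have "cmod (R s) \<le> (B + 1) * \<bar>s - s\<^sub>0\<bar> * hardy_norm (d s) + \<epsilon> * \<bar>s - s\<^sub>0\<bar> * hardy_norm (f s\<^sub>0)"
          unfolding R_def by (rule norm_triangle_le[OF add_mono[OF 1 2]])
        also have "\<dots> = \<bar>s - s\<^sub>0\<bar> * ((B + 1) * hardy_norm (d s) + \<epsilon> * hardy_norm (f s\<^sub>0))"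
          by (simp add: algebra_simps)
        also have "\<dots> < \<bar>s - s\<^sub>0\<bar> * e"
        proof (rule mult_strict_left_mono)
          have "(B + 1) * hardy_norm (d s) < e / 2"
            using small B by (simp add: field_simps)
          then show "(B + 1) * hardy_norm (d s) + \<epsilon> * hardy_norm (f s\<^sub>0) < e"
            using \<epsilon>(3) by simp
        qed (use neq in simp)
        finally show "dist (norm (R s - R s\<^sub>0 - 0) / norm (s - s\<^sub>0)) 0 < e"
          using neq by (simp add: R0 field_simps)
      qed
    qed
  qed auto
  then have R': "(R has_vector_derivative 0) (at s\<^sub>0)"
    by (simp add: has_vector_derivative_def)
  have "((\<lambda>s. (s - s\<^sub>0) *\<^sub>R hardy_inner (f s\<^sub>0) D) has_vector_derivative hardy_inner (f s\<^sub>0) D) (at s\<^sub>0)"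
    by (auto intro!: derivative_eq_intros)
  from has_vector_derivative_add[OF deriv has_vector_derivative_add[OF this R']]
  have "((\<lambda>s. hardy_inner (f s) (Q s\<^sub>0) + ((s - s\<^sub>0) *\<^sub>R hardy_inner (f s\<^sub>0) D + R s))
      has_vector_derivative a + hardy_inner (f s\<^sub>0) D) (at s\<^sub>0)"
    by simp
  moreover have "hardy_inner (f s) (Q s\<^sub>0) + ((s - s\<^sub>0) *\<^sub>R hardy_inner (f s\<^sub>0) D + R s) = hardy_inner (f s) (Q s)"
    if s: "s \<in> S" for s
  proof -
    have Q_eq: "(\<lambda>z. 1 * Q s z + (-1) * Q s\<^sub>0 z) = (\<lambda>z. Q s z - Q s\<^sub>0 z)"
      by auto
    have "hardy_inner (f s\<^sub>0) (E s) = hardy_inner (f s\<^sub>0) (\<lambda>z. Q s z - Q s\<^sub>0 z) - (s - s\<^sub>0) *\<^sub>R hardy_inner (f s\<^sub>0) D"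
      unfolding E_def[abs_def]
      using hardy_inner_combine_right[OF hardy_space_combine[OF Q[OF s] Q[OF S(2)], of 1 "-1"] D(1) f[OF S(2)],
          of 1 "- of_real (s - s\<^sub>0)"]
      by (simp add: Q_eq scaleR_conv_of_real left_diff_distrib)
    moreover have "hardy_inner (d s) (\<lambda>z. Q s z - Q s\<^sub>0 z)
      = hardy_inner (f s) (\<lambda>z. Q s z - Q s\<^sub>0 z) - hardy_inner (f s\<^sub>0) (\<lambda>z. Q s z - Q s\<^sub>0 z)"
      unfolding d_def by (intro hardy_inner_diff_left f s S QH)
    moreover have "hardy_inner (f s) (\<lambda>z. Q s z - Q s\<^sub>0 z) = hardy_inner (f s) (Q s) - hardy_inner (f s) (Q s\<^sub>0)"
      using hardy_inner_combine_right[OF Q[OF s] Q[OF S(2)] f[OF s], of 1 "-1"] by simp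
    ultimately show ?thesis
      by (simp add: R_def)
  qed
  ultimately show ?thesis
    by (rule has_vector_derivative_transform_within_open[OF _ S])
qed

text \<open>The mean value inequality in \<open>s\<close> for each fixed \<open>z\<close>; the
  oscillation of the derivative near \<open>s\<^sub>0\<close> is bounded uniformly in
  \<open>z\<close>, hence so is the error.\<close>

lemma eventually_uniform_linearization:
  fixes q q' :: "real \<Rightarrow> 'a \<Rightarrow> 'b::real_normed_vector"
  assumes S: "open S" "s\<^sub>0 \<in> S"
    and deriv: "\<And>s z. s \<in> S \<Longrightarrow> z \<in> C \<Longrightarrow> ((\<lambda>s. q s z) has_vector_derivative q' s z) (at s)"
    and cont: "\<And>\<epsilon>. \<epsilon> > 0 \<Longrightarrow> eventually (\<lambda>s. \<forall>z\<in>C. norm (q' s z - q' s\<^sub>0 z) \<le> \<epsilon>) (nhds s\<^sub>0)"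
    and \<epsilon>: "\<epsilon> > 0"
  shows "eventually (\<lambda>s. \<forall>z\<in>C. norm (q s z - q s\<^sub>0 z - (s - s\<^sub>0) *\<^sub>R q' s\<^sub>0 z) \<le> \<epsilon> * \<bar>s - s\<^sub>0\<bar>) (at s\<^sub>0)"
proof -
  have "eventually (\<lambda>s. s \<in> S \<and> (\<forall>z\<in>C. norm (q' s z - q' s\<^sub>0 z) \<le> \<epsilon>)) (nhds s\<^sub>0)"
    using eventually_nhds_in_open[OF S] cont[OF \<epsilon>] by (rule eventually_conj)
  then obtain \<delta> where \<delta>0: "\<delta> > 0"
    and \<delta>: "\<forall>s. dist s s\<^sub>0 < \<delta> \<longrightarrow> s \<in> S \<and> (\<forall>z\<in>C. norm (q' s z - q' s\<^sub>0 z) \<le> \<epsilon>)"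
    unfolding eventually_nhds_metric by blast
  have "norm (q s z - q s\<^sub>0 z - (s - s\<^sub>0) *\<^sub>R q' s\<^sub>0 z) \<le> norm (s - s\<^sub>0) * \<epsilon>"
    if s: "dist s s\<^sub>0 < \<delta>" and z: "z \<in> C" for s z
  proof (rule vector_differentiable_bound_linearization[where S = "ball s\<^sub>0 \<delta>" and f' = "\<lambda>s. q' s z"])
    fix t assume "t \<in> ball s\<^sub>0 \<delta>"
    then have t: "dist t s\<^sub>0 < \<delta>"
      by (simp add: dist_commute)
    show "((\<lambda>s. q s z) has_vector_derivative q' t z) (at t within ball s\<^sub>0 \<delta>)"
      using t \<delta> by (intro has_vector_derivative_at_within[OF deriv[OF _ z]]) blast
    show "norm (q' t z - q' s\<^sub>0 z) \<le> \<epsilon>"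
      using t \<delta> z by blast
  next
    show "closed_segment s\<^sub>0 s \<subseteq> ball s\<^sub>0 \<delta>"
      using s \<delta>0 by (intro closed_segment_subset convex_ball) (auto simp: dist_commute)
    show "s\<^sub>0 \<in> ball s\<^sub>0 \<delta>"
      using \<delta>0 by simp
  qed
  then have "\<forall>s. s \<noteq> s\<^sub>0 \<and> dist s s\<^sub>0 < \<delta> \<longrightarrow>
      (\<forall>z\<in>C. norm (q s z - q s\<^sub>0 z - (s - s\<^sub>0) *\<^sub>R q' s\<^sub>0 z) \<le> \<epsilon> * \<bar>s - s\<^sub>0\<bar>)"
    by (simp add: mult.commute)
  with \<delta>0 show ?thesis
    unfolding eventually_at by blast
qed

text \<open>Compactness of \<open>C\<close> turns joint continuity into uniformity in
  \<open>z\<close>.\<close>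

lemma eventually_uniformly_close:
  fixes q :: "'a::metric_space \<Rightarrow> 'b::metric_space \<Rightarrow> 'c::real_normed_vector"
  assumes "open S" "s\<^sub>0 \<in> S" "compact C" "continuous_on (S \<times> C) (\<lambda>(s, z). q s z)" "\<epsilon> > 0"
  shows "eventually (\<lambda>s. \<forall>z\<in>C. norm (q s z - q s\<^sub>0 z) \<le> \<epsilon>) (nhds s\<^sub>0)"
proof -
  obtain X where X: "s\<^sub>0 \<in> X" "open X" "\<forall>s\<in>X \<inter> S. \<forall>z\<in>C. dist (q s z) (q s\<^sub>0 z) \<le> \<epsilon>"
    by (rule continuous_on_prod_compactE[OF assms(4,3,2,5), unfolded prod.case]) (rule that)
  have "eventually (\<lambda>s. s \<in> X \<inter> S) (nhds s\<^sub>0)"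
    using X assms by (intro eventually_nhds_in_open) auto
  then show ?thesis
    by eventually_elim (use X(3) in \<open>auto simp: dist_norm\<close>)
qed

text \<open>The derivative of the kernel with respect to its parameter \<open>x\<close> in direction
  \<open>v\<close>, obtained from the conjugate symmetry of the kernel. It represents the
  directional derivative at \<open>x\<close> as an inner product.\<close>

definition hardy_kernel_deriv :: "complex ^ 'n::finite \<Rightarrow> complex ^ 'n \<Rightarrow> 'n cfun" where
  "hardy_kernel_deriv x v = (\<lambda>z. if z \<in> unit_polydisc then cnj (kernel_deriv z x v) else 0)"

lemma
  fixes x :: "complex ^ 'n::finite"
  assumes x: "x \<in> unit_polydisc"
  shows hardy_kernel_deriv_in_hardy_space: "hardy_kernel_deriv x v \<in> hardy_space"
    and hardy_kernel_deriv_bounded: "\<exists>B. \<forall>z\<in>unit_polydisc. cmod (hardy_kernel_deriv x v z) \<le> B"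
proof -
  \<comment> \<open>In \<open>cnj (kernel_deriv z x v)\<close> the variable \<open>z\<close> is the
    parameter of the kernel; carrying out the conjugation shows that the dependence on
    \<open>z\<close> is holomorphic.\<close>
  have eq: "cnj (kernel_deriv z x v) = kernel_prod x z * (\<Sum>i\<in>UNIV. cnj (v $ i) * z $ i * inverse (1 - cnj (x $ i) * z $ i))" for z
    by (simp add: kernel_deriv_def kernel_prod_cnj[of x z] mult_ac)
  have aff: "cn_holomorphic_on (\<lambda>w. 1 + (- cnj (x $ i)) * w $ i) unit_polydisc" for i
    by (intro cn_holomorphic_on_add cn_holomorphic_on_mult cn_holomorphic_on_const cn_holomorphic_on_nth)
  have nz: "1 - cnj (x $ i) * z $ i \<noteq> 0" if "z \<in> unit_polydisc" for z i
    using x that by (intro one_minus_cnj_mult_neq_0) (auto simp: polydisc_def less_imp_le)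
  have hol: "cn_holomorphic_on (\<lambda>z. cnj (kernel_deriv z x v)) unit_polydisc"
    unfolding eq using aff nz
    by (intro cn_holomorphic_on_mult cn_holomorphic_on_kernel_prod[OF x] cn_holomorphic_on_sum
        cn_holomorphic_on_const cn_holomorphic_on_nth cn_holomorphic_on_inverse) auto
  have cont: "continuous_on (unit_polydisc \<union> torus) (\<lambda>z. cnj (kernel_deriv z x v))"
    using x unit_polydisc_torus_subset by (intro continuous_intros kernel_domainI) auto
  show "hardy_kernel_deriv x v \<in> hardy_space"
    unfolding hardy_kernel_deriv_def by (rule hardy_spaceI_continuous_torus[OF hol cont])
  obtain B where "\<And>z. z \<in> unit_polydisc \<Longrightarrow> cmod (cnj (kernel_deriv z x v)) \<le> B"
    using holomorphic_continuous_torus_bounded[OF hol cont] by blast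
  then show "\<exists>B. \<forall>z\<in>unit_polydisc. cmod (hardy_kernel_deriv x v z) \<le> B"
    by (intro exI[of _ B]) (auto simp: hardy_kernel_deriv_def)
qed

text \<open>The function \<open>s \<mapsto> f (x + s v)\<close> is the inner product of
  \<open>f\<close> with a moving kernel. At 0 it is differentiated by the chain rule and by the
  product rule with constant \<open>f\<close>, and derivatives are unique.\<close>

lemma hardy_inner_hardy_kernel_deriv:
  fixes f :: "'n::finite cfun"
  assumes f: "f \<in> hardy_space" and x: "x \<in> unit_polydisc" and L: "(f has_derivative L) (at x)"
  shows "hardy_inner f (hardy_kernel_deriv x v) = L v"
proof -
  define S where "S = (\<lambda>s::real. x + s *\<^sub>R v) -` unit_polydisc"
  have S: "open S" "0 \<in> S"
    unfolding S_def using x by (auto intro!: open_vimage continuous_intros)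
  have SD: "x + s *\<^sub>R v \<in> unit_polydisc" if "s \<in> S" for s
    using that by (simp add: S_def)
  obtain B where B: "\<And>z. z \<in> unit_polydisc \<Longrightarrow> cmod (hardy_kernel_deriv x v z) \<le> B"
    using hardy_kernel_deriv_bounded[OF x] by blast
  have path: "((\<lambda>s. x + s *\<^sub>R v) has_vector_derivative v) (at s)" for s
    by (auto intro!: derivative_eq_intros)
  have "((\<lambda>s. hardy_inner f (hardy_kernel (x + s *\<^sub>R v))) has_vector_derivative
      0 + hardy_inner f (hardy_kernel_deriv x v)) (at 0)"
  proof (rule has_vector_derivative_hardy_inner[OF S, where f = "\<lambda>_. f"])
    fix \<epsilon> :: real assume \<epsilon>: "\<epsilon> > 0"
    \<comment> \<open>The closed polydisc provides the compactness needed for uniformity in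
      \<open>z\<close>; the kernel is regular up to its boundary because \<open>x + s v\<close>
      stays inside.\<close>
    have "eventually (\<lambda>s. \<forall>z\<in>closed_polydisc 1. cmod (kernel_prod (x + s *\<^sub>R v) z - kernel_prod (x + 0 *\<^sub>R v) z
        - (s - 0) *\<^sub>R cnj (kernel_deriv z (x + 0 *\<^sub>R v) v)) \<le> \<epsilon> * \<bar>s - 0\<bar>) (at 0)"
    proof (rule eventually_uniform_linearization[OF S _ _ \<epsilon>])
      fix s z assume s: "s \<in> S" and z: "z \<in> (closed_polydisc 1 :: (complex ^ 'n) set)"
      have "((\<lambda>s. kernel_prod z (x + s *\<^sub>R v)) has_vector_derivative kernel_deriv z (x + s *\<^sub>R v) v) (at s)"
        by (intro has_vector_derivative_compose_path[OF has_derivative_kernel_prod path] kernel_domainI SD s z)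
      then show "((\<lambda>s. kernel_prod (x + s *\<^sub>R v) z) has_vector_derivative cnj (kernel_deriv z (x + s *\<^sub>R v) v)) (at s)"
        by (subst kernel_prod_cnj) (rule has_vector_derivative_cnj)
    next
      fix \<epsilon> :: real assume \<epsilon>: "\<epsilon> > 0"
      show "\<forall>\<^sub>F s in nhds 0. \<forall>z\<in>closed_polydisc 1.
          cmod (cnj (kernel_deriv z (x + s *\<^sub>R v) v) - cnj (kernel_deriv z (x + 0 *\<^sub>R v) v)) \<le> \<epsilon>"
      proof (rule eventually_uniformly_close[OF S compact_closed_polydisc _ \<epsilon>])
        show "continuous_on (S \<times> closed_polydisc 1) (\<lambda>(s, z). cnj (kernel_deriv z (x + s *\<^sub>R v) v))"
          unfolding case_prod_beta by (intro continuous_intros kernel_domainI) (auto intro: SD)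
      qed
    qed
    moreover have "eventually (\<lambda>s. s \<in> S) (at 0)"
      using S eventually_at_topological by blast
    ultimately show "eventually (\<lambda>s. \<forall>z\<in>unit_polydisc. cmod (hardy_kernel (x + s *\<^sub>R v) z
        - hardy_kernel (x + 0 *\<^sub>R v) z - (s - 0) *\<^sub>R hardy_kernel_deriv x v z) \<le> \<epsilon> * \<bar>s - 0\<bar>) (at 0)"
    proof eventually_elim
      case (elim s)
      show ?case
      proof
        fix z :: "complex ^ 'n" assume z: "z \<in> unit_polydisc"
        then have "z \<in> closed_polydisc 1"
          using polydisc_subset_closed by blast
        with elim z show "cmod (hardy_kernel (x + s *\<^sub>R v) z
          - hardy_kernel (x + 0 *\<^sub>R v) z - (s - 0) *\<^sub>R hardy_kernel_deriv x v z) \<le> \<epsilon> * \<bar>s - 0\<bar>"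
          by (simp add: hardy_kernel_eq hardy_kernel_deriv_def)
      qed
    qed
  qed (use f x B SD in \<open>auto simp: hardy_norm_zero intro!: hardy_kernel_in_hardy_space hardy_kernel_deriv_in_hardy_space\<close>)
  then have "((\<lambda>s. f (x + s *\<^sub>R v)) has_vector_derivative hardy_inner f (hardy_kernel_deriv x v)) (at 0)"
    unfolding add_0
    by (rule has_vector_derivative_transform_within_open[OF _ S]) (simp add: hardy_inner_hardy_kernel f SD)
  moreover have "((\<lambda>s. f (x + s *\<^sub>R v)) has_vector_derivative L v) (at 0)"
    by (rule has_vector_derivative_compose_path[OF _ path]) (simp add: L)
  ultimately show ?thesis
    by (rule vector_derivative_unique_at)
qed

subsection \<open>The generator and its adjoints\<close>

text \<open>Expanding \<open>F z\<close> in the standard basis turns the sum of partial derivatives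
  into the total derivative, the form in which the chain rule along the flow applies.\<close>

lemma koopman_gen_has_derivative:
  fixes F :: "complex ^ 'n::finite \<Rightarrow> complex ^ 'n"
  assumes z: "z \<in> unit_polydisc" and f: "(f has_derivative L) (at z)" and L: "\<And>c v. L (c *s v) = c * L v"
  shows "koopman_gen F f z = L (F z)"
proof -
  have "partial_deriv k f z = L (axis k 1)" for k
  proof -
    have "(\<chi> i. if i = k then z $ k else z $ i) = z"
      by (simp add: vec_eq_iff)
    with slice_has_field_derivative[of f L k "z $ k" "\<lambda>i. z $ i", OF _ L] f show ?thesis
      unfolding partial_deriv_def by (intro DERIV_imp_deriv) simp
  qed
  then have "koopman_gen F f z = (\<Sum>k\<in>UNIV. L (F z $ k *s axis k 1))"
    using z by (simp add: koopman_gen_def L)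
  also have "\<dots> = L (\<Sum>k\<in>UNIV. F z $ k *s axis k 1)"
    by (rule linear_sum[symmetric, OF has_derivative_linear[OF f]])
  finally show ?thesis
    by (simp add: basis_expansion)
qed

text \<open>This holds on the whole Hardy space, not just on the domain of the generator. It
  therefore identifies \<open>koopman_gen F g\<close> for a \<open>g\<close> whose membership in the
  domain is still to be shown.\<close>

lemma koopman_gen_eq_hardy_inner:
  assumes f: "f \<in> hardy_space" and x: "x \<in> unit_polydisc"
  shows "koopman_gen F f x = hardy_inner f (hardy_kernel_deriv x (F x))"
proof -
  obtain L where L: "(f has_derivative L) (at x)" "\<And>c v. L (c *s v) = c * L v"
    using cn_holomorphic_onE[OF hardy_space_holomorphic[OF f] x] by blast
  show ?thesis
    using koopman_gen_has_derivative[OF x L] hardy_inner_hardy_kernel_deriv[OF f x L(1)] by simp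
qed

lemma koopman_gen_hardy_kernel:
  assumes x: "x \<in> unit_polydisc"
  shows "koopman_gen F (hardy_kernel x) = (\<lambda>z. if z \<in> unit_polydisc then kernel_deriv x z (F z) else 0)"
proof
  fix z
  show "koopman_gen F (hardy_kernel x) z = (if z \<in> unit_polydisc then kernel_deriv x z (F z) else 0)"
  proof (cases "z \<in> unit_polydisc")
    case True
    have "(kernel_prod x has_derivative kernel_deriv x z) (at z)"
      using True x polydisc_subset_closed by (intro has_derivative_kernel_prod kernel_domainI) auto
    then have "(hardy_kernel x has_derivative kernel_deriv x z) (at z)"
      by (rule has_derivative_transform_within_open[OF _ open_polydisc True]) (simp add: hardy_kernel_eq)
    from koopman_gen_has_derivative[OF True this kernel_deriv_scale] True show ?thesis
      by simp
  qed (simp add: koopman_gen_def)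
qed

text \<open>Since \<open>x\<close> is interior, the kernel and its derivative are regular up to the
  torus. As \<open>F\<close> is continuous there too, so is the image of the kernel under the
  generator, which puts it into the Hardy space.\<close>

lemma hardy_kernel_in_koopman_gen_dom:
  assumes F: "cn_map_holomorphic_on F unit_polydisc" "continuous_on (unit_polydisc \<union> torus) F"
    and x: "x \<in> unit_polydisc"
  shows "hardy_kernel x \<in> koopman_gen_dom F"
proof -
  have aff: "cn_holomorphic_on (\<lambda>w. 1 + (- cnj (x $ i)) * w $ i) unit_polydisc" for i
    by (intro cn_holomorphic_on_add cn_holomorphic_on_mult cn_holomorphic_on_const cn_holomorphic_on_nth)
  have nz: "1 - cnj (x $ i) * z $ i \<noteq> 0" if "z \<in> unit_polydisc" for z i
    using x that by (intro one_minus_cnj_mult_neq_0) (auto simp: polydisc_def less_imp_le)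
  have "cn_holomorphic_on (\<lambda>z. kernel_deriv x z (F z)) unit_polydisc"
    unfolding kernel_deriv_def using aff nz F(1)
    by (intro cn_holomorphic_on_mult cn_holomorphic_on_kernel_prod[OF x] cn_holomorphic_on_sum
        cn_holomorphic_on_const cn_holomorphic_on_inverse) (auto simp: cn_map_holomorphic_on_def)
  moreover have "continuous_on (unit_polydisc \<union> torus) (\<lambda>z. kernel_deriv x z (F z))"
    using x unit_polydisc_torus_subset F by (intro continuous_intros kernel_domainI) auto
  ultimately have "koopman_gen F (hardy_kernel x) \<in> hardy_space"
    unfolding koopman_gen_hardy_kernel[OF x] by (rule hardy_spaceI_continuous_torus)
  then show ?thesis
    by (simp add: koopman_gen_dom_def hardy_kernel_in_hardy_space x)
qed

lemma hardy_space_eqI: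
  assumes "u \<in> hardy_space" "u' \<in> hardy_space" "\<And>x. x \<in> unit_polydisc \<Longrightarrow> u x = u' x"
  shows "u = u'"
  using assms hardy_space_outside by (metis ext)

text \<open>Kernels in the domain do the work of its density: by the reproducing property they
  determine the adjoint value pointwise, so the \<open>THE\<close> in \<open>adjoint_op\<close> has
  a unique candidate.\<close>

lemma adjoint_op_eqI:
  assumes ker: "\<And>x. x \<in> unit_polydisc \<Longrightarrow> hardy_kernel x \<in> Dom"
    and u: "u \<in> hardy_space" "\<And>f. f \<in> Dom \<Longrightarrow> hardy_inner (A f) g = hardy_inner f u"
  shows "adjoint_op Dom A g = u"
  unfolding adjoint_op_def
proof (rule the_equality)
  fix u' assume u': "u' \<in> hardy_space \<and> (\<forall>f\<in>Dom. hardy_inner (A f) g = hardy_inner f u')"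
  show "u' = u"
  proof (rule hardy_space_eqI)
    fix x :: "complex ^ 'a" assume x: "x \<in> unit_polydisc"
    have "hardy_inner (hardy_kernel x) u' = hardy_inner (hardy_kernel x) u"
      using u(2)[OF ker[OF x]] u' ker[OF x] by simp
    then have "cnj (hardy_inner u' (hardy_kernel x)) = cnj (hardy_inner u (hardy_kernel x))"
      using hardy_inner_cnj[OF _ hardy_kernel_in_hardy_space[OF x]] u(1) u' by simp
    then show "u' x = u x"
      using hardy_inner_hardy_kernel[OF _ x] u(1) u' by simp
  qed (use u u' in auto)
qed (use u in auto)

abbreviation "dual_dom F \<equiv> adjoint_dom (koopman_gen_dom F) (koopman_gen F)"

abbreviation "dual_gen F \<equiv> adjoint_op (koopman_gen_dom F) (koopman_gen F)"

context
  fixes F :: "complex ^ 'n::finite \<Rightarrow> complex ^ 'n"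
  assumes F: "cn_map_holomorphic_on F unit_polydisc" "continuous_on (unit_polydisc \<union> torus) F"
begin

lemma hardy_kernel_adjoint:
  assumes x: "x \<in> unit_polydisc"
  shows "hardy_kernel x \<in> dual_dom F" "dual_gen F (hardy_kernel x) = hardy_kernel_deriv x (F x)"
proof -
  have eq: "hardy_inner (koopman_gen F f) (hardy_kernel x) = hardy_inner f (hardy_kernel_deriv x (F x))" if "f \<in> koopman_gen_dom F" for f
    using that by (simp add: koopman_gen_dom_def hardy_inner_hardy_kernel x koopman_gen_eq_hardy_inner)
  then show "hardy_kernel x \<in> dual_dom F"
    unfolding adjoint_dom_def
    using hardy_kernel_in_hardy_space[OF x] hardy_kernel_deriv_in_hardy_space[OF x] by blast
  show "dual_gen F (hardy_kernel x) = hardy_kernel_deriv x (F x)"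
    by (rule adjoint_op_eqI[OF hardy_kernel_in_koopman_gen_dom[OF F] hardy_kernel_deriv_in_hardy_space[OF x] eq])
qed

text \<open>The inclusion of \<open>A_F\<close> in its second adjoint is conjugate symmetry applied
  to the definition of the adjoint. The value is unique because kernels lie in
  \<open>dual_dom F\<close>.\<close>

lemma biadjoint_koopman_gen:
  assumes g: "g \<in> koopman_gen_dom F"
  shows "g \<in> adjoint_dom (dual_dom F) (dual_gen F)" "adjoint_op (dual_dom F) (dual_gen F) g = koopman_gen F g"
proof -
  have gH: "g \<in> hardy_space" "koopman_gen F g \<in> hardy_space"
    using g by (auto simp: koopman_gen_dom_def)
  have eq: "hardy_inner (dual_gen F f) g = hardy_inner f (koopman_gen F g)" if f: "f \<in> dual_dom F" for f
  proof -
    from f obtain u where u: "u \<in> hardy_space" "\<And>h. h \<in> koopman_gen_dom F \<Longrightarrow> hardy_inner (koopman_gen F h) f = hardy_inner h u"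
      and fH: "f \<in> hardy_space"
      unfolding adjoint_dom_def by blast
    have "dual_gen F f = u"
      by (rule adjoint_op_eqI[OF hardy_kernel_in_koopman_gen_dom[OF F] u])
    then show ?thesis
      using u(2)[OF g] hardy_inner_cnj[OF gH(1) u(1)] hardy_inner_cnj[OF gH(2) fH] by simp
  qed
  then show "g \<in> adjoint_dom (dual_dom F) (dual_gen F)"
    unfolding adjoint_dom_def[of "dual_dom F"] using gH by blast
  show "adjoint_op (dual_dom F) (dual_gen F) g = koopman_gen F g"
    by (rule adjoint_op_eqI[OF hardy_kernel_adjoint(1) gH(2) eq])
qed

text \<open>Kernels lie in the domain of the adjoint, and testing against them determines the value of the
  second adjoint pointwise.\<close>

lemma biadjoint_dom_koopman_gen:
  assumes g: "g \<in> adjoint_dom (dual_dom F) (dual_gen F)"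
  shows "g \<in> koopman_gen_dom F"
proof -
  from g obtain u where gH: "g \<in> hardy_space" and u: "u \<in> hardy_space"
    "\<And>f. f \<in> dual_dom F \<Longrightarrow> hardy_inner (dual_gen F f) g = hardy_inner f u"
    unfolding adjoint_dom_def[of "dual_dom F"] by blast
  have "koopman_gen F g x = u x" for x
  proof (cases "x \<in> unit_polydisc")
    case x: True
    have "hardy_inner (hardy_kernel_deriv x (F x)) g = hardy_inner (hardy_kernel x) u"
      using u(2)[OF hardy_kernel_adjoint(1)[OF x]] by (simp add: hardy_kernel_adjoint(2)[OF x])
    then have "hardy_inner g (hardy_kernel_deriv x (F x)) = hardy_inner u (hardy_kernel x)"
      using hardy_inner_cnj[OF gH hardy_kernel_deriv_in_hardy_space[OF x]]
        hardy_inner_cnj[OF u(1) hardy_kernel_in_hardy_space[OF x]] by simp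
    then show ?thesis
      by (simp add: koopman_gen_eq_hardy_inner gH x hardy_inner_hardy_kernel u(1))
  qed (simp add: koopman_gen_def hardy_space_outside u(1))
  then have "koopman_gen F g = u"
    by blast
  then show ?thesis
    using gH u(1) by (simp add: koopman_gen_dom_def)
qed

end

lemma at_0_within_atLeast_neq_bot: "at (0::real) within {0..} \<noteq> bot"
  by (simp add: at_within_Ici_at_right)

lemma has_vector_derivative_norm_bound:
  fixes f :: "real \<Rightarrow> 'a::real_normed_vector"
  assumes "convex S" and deriv: "\<And>t. t \<in> S \<Longrightarrow> (f has_vector_derivative f' t) (at t within S)"
    and M: "\<And>t. t \<in> S \<Longrightarrow> norm (f' t) \<le> M" and st: "s \<in> S" "t \<in> S"
  shows "norm (f t - f s) \<le> M * \<bar>t - s\<bar>"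
proof -
  have "norm (f t - f s) \<le> M * norm (t - s)"
  proof (rule differentiable_bound[OF assms(1), where f' = "\<lambda>t h. h *\<^sub>R f' t"])
    fix t assume "t \<in> S"
    then show "(f has_derivative (\<lambda>h. h *\<^sub>R f' t)) (at t within S)"
      using deriv by (simp add: has_vector_derivative_def)
    show "onorm (\<lambda>h. h *\<^sub>R f' t) \<le> M"
      using M[OF \<open>t \<in> S\<close>] by (intro onorm_le) (simp add: mult.commute[of M] mult_left_mono)
  qed (use st in auto)
  then show ?thesis
    by simp
qed

lemma koopman_op_0: "(\<And>z. z \<in> unit_polydisc \<Longrightarrow> \<phi> z = z) \<Longrightarrow> f \<in> hardy_space \<Longrightarrow> koopman_op \<phi> f = f"
  by (auto simp: koopman_op_def fun_eq_iff hardy_space_outside)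

subsection \<open>The flow\<close>

locale invariant_flow =
  fixes F :: "complex ^ 'n::finite \<Rightarrow> complex ^ 'n"
    and \<phi> :: "real \<Rightarrow> complex ^ 'n \<Rightarrow> complex ^ 'n"
  assumes flow: "holomorphic_flow F \<phi>" and inv: "forward_invariant_torus \<phi>"
begin

lemma F_regular: "cn_map_holomorphic_on F unit_polydisc" "continuous_on (unit_polydisc \<union> torus) F"
  using flow by (auto simp: holomorphic_flow_def)

lemma flow_in: "0 \<le> t \<Longrightarrow> z \<in> unit_polydisc \<Longrightarrow> \<phi> t z \<in> unit_polydisc"
  using flow by (auto simp: holomorphic_flow_def)

lemma flow_hol: "0 \<le> t \<Longrightarrow> cn_map_holomorphic_on (\<phi> t) unit_polydisc"
  using flow by (auto simp: holomorphic_flow_def)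

lemma flow_0: "z \<in> unit_polydisc \<Longrightarrow> \<phi> 0 z = z"
  using flow by (auto simp: holomorphic_flow_def)

lemma flow_add: "z \<in> unit_polydisc \<Longrightarrow> 0 \<le> s \<Longrightarrow> 0 \<le> t \<Longrightarrow> \<phi> (s + t) z = \<phi> s (\<phi> t z)"
  using flow by (auto simp: holomorphic_flow_def)

lemma flow_deriv: "z \<in> unit_polydisc \<Longrightarrow> 0 \<le> t \<Longrightarrow> ((\<lambda>s. \<phi> s z) has_vector_derivative F (\<phi> t z)) (at t within {0..})"
  using flow by (auto simp: holomorphic_flow_def)

lemma F_bounded: obtains M where "0 \<le> M" "\<And>z. z \<in> unit_polydisc \<Longrightarrow> norm (F z) \<le> M"
proof -
  have "\<exists>B. \<forall>z\<in>unit_polydisc. cmod (F z $ k) \<le> B" for k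
    using F_regular holomorphic_continuous_torus_bounded[of "\<lambda>z. F z $ k"]
    by (metis cn_map_holomorphic_on_def continuous_on_component)
  then obtain B where B: "\<And>k z. z \<in> unit_polydisc \<Longrightarrow> cmod (F z $ k) \<le> B k"
    by metis
  have "norm (F z) \<le> \<bar>\<Sum>k\<in>UNIV. B k\<bar>" if "z \<in> unit_polydisc" for z
  proof -
    have "norm (F z) \<le> (\<Sum>k\<in>UNIV. cmod (F z $ k))"
      by (simp add: norm_vec_def L2_set_le_sum)
    also have "\<dots> \<le> (\<Sum>k\<in>UNIV. B k)"
      by (intro sum_mono B that)
    finally show ?thesis
      by simp
  qed
  with that[of "\<bar>\<Sum>k\<in>UNIV. B k\<bar>"] show thesis
    by simp
qed

text \<open>The constant is a bound for \<open>F\<close> and does not depend on the starting point,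
  so the flow is continuous in time uniformly over the polydisc.\<close>

lemma flow_lipschitz:
  obtains M where "0 \<le> M"
    "\<And>z s t. z \<in> unit_polydisc \<Longrightarrow> 0 \<le> s \<Longrightarrow> 0 \<le> t \<Longrightarrow> norm (\<phi> t z - \<phi> s z) \<le> M * \<bar>t - s\<bar>"
proof -
  obtain M where M: "0 \<le> M" "\<And>z. z \<in> unit_polydisc \<Longrightarrow> norm (F z) \<le> M"
    using F_bounded by blast
  have "norm (\<phi> t z - \<phi> s z) \<le> M * \<bar>t - s\<bar>" if z: "z \<in> unit_polydisc" and "0 \<le> s" "0 \<le> t" for z s t
    by (rule has_vector_derivative_norm_bound[where S = "{0..}" and f' = "\<lambda>t. F (\<phi> t z)"])
      (use that flow_deriv flow_in M(2) in auto)
  with that[OF M(1)] show thesis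
    by simp
qed

text \<open>Over the compact cone \<open>star_torus\<close> the modulus of each coordinate of the
  extension attains its maximum. It is below 1, because interior points stay in the polydisc and
  torus points are sent inside by invariance. The maximum principle carries the bound over to the
  polydisc, and the largest of finitely many bounds is the radius.\<close>

lemma flow_image_closed_polydisc:
  assumes t: "0 < t"
  obtains R where "R < 1" "\<And>z. z \<in> unit_polydisc \<Longrightarrow> \<phi> t z \<in> closed_polydisc R"
proof -
  obtain \<psi> R' where \<psi>: "continuous_on (unit_polydisc \<union> torus) \<psi>" "\<And>z. z \<in> unit_polydisc \<Longrightarrow> \<psi> z = \<phi> t z"
    and R': "R' < 1" "\<psi> ` torus \<subseteq> polydisc R'"
    using inv t unfolding forward_invariant_torus_def by metis
  have \<psi>D: "\<psi> z \<in> unit_polydisc" if "z \<in> unit_polydisc \<union> torus" for z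
  proof (cases "z \<in> unit_polydisc")
    case True
    then show ?thesis
      using flow_in[of t z] t \<psi>(2)[of z] by simp
  next
    case False
    then have "\<psi> z \<in> polydisc R'"
      using that R'(2) by blast
    then show ?thesis
      using R'(1) by (force simp: polydisc_def intro: less_trans)
  qed
  have "\<exists>R. R < 1 \<and> (\<forall>z\<in>unit_polydisc. cmod (\<phi> t z $ k) \<le> R)" for k
  proof -
    have "(1 :: real) *\<^sub>R (\<chi> i. 1) \<in> (star_torus :: (complex ^ 'n) set)"
      by (intro scaleR_in_star_torus) (auto simp: torus_def)
    then have "star_torus \<noteq> ({} :: (complex ^ 'n) set)"
      by blast
    moreover have "continuous_on star_torus (\<lambda>z. cmod (\<psi> z $ k))"
      by (intro continuous_intros continuous_on_subset[OF \<psi>(1)] star_torus_subset)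
    ultimately obtain z\<^sub>1 where z\<^sub>1: "z\<^sub>1 \<in> star_torus" "\<And>z. z \<in> star_torus \<Longrightarrow> cmod (\<psi> z $ k) \<le> cmod (\<psi> z\<^sub>1 $ k)"
      using continuous_attains_sup[OF compact_star_torus] by blast
    have "cmod (\<phi> t z $ k) \<le> cmod (\<psi> z\<^sub>1 $ k)" if z: "z \<in> unit_polydisc" for z
    proof (rule maximum_principle_polydisc[OF _ _ z])
      show "cn_holomorphic_on (\<lambda>z. \<phi> t z $ k) unit_polydisc"
        using flow_hol[of t] t by (simp add: cn_map_holomorphic_on_def)
      fix r :: real and w :: "complex ^ 'n" assume r: "0 \<le> r" "r < 1" "w \<in> torus"
      then show "cmod (\<phi> t (r *\<^sub>R w) $ k) \<le> cmod (\<psi> z\<^sub>1 $ k)"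
        using z\<^sub>1(2)[of "r *\<^sub>R w"] \<psi>(2)[of "r *\<^sub>R w"] scaleR_in_star_torus[of r w] scaleR_torus_in_polydisc[of r w] by simp
    qed
    moreover have "cmod (\<psi> z\<^sub>1 $ k) < 1"
      using \<psi>D z\<^sub>1(1) star_torus_subset by (auto simp: polydisc_def)
    ultimately show ?thesis
      by blast
  qed
  then have "\<forall>k. \<exists>R. R < 1 \<and> (\<forall>z\<in>unit_polydisc. cmod (\<phi> t z $ k) \<le> R)"
    by blast
  from choice[OF this] obtain R where R: "\<And>k. R k < 1" "\<And>k z. z \<in> unit_polydisc \<Longrightarrow> cmod (\<phi> t z $ k) \<le> R k"
    by blast
  show thesis
  proof (rule that)
    show "Max (range R) < 1"
      using R(1) by (subst Max_less_iff) auto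
    have "R k \<le> Max (range R)" for k
      by (rule Max_ge) auto
    then show "\<phi> t z \<in> closed_polydisc (Max (range R))" if "z \<in> unit_polydisc" for z
      using order_trans[OF R(2)[OF that] \<open>\<And>k. R k \<le> Max (range R)\<close>] by (simp add: closed_polydisc_def)
  qed
qed

text \<open>For \<open>t > 0\<close> the flow map sends the polydisc into a compact subset, on which
  \<open>f\<close> is bounded, so the composition is bounded; for \<open>t = 0\<close> the operator
  is the identity.\<close>

lemma koopman_op_in_hardy_space:
  assumes t: "0 \<le> t" and f: "f \<in> hardy_space"
  shows "koopman_op (\<phi> t) f \<in> hardy_space"
proof (cases "t = 0")
  case True
  then show ?thesis
    using koopman_op_0[of "\<phi> 0" f] flow_0 f by simp
next
  case False
  then have t: "0 < t"
    using t by simp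
  obtain R where R: "R < 1" "\<And>z. z \<in> unit_polydisc \<Longrightarrow> \<phi> t z \<in> closed_polydisc R"
    using flow_image_closed_polydisc[OF t] by blast
  have sub: "closed_polydisc R \<subseteq> (unit_polydisc :: (complex ^ 'n) set)"
    using R(1) by (auto simp: polydisc_def closed_polydisc_def intro: le_less_trans)
  have "compact (f ` closed_polydisc R)"
    using cn_holomorphic_on_imp_continuous_on[OF hardy_space_holomorphic[OF f]] sub
    by (intro compact_continuous_image compact_closed_polydisc) (rule continuous_on_subset)
  then obtain B where B: "\<And>z. z \<in> closed_polydisc R \<Longrightarrow> cmod (f z) \<le> B"
    using compact_imp_bounded[of "f ` closed_polydisc R"] by (auto simp: bounded_iff)
  have hol: "cn_holomorphic_on (\<lambda>z. f (\<phi> t z)) unit_polydisc"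
    using t flow_in by (intro cn_holomorphic_on_compose[OF hardy_space_holomorphic[OF f] flow_hol]) auto
  show ?thesis
    unfolding koopman_op_def
    by (rule hardy_spaceI_bounded(1)[OF holomorphic_ext0I[OF hol], of B]) (use B R(2) in auto)
qed

text \<open>Two applications of the reproducing property: both sides of the adjoint identity are
  \<open>f (\<phi> t x)\<close>.\<close>

lemma adjoint_koopman_op_hardy_kernel:
  assumes t: "0 \<le> t" and x: "x \<in> unit_polydisc"
  shows "adjoint_op hardy_space (koopman_op (\<phi> t)) (hardy_kernel x) = hardy_kernel (\<phi> t x)"
proof (rule adjoint_op_eqI)
  fix f :: "'n cfun" assume f: "f \<in> hardy_space"
  show "hardy_inner (koopman_op (\<phi> t) f) (hardy_kernel x) = hardy_inner f (hardy_kernel (\<phi> t x))"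
    using t x f by (simp add: hardy_inner_hardy_kernel koopman_op_in_hardy_space flow_in) (simp add: koopman_op_def)
qed (use t x in \<open>auto intro: hardy_kernel_in_hardy_space flow_in\<close>)

lemma koopman_gen_flow_derivative:
  assumes f: "f \<in> hardy_space" and z: "z \<in> unit_polydisc" and t: "0 \<le> t"
  shows "((\<lambda>s. f (\<phi> s z)) has_vector_derivative koopman_gen F f (\<phi> t z)) (at t within {0..})"
proof -
  obtain L where L: "(f has_derivative L) (at (\<phi> t z))" "\<And>c v. L (c *s v) = c * L v"
    using cn_holomorphic_onE[OF hardy_space_holomorphic[OF f] flow_in[OF t z]] by blast
  show ?thesis
    using has_vector_derivative_compose_path[OF L(1) flow_deriv[OF z t]]
      koopman_gen_has_derivative[OF flow_in[OF t z] L, of F] by simp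
qed

text \<open>The two forms of \<open>s \<mapsto> f (\<phi> t (\<phi> s z)) = f (\<phi> s (\<phi> t
  z))\<close> are differentiated at 0, where one-sided derivatives are unique.\<close>

lemma koopman_gen_koopman_op:
  assumes f: "f \<in> koopman_gen_dom F" and t: "0 \<le> t"
  shows "koopman_gen F (koopman_op (\<phi> t) f) = koopman_op (\<phi> t) (koopman_gen F f)"
    and "koopman_op (\<phi> t) f \<in> koopman_gen_dom F"
proof -
  have fH: "f \<in> hardy_space" "koopman_gen F f \<in> hardy_space"
    using f by (auto simp: koopman_gen_dom_def)
  have KH: "koopman_op (\<phi> t) f \<in> hardy_space"
    by (rule koopman_op_in_hardy_space[OF t fH(1)])
  show eq: "koopman_gen F (koopman_op (\<phi> t) f) = koopman_op (\<phi> t) (koopman_gen F f)"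
  proof
    fix z
    show "koopman_gen F (koopman_op (\<phi> t) f) z = koopman_op (\<phi> t) (koopman_gen F f) z"
    proof (cases "z \<in> unit_polydisc")
      case z: True
      have 1: "((\<lambda>s. koopman_op (\<phi> t) f (\<phi> s z)) has_vector_derivative koopman_gen F (koopman_op (\<phi> t) f) z) (at 0 within {0..})"
        using koopman_gen_flow_derivative[OF KH z, of 0] by (simp add: flow_0[OF z])
      have "((\<lambda>s. f (\<phi> s (\<phi> t z))) has_vector_derivative koopman_gen F f (\<phi> t z)) (at 0 within {0..})"
        using koopman_gen_flow_derivative[OF fH(1) flow_in[OF t z], of 0] by (simp add: flow_0[OF flow_in[OF t z]])
      then have 2: "((\<lambda>s. koopman_op (\<phi> t) f (\<phi> s z)) has_vector_derivative koopman_gen F f (\<phi> t z)) (at 0 within {0..})"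
      proof (rule has_vector_derivative_transform[rotated 2])
        fix s :: real assume s: "s \<in> {0..}"
        have "\<phi> s (\<phi> t z) = \<phi> t (\<phi> s z)"
          using flow_add[OF z, of s t] flow_add[OF z, of t s] s t by (simp add: add.commute)
        then show "koopman_op (\<phi> t) f (\<phi> s z) = f (\<phi> s (\<phi> t z))"
          using flow_in[of s z] s z by (simp add: koopman_op_def)
      qed simp
      show ?thesis
        using vector_derivative_unique_within[OF at_0_within_atLeast_neq_bot 1 2] z by (simp add: koopman_op_def)
    qed (simp add: koopman_gen_def koopman_op_def)
  qed
  show "koopman_op (\<phi> t) f \<in> koopman_gen_dom F"
    using KH koopman_op_in_hardy_space[OF t fH(2)] by (simp add: koopman_gen_dom_def eq)
qed

end

lemma lipschitz_abs_continuous_on_interval: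
  assumes "\<And>s t. a \<le> s \<Longrightarrow> s \<le> t \<Longrightarrow> t \<le> b \<Longrightarrow> cmod (u t - u s) \<le> B * (t - s)"
  shows "abs_continuous_on_interval a b u"
  unfolding abs_continuous_on_interval_def
proof (intro allI impI)
  fix \<epsilon> :: real assume \<epsilon>: "0 < \<epsilon>"
  show "\<exists>\<delta>>0. \<forall>(N::nat) l r. (\<forall>i<N. a \<le> l i \<and> l i \<le> r i \<and> r i \<le> b) \<longrightarrow>
        disjoint_family_on (\<lambda>i. {l i<..<r i}) {..<N} \<longrightarrow>
        (\<Sum>i<N. r i - l i) < \<delta> \<longrightarrow> (\<Sum>i<N. cmod (u (r i) - u (l i))) < \<epsilon>"
  \<comment> \<open>The denominator is positive whatever the sign of \<open>B\<close>.\<close>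
  proof (intro exI[of _ "\<epsilon> / (\<bar>B\<bar> + 1)"] conjI allI impI)
    fix N :: nat and l r :: "nat \<Rightarrow> real"
    assume lr: "\<forall>i<N. a \<le> l i \<and> l i \<le> r i \<and> r i \<le> b"
      and small: "(\<Sum>i<N. r i - l i) < \<epsilon> / (\<bar>B\<bar> + 1)"
    have "(\<Sum>i<N. cmod (u (r i) - u (l i))) \<le> (\<Sum>i<N. (\<bar>B\<bar> + 1) * (r i - l i))"
    proof (rule sum_mono)
      fix i assume "i \<in> {..<N}"
      then have i: "a \<le> l i" "l i \<le> r i" "r i \<le> b"
        using lr by auto
      have "cmod (u (r i) - u (l i)) \<le> B * (r i - l i)"
        by (rule assms[OF i])
      also have "\<dots> \<le> (\<bar>B\<bar> + 1) * (r i - l i)"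
        using i by (intro mult_right_mono) auto
      finally show "cmod (u (r i) - u (l i)) \<le> (\<bar>B\<bar> + 1) * (r i - l i)" .
    qed
    also have "\<dots> < \<epsilon>"
      unfolding sum_distrib_left[symmetric] using small by (simp add: pos_less_divide_eq mult.commute)
    finally show "(\<Sum>i<N. cmod (u (r i) - u (l i))) < \<epsilon>" .
  qed (use \<epsilon> in \<open>auto intro!: divide_pos_pos\<close>)
qed

text \<open>The supremum norm dominates the Hardy norm, and the kernel is jointly continuous on the
  open polydisc times the compact closed one.\<close>

lemma tendsto_hardy_norm_hardy_kernel:
  assumes x: "x \<in> unit_polydisc" and \<gamma>: "(\<gamma> \<longlongrightarrow> x) G" "eventually (\<lambda>s. \<gamma> s \<in> unit_polydisc) G"
  shows "((\<lambda>s. hardy_norm (\<lambda>z. hardy_kernel (\<gamma> s) z - hardy_kernel x z)) \<longlongrightarrow> 0) G"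
proof (rule tendstoI)
  fix e :: real assume e: "0 < e"
  have "continuous_on (unit_polydisc \<times> closed_polydisc 1) (\<lambda>(x, z). kernel_prod x z)"
    unfolding case_prod_beta by (intro continuous_intros kernel_domainI) auto
  from eventually_uniformly_close[OF open_polydisc x compact_closed_polydisc this, of "e / 2"] e
  have "eventually (\<lambda>y. \<forall>z\<in>closed_polydisc 1. cmod (kernel_prod y z - kernel_prod x z) \<le> e / 2) (nhds x)"
    by simp
  then have "eventually (\<lambda>s. \<forall>z\<in>closed_polydisc 1. cmod (kernel_prod (\<gamma> s) z - kernel_prod x z) \<le> e / 2) G"
    by (rule eventually_compose_filterlim[OF _ \<gamma>(1)])
  then show "eventually (\<lambda>s. dist (hardy_norm (\<lambda>z. hardy_kernel (\<gamma> s) z - hardy_kernel x z)) 0 < e) G"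
    using \<gamma>(2)
  proof eventually_elim
    case (elim s)
    have H: "(\<lambda>z. hardy_kernel (\<gamma> s) z - hardy_kernel x z) \<in> hardy_space"
      by (intro hardy_space_diff hardy_kernel_in_hardy_space elim x)
    have "hardy_norm (\<lambda>z. hardy_kernel (\<gamma> s) z - hardy_kernel x z) \<le> e / 2"
    proof (rule hardy_spaceI_bounded(2)[OF hardy_space_ext0[OF H]])
      fix z assume "z \<in> (unit_polydisc :: (complex ^ 'a) set)"
      then show "cmod (hardy_kernel (\<gamma> s) z - hardy_kernel x z) \<le> e / 2"
        using elim(1) polydisc_subset_closed by (auto simp: hardy_kernel_eq)
    qed
    then show ?case
      using e hardy_space_radial_mean(2)[OF H] by simp
  qed
qed

lemma at_within_atLeast_0: "0 < s \<Longrightarrow> at s within {0..} = at (s :: real)"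
  by (rule at_within_open_subset[of _ "{0<..}"]) auto

subsection \<open>Solutions of the dual system\<close>

text \<open>Norm convergence in one argument is paired with uniform convergence in the other. This
  gives continuity of \<open><f s, Q s>\<close> at the end points of the time interval, which the
  product rule does not reach.\<close>

lemma tendsto_hardy_inner:
  fixes f Q :: "'b \<Rightarrow> 'n::finite cfun"
  assumes f: "eventually (\<lambda>s. f s \<in> hardy_space) G" "f\<^sub>0 \<in> hardy_space"
    and Q: "eventually (\<lambda>s. Q s \<in> hardy_space) G" "Q\<^sub>0 \<in> hardy_space"
    and fl: "((\<lambda>s. hardy_norm (\<lambda>z. f s z - f\<^sub>0 z)) \<longlongrightarrow> 0) G"
    and Ql: "\<And>\<epsilon>. 0 < \<epsilon> \<Longrightarrow> eventually (\<lambda>s. \<forall>z\<in>unit_polydisc. cmod (Q s z - Q\<^sub>0 z) \<le> \<epsilon>) G"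
    and B: "\<And>s z. z \<in> unit_polydisc \<Longrightarrow> cmod (Q s z) \<le> B"
  shows "((\<lambda>s. hardy_inner (f s) (Q s)) \<longlongrightarrow> hardy_inner f\<^sub>0 Q\<^sub>0) G"
proof (rule tendstoI)
  fix e :: real assume e: "0 < e"
  have "0 \<in> (unit_polydisc :: (complex ^ 'n) set)"
    by (simp add: polydisc_def)
  from order_trans[OF norm_ge_zero B[OF this]] have B0: "0 \<le> B" .
  have f0: "0 \<le> hardy_norm f\<^sub>0"
    by (intro hardy_space_radial_mean f)
  define \<epsilon> where "\<epsilon> = e / (2 * (hardy_norm f\<^sub>0 + 1))"
  have \<epsilon>: "0 < \<epsilon>" "\<epsilon> * hardy_norm f\<^sub>0 \<le> e / 2"
    using e f0 by (auto simp: \<epsilon>_def field_simps)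
  have "eventually (\<lambda>s. hardy_norm (\<lambda>z. f s z - f\<^sub>0 z) < e / (2 * (B + 1))) G"
    using order_tendstoD(2)[OF fl, of "e / (2 * (B + 1))"] e B0 by simp
  then show "eventually (\<lambda>s. dist (hardy_inner (f s) (Q s)) (hardy_inner f\<^sub>0 Q\<^sub>0) < e) G"
    using f(1) Q(1) Ql[OF \<epsilon>(1)]
  proof eventually_elim
    case (elim s)
    have "hardy_inner (f s) (Q s) - hardy_inner f\<^sub>0 Q\<^sub>0
        = hardy_inner (\<lambda>z. f s z - f\<^sub>0 z) (Q s) + hardy_inner f\<^sub>0 (\<lambda>z. Q s z - Q\<^sub>0 z)"
      using hardy_inner_combine_right[OF elim(3) Q(2) f(2), of 1 "-1"] hardy_inner_diff_left[OF elim(2) f(2) elim(3)]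
      by simp
    moreover have "cmod (hardy_inner (\<lambda>z. f s z - f\<^sub>0 z) (Q s)) < e / 2"
    proof -
      have "cmod (hardy_inner (\<lambda>z. f s z - f\<^sub>0 z) (Q s)) \<le> B * hardy_norm (\<lambda>z. f s z - f\<^sub>0 z)"
        by (intro norm_hardy_inner_le hardy_space_diff elim f B)
      also have "\<dots> \<le> B * (e / (2 * (B + 1)))"
        using elim(1) B0 by (intro mult_left_mono) auto
      also have "\<dots> < e / 2"
        using e B0 by (simp add: field_simps)
      finally show ?thesis .
    qed
    moreover have "cmod (hardy_inner f\<^sub>0 (\<lambda>z. Q s z - Q\<^sub>0 z)) \<le> \<epsilon> * hardy_norm f\<^sub>0"
      by (rule norm_hardy_inner_le[OF f(2) hardy_space_diff[OF elim(3) Q(2)]]) (use elim(4) in blast)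
    ultimately show ?case
      using \<epsilon>(2) norm_triangle_ineq[of "hardy_inner (\<lambda>z. f s z - f\<^sub>0 z) (Q s)" "hardy_inner f\<^sub>0 (\<lambda>z. Q s z - Q\<^sub>0 z)"]
      by (simp only: dist_norm)
  qed
qed

context invariant_flow
begin

text \<open>Uniform continuity of \<open>h\<close> on \<open>K\<close> combined with the Lipschitz
  bound in time. The filter and the time change \<open>\<sigma>\<close> are general so as to serve
  limits within a closed interval as well as full neighbourhoods, both for reversed time.\<close>

lemma flow_uniformly_close:
  assumes K: "compact K" and h: "continuous_on K (h :: 'n cfun)"
    and \<sigma>: "(\<sigma> \<longlongrightarrow> \<tau>) G" "0 \<le> \<tau>" "\<And>z. z \<in> unit_polydisc \<Longrightarrow> \<phi> \<tau> z \<in> K"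
    and in_K: "eventually (\<lambda>s. 0 \<le> \<sigma> s \<and> (\<forall>z\<in>unit_polydisc. \<phi> (\<sigma> s) z \<in> K)) G"
    and \<epsilon>: "0 < \<epsilon>"
  shows "eventually (\<lambda>s. \<forall>z\<in>unit_polydisc. cmod (h (\<phi> (\<sigma> s) z) - h (\<phi> \<tau> z)) \<le> \<epsilon>) G"
proof -
  obtain M where M: "0 \<le> M"
    "\<And>z s t. z \<in> unit_polydisc \<Longrightarrow> 0 \<le> s \<Longrightarrow> 0 \<le> t \<Longrightarrow> norm (\<phi> t z - \<phi> s z) \<le> M * \<bar>t - s\<bar>"
    using flow_lipschitz by blast
  obtain \<delta> where \<delta>: "0 < \<delta>" "\<And>x y. x \<in> K \<Longrightarrow> y \<in> K \<Longrightarrow> dist y x < \<delta> \<Longrightarrow> dist (h y) (h x) < \<epsilon>"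
    using compact_uniformly_continuous[OF h K] \<epsilon> unfolding uniformly_continuous_on_def by metis
  have "eventually (\<lambda>s. dist (\<sigma> s) \<tau> < \<delta> / (M + 1)) G"
    using \<sigma>(1) \<delta>(1) M(1) by (intro tendstoD) auto
  then show ?thesis
    using in_K
  proof eventually_elim
    case (elim s)
    show ?case
    proof
      fix z :: "complex ^ 'n" assume z: "z \<in> unit_polydisc"
      have "dist (\<phi> (\<sigma> s) z) (\<phi> \<tau> z) \<le> M * \<bar>\<sigma> s - \<tau>\<bar>"
        using M(2)[OF z \<sigma>(2)] elim by (simp add: dist_norm)
      also have "\<dots> \<le> (M + 1) * \<bar>\<sigma> s - \<tau>\<bar>"
        by (intro mult_right_mono) auto
      also have "\<dots> < \<delta>"
        using elim(1) M(1) by (simp add: dist_real_def pos_less_divide_eq mult.commute)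
      finally have "dist (h (\<phi> (\<sigma> s) z)) (h (\<phi> \<tau> z)) < \<epsilon>"
        using elim(2) z \<sigma>(3) by (intro \<delta>(2)) auto
      then show "cmod (h (\<phi> (\<sigma> s) z) - h (\<phi> \<tau> z)) \<le> \<epsilon>"
        by (simp add: dist_norm)
    qed
  qed
qed

text \<open>Uniform continuity needs one compact subset of the open polydisc that contains the
  images for all times near \<open>\<tau>\<close>, not just for \<open>\<tau>\<close>
  itself.\<close>

lemma eventually_flow_in_compact:
  assumes \<tau>: "0 < \<tau>"
  obtains K where "compact K" "K \<subseteq> unit_polydisc" "\<And>z. z \<in> unit_polydisc \<Longrightarrow> \<phi> \<tau> z \<in> K"
    "eventually (\<lambda>s. 0 \<le> s \<and> (\<forall>z\<in>unit_polydisc. \<phi> s z \<in> K)) (nhds \<tau>)"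
proof -
  obtain M where M: "0 \<le> M"
    "\<And>z s t. z \<in> unit_polydisc \<Longrightarrow> 0 \<le> s \<Longrightarrow> 0 \<le> t \<Longrightarrow> norm (\<phi> t z - \<phi> s z) \<le> M * \<bar>t - s\<bar>"
    using flow_lipschitz by blast
  obtain R where R: "R < 1" "\<And>z. z \<in> unit_polydisc \<Longrightarrow> \<phi> \<tau> z \<in> closed_polydisc R"
    using flow_image_closed_polydisc[OF \<tau>] by blast
  \<comment> \<open>The radius is halfway between \<open>R\<close> and 1: by the Lipschitz bound, a
    small change of time moves points by at most the gap \<open>(1 - R) / 2\<close>.\<close>
  define K where "K = (closed_polydisc ((R + 1) / 2) :: (complex ^ 'n) set)"
  have K: "compact K" "K \<subseteq> unit_polydisc"
  proof -
    show "compact K"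
      by (simp add: K_def)
    have "(R + 1) / 2 < 1"
      using R(1) by simp
    then show "K \<subseteq> unit_polydisc"
      unfolding K_def closed_polydisc_def polydisc_def using order_le_less_trans by blast
  qed
  have R': "\<phi> \<tau> z \<in> K" if "z \<in> unit_polydisc" for z
  proof -
    have "R \<le> (R + 1) / 2"
      using R(1) by simp
    then show ?thesis
      using R(2)[OF that] unfolding K_def closed_polydisc_def using order_trans by blast
  qed
  have "eventually (\<lambda>s. dist s \<tau> < (1 - R) / 2 / (M + 1)) (nhds \<tau>)"
    using R(1) M(1) by (intro eventually_nhds_metric[THEN iffD2] exI[of _ "(1 - R) / 2 / (M + 1)"]) auto
  moreover have "eventually (\<lambda>s. s \<in> {0<..}) (nhds \<tau>)"
    using \<tau> by (intro eventually_nhds_in_open) auto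
  ultimately have "eventually (\<lambda>s. 0 \<le> s \<and> (\<forall>z\<in>unit_polydisc. \<phi> s z \<in> K)) (nhds \<tau>)"
  proof eventually_elim
    case (elim s)
    have "\<phi> s z \<in> K" if z: "z \<in> unit_polydisc" for z
      unfolding K_def closed_polydisc_def
    proof (intro CollectI allI)
      fix k
      have "cmod (\<phi> s z $ k) \<le> cmod (\<phi> \<tau> z $ k) + cmod ((\<phi> s z - \<phi> \<tau> z) $ k)"
        using norm_triangle_ineq[of "\<phi> \<tau> z $ k" "(\<phi> s z - \<phi> \<tau> z) $ k"] by simp
      also have "cmod (\<phi> \<tau> z $ k) \<le> R"
        using R(2)[OF z] by (simp add: closed_polydisc_def)
      also have "cmod ((\<phi> s z - \<phi> \<tau> z) $ k) \<le> norm (\<phi> s z - \<phi> \<tau> z)"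
        by (rule Finite_Cartesian_Product.norm_nth_le)
      also have "\<dots> \<le> M * \<bar>s - \<tau>\<bar>"
        using M(2)[OF z, of \<tau> s] elim \<tau> by simp
      also have "\<dots> \<le> (M + 1) * \<bar>s - \<tau>\<bar>"
        by (intro mult_right_mono) auto
      also have "\<dots> \<le> (1 - R) / 2"
        using elim(1) M(1) by (simp add: dist_real_def field_simps)
      finally show "cmod (\<phi> s z $ k) \<le> (R + 1) / 2"
        by (simp add: field_simps)
    qed
    with elim show ?case
      by simp
  qed
  with that K R' show thesis
    by blast
qed

lemma hardy_kernel_flow_solution:
  assumes x: "x\<^sub>0 \<in> unit_polydisc"
  shows "pseudo_weak_solution (dual_dom F) (dual_gen F) (\<lambda>t z. 0) (hardy_kernel x\<^sub>0) (\<lambda>t. hardy_kernel (\<phi> t x\<^sub>0))"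
  unfolding pseudo_weak_solution_def
proof (intro conjI allI impI ballI)
  show "hardy_kernel x\<^sub>0 \<in> kernel_span"
    unfolding kernel_span_def using x
    by (intro CollectI exI[of _ "{x\<^sub>0}"] exI[of _ "\<lambda>_. 1"]) auto
  show "hardy_kernel (\<phi> 0 x\<^sub>0) = hardy_kernel x\<^sub>0"
    by (simp add: flow_0 x)
  have flow_cont: "continuous_on {0..} (\<lambda>s. \<phi> s x\<^sub>0)"
    using flow_deriv[OF x]
    by (auto simp: continuous_on_eq_continuous_within intro: has_vector_derivative_continuous)
  show "hardy_continuous_on {0..\<tau>} (\<lambda>t. hardy_kernel (\<phi> t x\<^sub>0))" for \<tau>
    unfolding hardy_continuous_on_def
  proof (intro ballI conjI)
    fix t assume t: "t \<in> {0..\<tau>}"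
    then show "hardy_kernel (\<phi> t x\<^sub>0) \<in> hardy_space"
      by (intro hardy_kernel_in_hardy_space flow_in x) auto
    have "((\<lambda>s. \<phi> s x\<^sub>0) \<longlongrightarrow> \<phi> t x\<^sub>0) (at t within {0..\<tau>})"
      using continuous_on_subset[OF flow_cont, of "{0..\<tau>}"] t by (auto simp: continuous_on_def)
    moreover have "eventually (\<lambda>s. \<phi> s x\<^sub>0 \<in> unit_polydisc) (at t within {0..\<tau>})"
      unfolding eventually_at_filter by (rule always_eventually) (auto intro!: flow_in x)
    ultimately show "((\<lambda>s. hardy_norm (\<lambda>z. hardy_kernel (\<phi> s x\<^sub>0) z - hardy_kernel (\<phi> t x\<^sub>0) z)) \<longlongrightarrow> 0) (at t within {0..\<tau>})"
      using t by (intro tendsto_hardy_norm_hardy_kernel flow_in x) auto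
  qed
  fix g assume g': "g \<in> adjoint_dom (dual_dom F) (dual_gen F)"
  \<comment> \<open>Test functions come from the domain of the second adjoint. Membership in the
    domain of the generator puts \<open>koopman_gen F g\<close> into the Hardy space, so it is
    continuous along the orbit.\<close>
  have g: "g \<in> koopman_gen_dom F"
    by (rule biadjoint_dom_koopman_gen[OF F_regular g'])
  then have gH: "g \<in> hardy_space" "koopman_gen F g \<in> hardy_space"
    by (auto simp: koopman_gen_dom_def)
  have inner: "hardy_inner (hardy_kernel (\<phi> s x\<^sub>0)) u = cnj (u (\<phi> s x\<^sub>0))" if "0 \<le> s" "u \<in> hardy_space" for s u
    using hardy_inner_cnj[OF that(2) hardy_kernel_in_hardy_space[OF flow_in[OF that(1) x]]]
      hardy_inner_hardy_kernel[OF that(2) flow_in[OF that(1) x]] by simp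
  have deriv: "((\<lambda>s. hardy_inner (hardy_kernel (\<phi> s x\<^sub>0)) g) has_vector_derivative cnj (koopman_gen F g (\<phi> t x\<^sub>0))) (at t within {0..})"
    if t: "0 \<le> t" for t
    by (rule has_vector_derivative_transform[OF _ _ has_vector_derivative_cnj[OF koopman_gen_flow_derivative[OF gH(1) x t]]])
      (use t inner gH in auto)
  show "((\<lambda>s. hardy_inner (hardy_kernel (\<phi> s x\<^sub>0)) g) has_vector_derivative
      hardy_inner (hardy_kernel (\<phi> t x\<^sub>0)) (adjoint_op (dual_dom F) (dual_gen F) g) + hardy_inner (\<lambda>z. 0) g) (at t within {0..})"
    if t: "0 \<le> t" for t
    using deriv[OF t] inner[OF t gH(2)] by (simp add: biadjoint_koopman_gen(2)[OF F_regular g] hardy_inner_zero_left gH)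
  show "abs_continuous_on_interval 0 \<tau> (\<lambda>t. hardy_inner (hardy_kernel (\<phi> t x\<^sub>0)) g)" for \<tau>
  proof -
    \<comment> \<open>The derivative of the pairing is bounded along a compact piece of the orbit,
      so the pairing is Lipschitz there.\<close>
    have "continuous_on {0..\<tau>} (\<lambda>t. koopman_gen F g (\<phi> t x\<^sub>0))"
      by (rule continuous_on_compose2[OF cn_holomorphic_on_imp_continuous_on[OF hardy_space_holomorphic[OF gH(2)]]])
        (auto intro!: flow_in x continuous_on_subset[OF flow_cont])
    then have "bounded ((\<lambda>t. koopman_gen F g (\<phi> t x\<^sub>0)) ` {0..\<tau>})"
      by (intro compact_imp_bounded compact_continuous_image) auto
    then obtain B where "\<forall>c\<in>(\<lambda>t. koopman_gen F g (\<phi> t x\<^sub>0)) ` {0..\<tau>}. cmod c \<le> B"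
      unfolding bounded_iff by blast
    then have B: "cmod (koopman_gen F g (\<phi> t x\<^sub>0)) \<le> B" if "t \<in> {0..\<tau>}" for t
      using that by blast
    show ?thesis
    proof (rule lipschitz_abs_continuous_on_interval)
      fix s t assume st: "0 \<le> s" "s \<le> t" "t \<le> \<tau>"
      have "cmod (hardy_inner (hardy_kernel (\<phi> t x\<^sub>0)) g - hardy_inner (hardy_kernel (\<phi> s x\<^sub>0)) g) \<le> B * \<bar>t - s\<bar>"
      proof (rule has_vector_derivative_norm_bound[where S = "{0..\<tau>}" and f' = "\<lambda>t. cnj (koopman_gen F g (\<phi> t x\<^sub>0))"])
        show "((\<lambda>s. hardy_inner (hardy_kernel (\<phi> s x\<^sub>0)) g) has_vector_derivative cnj (koopman_gen F g (\<phi> r x\<^sub>0))) (at r within {0..\<tau>})"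
          if "r \<in> {0..\<tau>}" for r
          by (rule has_vector_derivative_within_subset[OF deriv]) (use that in auto)
      qed (use st B in auto)
      then show "cmod (hardy_inner (hardy_kernel (\<phi> t x\<^sub>0)) g - hardy_inner (hardy_kernel (\<phi> s x\<^sub>0)) g) \<le> B * (t - s)"
        using st by simp
    qed
  qed
qed

text \<open>For a solution \<open>f\<close> and a kernel \<open>k\<close>, the function \<open>s \<mapsto> \<langle>f s, K (t - s) k\<rangle>\<close> is constant on
  \<open>[0, t]\<close>. Its values at the end points are \<open>f t y\<close> and \<open>k\<^bsub>\<phi> t x\<^sub>0\<^esub> y\<close>, where \<open>k = k\<^sub>y\<close>.\<close>

lemma pseudo_weak_solution_unique:
  assumes x: "x\<^sub>0 \<in> unit_polydisc"
    and sol: "pseudo_weak_solution (dual_dom F) (dual_gen F) (\<lambda>t z. 0) (hardy_kernel x\<^sub>0) f"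
    and t: "0 \<le> t"
  shows "f t = hardy_kernel (\<phi> t x\<^sub>0)"
proof (cases "t = 0")
  case True
  then show ?thesis
    using sol by (simp add: pseudo_weak_solution_def flow_0 x)
next
  case False
  with t have t: "0 < t"
    by simp
  have hc: "hardy_continuous_on {0..t} f"
    using sol t unfolding pseudo_weak_solution_def by blast
  have fH: "f s \<in> hardy_space" if "s \<in> {0..t}" for s
    using hc that by (auto simp: hardy_continuous_on_def)
  have fcont: "((\<lambda>s. hardy_norm (\<lambda>z. f s z - f r z)) \<longlongrightarrow> 0) (at r within {0..t})" if "r \<in> {0..t}" for r
    using hc that by (auto simp: hardy_continuous_on_def)
  have f0: "f 0 = hardy_kernel x\<^sub>0"
    using sol by (simp add: pseudo_weak_solution_def)
  \<comment> \<open>At positive times the derivative within \<open>{0..}\<close> is two-sided, as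
    the product rule requires.\<close>
  have fderiv: "((\<lambda>s. hardy_inner (f s) g) has_vector_derivative hardy_inner (f s) (koopman_gen F g)) (at s)"
    if g: "g \<in> koopman_gen_dom F" and s: "0 < s" for g s
  proof -
    have "((\<lambda>s. hardy_inner (f s) g) has_vector_derivative hardy_inner (f s) (koopman_gen F g)) (at s within {0..})"
    proof -
      have "((\<lambda>s. hardy_inner (f s) g) has_vector_derivative
          hardy_inner (f s) (adjoint_op (dual_dom F) (dual_gen F) g) + hardy_inner (\<lambda>z. 0) g) (at s within {0..})"
        using sol biadjoint_koopman_gen(1)[OF F_regular g] less_imp_le[OF s] unfolding pseudo_weak_solution_def by blast
      moreover have "hardy_inner (\<lambda>z. 0) g = 0"
        using g by (intro hardy_inner_zero_left) (simp add: koopman_gen_dom_def)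
      ultimately show ?thesis
        by (simp add: biadjoint_koopman_gen(2)[OF F_regular g])
    qed
    then show ?thesis
      by (simp only: at_within_atLeast_0[OF s])
  qed
  show ?thesis
  proof (rule hardy_space_eqI)
    show "f t \<in> hardy_space"
      using fH t by simp
    show "hardy_kernel (\<phi> t x\<^sub>0) \<in> hardy_space"
      using t x by (intro hardy_kernel_in_hardy_space flow_in) auto
    fix y :: "complex ^ 'n" assume y: "y \<in> unit_polydisc"
    let ?k = "hardy_kernel y"
    have kd: "?k \<in> koopman_gen_dom F"
      by (rule hardy_kernel_in_koopman_gen_dom[OF F_regular y])
    then have kH: "?k \<in> hardy_space" "koopman_gen F ?k \<in> hardy_space"
      by (auto simp: koopman_gen_dom_def)
    define Q where "Q s = koopman_op (\<phi> (t - s)) ?k" for s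
    define p where "p s = hardy_inner (f s) (Q s)" for s
    have Qd: "Q s \<in> koopman_gen_dom F" and QH: "Q s \<in> hardy_space" if "s \<in> {0..t}" for s
      unfolding Q_def using that by (auto intro!: koopman_gen_koopman_op(2) kd koopman_op_in_hardy_space kH)
    have Q_eq: "Q s z = ?k (\<phi> (t - s) z)" if "z \<in> unit_polydisc" for s z
      using that by (simp add: Q_def koopman_op_def)
    \<comment> \<open>Continuity of the kernel up to the boundary gives the uniform continuity
      needed at \<open>s = t\<close>, where the flow map is the identity and its image is the whole
      polydisc.\<close>
    have kcont: "continuous_on (closed_polydisc 1) (kernel_prod y)"
      using y by (intro continuous_intros kernel_domainI) auto
    have "bounded (kernel_prod y ` closed_polydisc 1)"
      by (rule compact_imp_bounded[OF compact_continuous_image[OF kcont compact_closed_polydisc]])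
    then obtain B where B: "\<And>z. z \<in> closed_polydisc 1 \<Longrightarrow> cmod (kernel_prod y z) \<le> B"
      by (auto simp: bounded_iff)
    have B0: "0 \<le> B"
      using order_trans[OF norm_ge_zero B[of 0]] by (simp add: closed_polydisc_def)
    have cont: "continuous_on {0..t} p"
      unfolding continuous_on_def
    proof
      fix r assume r: "r \<in> {0..t}"
      have ev: "eventually (\<lambda>s. s \<in> {0..t}) (at r within {0..t})"
        by (simp add: eventually_at_filter)
      show "(p \<longlongrightarrow> p r) (at r within {0..t})"
        unfolding p_def
      proof (rule tendsto_hardy_inner[OF _ fH[OF r] _ QH[OF r] fcont[OF r]])
        show "\<forall>\<^sub>F s in at r within {0..t}. f s \<in> hardy_space" "\<forall>\<^sub>F s in at r within {0..t}. Q s \<in> hardy_space"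
          by (rule eventually_mono[OF ev], erule fH QH)+
        show "cmod (Q s z) \<le> B" if "z \<in> unit_polydisc" for s z
          using B[of "\<phi> (t - s) z"] B0 polydisc_subset_closed[of 1] by (auto simp: Q_eq[OF that] hardy_kernel_eq)
        fix \<epsilon> :: real assume \<epsilon>: "0 < \<epsilon>"
        have "\<forall>\<^sub>F s in at r within {0..t}. \<forall>z\<in>unit_polydisc. cmod (kernel_prod y (\<phi> (t - s) z) - kernel_prod y (\<phi> (t - r) z)) \<le> \<epsilon>"
        proof (rule flow_uniformly_close[OF compact_closed_polydisc kcont _ _ _ _ \<epsilon>])
          show "((\<lambda>s. t - s) \<longlongrightarrow> t - r) (at r within {0..t})"
            by (intro tendsto_intros)
          show "\<phi> (t - r) z \<in> closed_polydisc 1" if "z \<in> unit_polydisc" for z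
            using flow_in[of "t - r" z] that r polydisc_subset_closed by auto
          show "\<forall>\<^sub>F s in at r within {0..t}. 0 \<le> t - s \<and> (\<forall>z\<in>unit_polydisc. \<phi> (t - s) z \<in> closed_polydisc 1)"
            by (rule eventually_mono[OF ev]) (use flow_in polydisc_subset_closed[of 1] in auto)
        qed (use r in auto)
        with ev show "\<forall>\<^sub>F s in at r within {0..t}. \<forall>z\<in>unit_polydisc. cmod (Q s z - Q r z) \<le> \<epsilon>"
        proof eventually_elim
          case (elim s)
          then show ?case
            using r by (auto simp: Q_eq hardy_kernel_eq flow_in)
        qed
      qed
    qed
    \<comment> \<open>Strictly inside the interval the remaining time \<open>t - s\<close> is
      positive, so invariance confines the flow to a compact set and the product rule
      applies.\<close>
    have zero: "(p has_vector_derivative 0) (at s)" if s: "s \<in> {0<..<t}" for s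
    proof -
      define G where "G = koopman_gen F ?k"
      \<comment> \<open>The time derivative of \<open>Q\<close> at \<open>s\<close>. The minus sign
        is due to the reversed time, and the summand with coefficient 0 gives the shape of
        \<open>hardy_space_combine\<close>.\<close>
      define D where "D z = 0 * koopman_op (\<phi> (t - s)) G z + (-1) * koopman_op (\<phi> (t - s)) G z" for z
      have s': "s \<in> {0..t}" "0 < t - s" "0 < s"
        using s by auto
      have KG: "koopman_op (\<phi> (t - s)) G \<in> hardy_space"
        unfolding G_def using s' by (intro koopman_op_in_hardy_space kH) auto
      have DH: "D \<in> hardy_space"
        unfolding D_def by (rule hardy_space_combine[OF KG KG])
      have D_eq: "D z = - G (\<phi> (t - s) z)" if "z \<in> unit_polydisc" for z
        using that by (simp add: D_def koopman_op_def)
      obtain K where K: "compact K" "K \<subseteq> unit_polydisc" "\<And>z. z \<in> unit_polydisc \<Longrightarrow> \<phi> (t - s) z \<in> K"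
        "eventually (\<lambda>r. 0 \<le> r \<and> (\<forall>z\<in>unit_polydisc. \<phi> r z \<in> K)) (nhds (t - s))"
        using eventually_flow_in_compact[OF s'(2)] by blast
      have GK: "continuous_on K G"
        unfolding G_def
        by (rule continuous_on_subset[OF cn_holomorphic_on_imp_continuous_on[OF hardy_space_holomorphic[OF kH(2)]] K(2)])
      obtain B' where B': "\<And>z. z \<in> K \<Longrightarrow> cmod (G z) \<le> B'"
        using compact_imp_bounded[OF compact_continuous_image[OF GK K(1)]] by (auto simp: bounded_iff)
      have lim: "((\<lambda>r. t - r) \<longlongrightarrow> t - s) (nhds s)"
        by (intro tendsto_diff tendsto_const filterlim_ident)
      have "(p has_vector_derivative hardy_inner (f s) (koopman_gen F (Q s)) + hardy_inner (f s) D) (at s)"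
        unfolding p_def
      proof (rule has_vector_derivative_hardy_inner[OF open_greaterThanLessThan s _ _ DH])
        show "f r \<in> hardy_space" "Q r \<in> hardy_space" if "r \<in> {0<..<t}" for r
          using that by (auto intro: fH QH)
        show "cmod (D z) \<le> B'" if "z \<in> unit_polydisc" for z
          using B'[OF K(3)[OF that]] by (simp add: D_eq[OF that])
        show "((\<lambda>r. hardy_norm (\<lambda>z. f r z - f s z)) \<longlongrightarrow> 0) (at s)"
          using fcont[OF s'(1)] s by (simp add: at_within_Icc_at)
        show "((\<lambda>r. hardy_inner (f r) (Q s)) has_vector_derivative hardy_inner (f s) (koopman_gen F (Q s))) (at s)"
          by (rule fderiv[OF Qd[OF s'(1)] s'(3)])
        fix \<epsilon> :: real assume \<epsilon>: "0 < \<epsilon>"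
        have "\<forall>\<^sub>F r in at s. \<forall>z\<in>unit_polydisc. cmod (?k (\<phi> (t - r) z) - ?k (\<phi> (t - s) z) - (r - s) *\<^sub>R (- G (\<phi> (t - s) z))) \<le> \<epsilon> * \<bar>r - s\<bar>"
        proof (rule eventually_uniform_linearization[OF open_greaterThanLessThan s _ _ \<epsilon>])
          fix r z assume r: "r \<in> {0<..<t}" and z: "z \<in> (unit_polydisc :: (complex ^ 'n) set)"
          have "((\<lambda>s. ?k (\<phi> s z)) has_vector_derivative G (\<phi> (t - r) z)) (at (t - r) within {0..})"
            unfolding G_def using r by (intro koopman_gen_flow_derivative kH z) auto
          then have "((\<lambda>s. ?k (\<phi> s z)) has_vector_derivative G (\<phi> (t - r) z)) (at (t - r))"
            using r by (simp add: at_within_atLeast_0)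
          moreover have "((\<lambda>r. t - r) has_vector_derivative -1) (at r)"
            by (auto intro!: derivative_eq_intros)
          ultimately show "((\<lambda>r. ?k (\<phi> (t - r) z)) has_vector_derivative - G (\<phi> (t - r) z)) (at r)"
            using vector_diff_chain_at[of "\<lambda>r. t - r" "-1" r "\<lambda>s. ?k (\<phi> s z)" "G (\<phi> (t - r) z)"] by (simp add: o_def)
        next
          fix \<epsilon> :: real assume \<epsilon>: "0 < \<epsilon>"
          have "\<forall>\<^sub>F r in nhds s. \<forall>z\<in>unit_polydisc. cmod (G (\<phi> (t - r) z) - G (\<phi> (t - s) z)) \<le> \<epsilon>"
            by (rule flow_uniformly_close[OF K(1) GK lim _ K(3) eventually_compose_filterlim[OF K(4) lim] \<epsilon>])
              (use s' in auto)
          then show "\<forall>\<^sub>F r in nhds s. \<forall>z\<in>unit_polydisc. cmod (- G (\<phi> (t - r) z) - - G (\<phi> (t - s) z)) \<le> \<epsilon>"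
            by eventually_elim (simp add: norm_minus_commute)
        qed
        then show "\<forall>\<^sub>F r in at s. \<forall>z\<in>unit_polydisc. cmod (Q r z - Q s z - (r - s) *\<^sub>R D z) \<le> \<epsilon> * \<bar>r - s\<bar>"
          by eventually_elim (simp add: Q_eq D_eq)
      qed
      moreover have "hardy_inner (f s) D = - hardy_inner (f s) (koopman_op (\<phi> (t - s)) G)"
        unfolding D_def[abs_def] using hardy_inner_combine_right[OF KG KG fH[OF s'(1)], of 0 "-1"] by simp
      \<comment> \<open>The generator commutes with \<open>K\<close>, so the contributions of the
        solution and of the moving test function are opposite.\<close>
      moreover have "koopman_gen F (Q s) = koopman_op (\<phi> (t - s)) G"
        unfolding Q_def G_def using s' by (intro koopman_gen_koopman_op kd) auto
      ultimately show ?thesis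
        by simp
    qed
    \<comment> \<open>The vanishing derivative is available at interior times; continuity covers the
      exceptional points 0 and \<open>t\<close>.\<close>
    have "p t = p 0"
    proof (rule has_derivative_zero_unique_strong_interval[where k = "{0, t}", OF _ cont])
      fix s assume "s \<in> {0..t} - {0, t}"
      then have "(p has_vector_derivative 0) (at s)"
        by (intro zero) auto
      then show "(p has_derivative (\<lambda>h. 0)) (at s within {0..t})"
        unfolding has_vector_derivative_def by (simp add: has_derivative_at_withinI)
    qed (use t in auto)
    moreover have "p t = f t y"
      using fH[of t] t koopman_op_0[of "\<phi> 0" ?k] flow_0 kH
      by (simp add: p_def Q_def hardy_inner_hardy_kernel y)
    moreover have "p 0 = hardy_kernel (\<phi> t x\<^sub>0) y"
    proof -
      have "p 0 = cnj (hardy_inner (Q 0) (hardy_kernel x\<^sub>0))"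
        unfolding p_def f0 using t by (intro hardy_inner_cnj hardy_kernel_in_hardy_space x QH) auto
      also have "\<dots> = cnj (?k (\<phi> t x\<^sub>0))"
        using hardy_inner_hardy_kernel[OF QH[of 0] x] t by (simp add: Q_eq x)
      also have "\<dots> = hardy_kernel (\<phi> t x\<^sub>0) y"
        using flow_in[of t x\<^sub>0] t x y kernel_prod_cnj[of "\<phi> t x\<^sub>0" y] by (simp add: hardy_kernel_eq)
      finally show ?thesis .
    qed
    ultimately show "f t y = hardy_kernel (\<phi> t x\<^sub>0) y"
      by simp
  qed
qed

end

theorem proposition13:
  fixes F :: "complex ^ 'n::finite \<Rightarrow> complex ^ 'n"
    and \<phi> :: "real \<Rightarrow> complex ^ 'n \<Rightarrow> complex ^ 'n"
    and h :: "'m::finite \<Rightarrow> 'n cfun"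
    and x\<^sub>0 :: "complex ^ 'n"
  assumes "holomorphic_flow F \<phi>"
    and "forward_invariant_torus \<phi>"
    and "\<And>j. h j \<in> hardy_space"
    and "x\<^sub>0 \<in> unit_polydisc"
  shows "\<exists>f y. dual_koopman_solution F h x\<^sub>0 f y \<and>
           (\<forall>f' y'. dual_koopman_solution F h x\<^sub>0 f' y' \<longrightarrow> (\<forall>t\<ge>0. f' t = f t \<and> y' t = y t)) \<and>
           (\<forall>t\<ge>0. f t = adjoint_op hardy_space (koopman_op (\<phi> t)) (hardy_kernel x\<^sub>0) \<and>
                   adjoint_op hardy_space (koopman_op (\<phi> t)) (hardy_kernel x\<^sub>0) = hardy_kernel (\<phi> t x\<^sub>0))"
proof -
  interpret invariant_flow F \<phi>
    by unfold_locales (fact assms)+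
  note x = \<open>x\<^sub>0 \<in> unit_polydisc\<close>
  define f where "f t = hardy_kernel (\<phi> t x\<^sub>0)" for t
  have "dual_koopman_solution F h x\<^sub>0 f (\<lambda>t. output_op h (f t))"
    unfolding dual_koopman_solution_def f_def using hardy_kernel_flow_solution[OF x] by simp
  \<comment> \<open>The output depends only on the state at the same time, so its uniqueness follows
    from that of the state.\<close>
  moreover have "f' t = f t \<and> y' t = output_op h (f t)" if "dual_koopman_solution F h x\<^sub>0 f' y'" "0 \<le> t" for f' y' t
    using pseudo_weak_solution_unique[OF x _ that(2)] that unfolding dual_koopman_solution_def f_def by auto
  ultimately show ?thesis
    using adjoint_koopman_op_hardy_kernel[OF _ x]
    by (intro exI[of _ f] exI[of _ "\<lambda>t. output_op h (f t)"]) (auto simp: f_def)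
qed

end
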